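(* Let $n\ge1$ be an integer, $\alpha\in(-1,1)$ and $2-\alpha\le b<n+1$, and let $$K(n,\alpha,b)=(1-\alpha)\,\frac{\Gamma\left(\frac{n-2\alpha-b+3}{4}\right)\Gamma\left(\frac{n+b-1}{4}\right)\Gamma\left(\frac{\alpha+1}{2}\right)}{\Gamma\left(\frac{3-\alpha}{2}\right)\Gamma\left(\frac{n+1-b}{4}\right)\Gamma\left(\frac{n+2\alpha+b-3}{4}\right)}.$$ There are no constant $C>0$, nontrivial potential $V\ge0$ on $\mathbb R^{n+1}_+$ and exponent $p>0$ such that $$C\left(\int_{\mathbb R^{n+1}_+}V(z)|u(z)|^p\,dz\right)^{\frac2p}\le\int_{\mathbb R^{n+1}_+}y^\alpha\Phi^2(\nabla u)\,dz-K(n,\alpha,b)\int_{\mathbb R^n}\frac{u^2(x,0)}{H_0^{1-\alpha}(x)}\,dx-\frac{(\alpha+b-2)^2}{4}\int_{\mathbb R^{n+1}_+}\frac{y^\alpha u^2(z)}{\Phi_0^2(z)}\,dz$$ holds for all $u\in D^{1,2}(\mathbb R^{n+1}_+,y^\alpha dz)$.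
   Context: Points of $\mathbb R^{n+1}$ are written $z=(x,y)$, $x\in\mathbb R^n$, $y\in\mathbb R$, and $\mathbb R^{n+1}_+=\{(x,y)\in\mathbb R^{n+1}: y>0\}$. $\nabla u$ is the full gradient in $z=(x,y)$. $\Gamma$ is the Gamma function. $H:\mathbb R^n\to[0,\infty)$ is a norm (in particular $H(\lambda\xi)=|\lambda|H(\xi)$) of class $C^2(\mathbb R^n\setminus\{0\})$ such that $H^2$ is strictly convex. Its dual norm is $H_0(x)=\sup_{\xi\in\mathbb R^n\setminus\{0\}}\frac{\langle x,\xi\rangle}{H(\xi)}$, with $\langle\cdot,\cdot\rangle$ the Euclidean inner product. On $\mathbb R^{n+1}$ one sets $\Phi(\xi,\mathrm y)=\sqrt{H^2(\xi)+\mathrm y^2}$ for $\xi\in\mathbb R^n,\ \mathrm y\in\mathbb R$, and $\Phi_0(x,y)=\sqrt{H_0^2(x)+y^2}$. $D^{1,2}(\mathbb R^{n+1}_+,y^\alpha dz)$ is the completion of $C_c^\infty(\overline{\mathbb R^{n+1}_+})$ with respect to the norm $\left(\int_{\mathbb R^{n+1}_+}y^\alpha|\nabla u|^2\,dz\right)^{1/2}$; $u(x,0)$ denotes the trace of $u$ on $\{y=0\}$. "Nontrivial potential $V\ge 0$" means a nonnegative measurable function that is not almost everywhere zero. *)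

theory Defs
  imports "HOL-Analysis.Analysis"
begin

text \<open>\<open>\<real>\<^sup>n\<close> is \<^typ>\<open>real^'n\<close> with \<open>n = CARD('n)\<close>, and \<open>\<real>\<^sup>n\<^sup>+\<^sup>1\<close> is \<^typ>\<open>(real^'n) \<times> real\<close>, whose
  inner product and norm are the Euclidean ones.\<close>

definition halfspace :: "('a::euclidean_space \<times> real) set" where
  "halfspace = {z. 0 < snd z}"

primrec C_k_on :: "nat \<Rightarrow> ('a::real_normed_vector \<Rightarrow> 'b::real_normed_vector) \<Rightarrow> 'a set \<Rightarrow> bool" where
  "C_k_on 0 f S \<longleftrightarrow> continuous_on S f"
| "C_k_on (Suc k) f S \<longleftrightarrow>
     (\<forall>x\<in>S. f differentiable (at x)) \<and> (\<forall>v. C_k_on k (\<lambda>x. frechet_derivative f (at x) v) S)"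

text \<open>\<^const>\<open>C_k_on\<close> is only meaningful for open \<open>S\<close>, since it uses derivatives in the full space.\<close>

definition is_norm :: "('a::real_vector \<Rightarrow> real) \<Rightarrow> bool" where
  "is_norm H \<longleftrightarrow>
     (\<forall>x. 0 \<le> H x) \<and> (\<forall>x. H x = 0 \<longleftrightarrow> x = 0) \<and>
     (\<forall>c x. H (c *\<^sub>R x) = \<bar>c\<bar> * H x) \<and> (\<forall>x y. H (x + y) \<le> H x + H y)"

definition strictly_convex :: "('a::real_vector \<Rightarrow> real) \<Rightarrow> bool" where
  "strictly_convex f \<longleftrightarrow>
     (\<forall>x y t. x \<noteq> y \<longrightarrow> 0 < t \<longrightarrow> t < 1 \<longrightarrow>
        f ((1 - t) *\<^sub>R x + t *\<^sub>R y) < (1 - t) * f x + t * f y)"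

definition dual_norm :: "('a::real_inner \<Rightarrow> real) \<Rightarrow> 'a \<Rightarrow> real" where
  "dual_norm H x = (SUP \<xi>\<in>-{0}. (x \<bullet> \<xi>) / H \<xi>)"

definition Phi :: "('a::real_inner \<Rightarrow> real) \<Rightarrow> 'a \<times> real \<Rightarrow> real" where
  "Phi H \<zeta> = sqrt ((H (fst \<zeta>))\<^sup>2 + (snd \<zeta>)\<^sup>2)"

definition Phi_dual :: "('a::real_inner \<Rightarrow> real) \<Rightarrow> 'a \<times> real \<Rightarrow> real" where
  "Phi_dual H z = sqrt ((dual_norm H (fst z))\<^sup>2 + (snd z)\<^sup>2)"

definition grad :: "('a::euclidean_space \<Rightarrow> real) \<Rightarrow> 'a \<Rightarrow> 'a" where
  "grad f z = (\<Sum>e\<in>Basis. frechet_derivative f (at z) e *\<^sub>R e)"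

definition Cc_infinity :: "('a::euclidean_space \<Rightarrow> real) set" where
  "Cc_infinity = {\<phi>. (\<forall>k. C_k_on k \<phi> UNIV) \<and> (\<exists>S. compact S \<and> (\<forall>z. z \<notin> S \<longrightarrow> \<phi> z = 0))}"

text \<open>Elements of \<open>D\<^sup>1\<^sup>,\<^sup>2(\<real>\<^sup>n\<^sup>+\<^sup>1\<^sub>+, y\<^sup>\<alpha> dz)\<close>, the completion of \<open>C\<^sub>c\<^sup>\<infinity>\<close> of the closed half-space
  (i.e. restrictions of functions in \<^const>\<open>Cc_infinity\<close>) in the norm
  \<open>(\<integral> y\<^sup>\<alpha> |\<nabla>u|\<^sup>2 dz)\<^sup>1\<^sup>/\<^sup>2\<close>, are realised as functions: \<open>in_D12 \<alpha> u Du u0\<close> says that \<open>u\<close> is an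
  element with gradient \<open>Du\<close> and trace \<open>u0 = u(\<cdot>,0)\<close>, i.e. that some sequence of test functions
  has gradients converging to \<open>Du\<close> in the norm, and itself and its boundary values converge to
  \<open>u\<close> and \<open>u0\<close> in (weighted) \<open>L\<^sup>2\<close> on bounded sets.
  For \<open>-1 < \<alpha> < 1\<close> and \<open>n + \<alpha> > 1\<close> the Hardy inequalities for \<open>\<integral> y\<^sup>\<alpha> u\<^sup>2/|z|\<^sup>2 dz\<close> and
  \<open>\<integral> u(x,0)\<^sup>2/|x|\<^sup>1\<^sup>-\<^sup>\<alpha> dx\<close> show that a Cauchy sequence in the norm always has such limits, and that
  they depend, up to null sets, only on its class in the completion; conversely \<open>Du = 0\<close> almost
  everywhere forces \<open>u = 0\<close> and \<open>u0 = 0\<close> almost everywhere.\<close>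

definition in_D12 ::
  "real \<Rightarrow> ('a::euclidean_space \<times> real \<Rightarrow> real) \<Rightarrow> ('a \<times> real \<Rightarrow> 'a \<times> real) \<Rightarrow> ('a \<Rightarrow> real) \<Rightarrow> bool" where
  "in_D12 \<alpha> u Du u0 \<longleftrightarrow>
     u \<in> borel_measurable (lebesgue_on halfspace) \<and>
     Du \<in> borel_measurable (lebesgue_on halfspace) \<and>
     u0 \<in> borel_measurable lebesgue \<and>
     (\<exists>\<phi>::nat \<Rightarrow> 'a \<times> real \<Rightarrow> real.
        (\<forall>k. \<phi> k \<in> Cc_infinity) \<and>
        (\<lambda>k. \<integral>\<^sup>+z. ennreal (snd z powr \<alpha> * (norm (grad (\<phi> k) z - Du z))\<^sup>2)
               \<partial>lebesgue_on halfspace) \<longlonglongrightarrow> 0 \<and>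
        (\<forall>R>0. (\<lambda>k. \<integral>\<^sup>+z. ennreal (snd z powr \<alpha> * (\<phi> k z - u z)\<^sup>2)
               \<partial>lebesgue_on (halfspace \<inter> ball 0 R)) \<longlonglongrightarrow> 0) \<and>
        (\<forall>R>0. (\<lambda>k. \<integral>\<^sup>+x. ennreal ((\<phi> k (x, 0) - u0 x)\<^sup>2)
               \<partial>lebesgue_on (ball 0 R)) \<longlonglongrightarrow> 0))"

definition nontrivial_potential :: "('a::euclidean_space \<times> real \<Rightarrow> real) \<Rightarrow> bool" where
  "nontrivial_potential V \<longleftrightarrow>
     V \<in> borel_measurable (lebesgue_on halfspace) \<and>
     (\<forall>z\<in>halfspace. 0 \<le> V z) \<and>
     \<not> (AE z in lebesgue_on halfspace. V z = 0)"

definition K_const :: "nat \<Rightarrow> real \<Rightarrow> real \<Rightarrow> real" where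
  "K_const n \<alpha> b =
     (1 - \<alpha>) *
     (Gamma ((real n - 2 * \<alpha> - b + 3) / 4) * Gamma ((real n + b - 1) / 4) * Gamma ((\<alpha> + 1) / 2)) /
     (Gamma ((3 - \<alpha>) / 2) * Gamma ((real n + 1 - b) / 4) * Gamma ((real n + 2 * \<alpha> + b - 3) / 4))"

text \<open>A Bochner integral is \<open>0\<close> when the integrand is not integrable, so integrability has to be
  required for the left-hand side: an infinite left-hand side violates the inequality. The
  integrals on the right-hand side are finite on all of \<open>D\<^sup>1\<^sup>,\<^sup>2\<close>, by equivalence of norms and the
  Hardy inequalities mentioned above.\<close>

definition improved_inequality ::
  "(real^'n \<Rightarrow> real) \<Rightarrow> real \<Rightarrow> real \<Rightarrow> real \<Rightarrow> ((real^'n) \<times> real \<Rightarrow> real) \<Rightarrow> real \<Rightarrow>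
   ((real^'n) \<times> real \<Rightarrow> real) \<Rightarrow> ((real^'n) \<times> real \<Rightarrow> (real^'n) \<times> real) \<Rightarrow> (real^'n \<Rightarrow> real) \<Rightarrow> bool" where
  "improved_inequality H \<alpha> b C V p u Du u0 \<longleftrightarrow>
     integrable (lebesgue_on halfspace) (\<lambda>z. V z * \<bar>u z\<bar> powr p) \<and>
     C * (LINT z|lebesgue_on halfspace. V z * \<bar>u z\<bar> powr p) powr (2 / p) \<le>
       (LINT z|lebesgue_on halfspace. snd z powr \<alpha> * (Phi H (Du z))\<^sup>2)
       - K_const CARD('n) \<alpha> b * (LINT x|lebesgue. (u0 x)\<^sup>2 / dual_norm H x powr (1 - \<alpha>))
       - (\<alpha> + b - 2)\<^sup>2 / 4 *
           (LINT z|lebesgue_on halfspace. snd z powr \<alpha> * (u z)\<^sup>2 / (Phi_dual H z)\<^sup>2)"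

end

theory Submission
  imports Defs
begin

text \<open>
  Write \<open>r = \<Phi>\<^sub>0(z)\<close>, \<open>s = H\<^sub>0(x)\<^sup>2 / r\<^sup>2\<close>, \<open>\<gamma> = (n + \<alpha> - 1)/2\<close> and \<open>\<delta> = (\<alpha> + b - 2)/2\<close>. The right-hand side of
  the inequality is a quadratic form which is critical: it formally vanishes on
  \<open>U = r powr (- \<gamma>) * F(s)\<close>, where \<open>F\<close> is the hypergeometric function
  \<open>\<^sub>2F\<^sub>1((\<gamma> + \<delta>)/2, (\<gamma> - \<delta>)/2; n/2; s)\<close>. The function \<open>U\<close> just fails to have finite energy, and cutting
  it off on \<open>exp (- L) \<le> r \<le> exp L\<close> costs only \<open>O(1/L)\<close>. So there are test functions on which the
  form tends to \<open>0\<close> while they increase to something positive, and then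
  \<open>\<integral> V u\<^sup>p\<close> has to vanish for the truncations, which forces \<open>V = 0\<close>.

  On a function \<open>u = f(r) S(s)\<close> the form splits. The gradient of \<open>H\<^sub>0\<close> has \<open>H\<close>-length one, so
  \<open>\<Phi>\<^sup>2(\<nabla>u) = f'(r)\<^sup>2 S(s)\<^sup>2 + 4 s (1 - s) S'(s)\<^sup>2 f(r)\<^sup>2 / r\<^sup>2\<close> (\<open>Phi_grad_polar\<close>), and polar coordinates for \<open>\<Phi>\<^sub>0\<close> turn the
  integrals into products of a radial and an angular one (\<open>nn_integral_polar\<close>). With \<open>f = r powr (- \<gamma>) * \<chi>\<close>
  the radial integrals reduce to \<open>X = \<integral> \<chi>\<^sup>2 / r dr = O(L)\<close> and \<open>\<integral> r \<chi>'\<^sup>2 dr = O(1/L)\<close>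
  (\<open>profile_integrals\<close>), and \<open>X\<close> gets multiplied by the angular energy of \<open>S\<close> minus \<open>K S(1)\<^sup>2\<close>. It remains
  to find \<open>S\<close> for which the angular energy is at most \<open>K S(1)\<^sup>2 + \<epsilon>\<close>, and one may let \<open>\<epsilon> = 1/L\<^sup>2\<close>.

  Instead of \<open>F\<close>, whose derivative is singular at \<open>s = 1\<close>, the polynomials \<open>S\<close> used are the partial sums of its
  series. They solve the hypergeometric equation up to one monomial (\<open>hyp_sum_ode\<close>), so partial
  integration bounds their energy by a flux times \<open>S(1)\<close>
  (\<open>energy_le\<close>). The flux converges by Euler's limit formula for the Gamma function, \<open>S(1)\<close> converges by Gauss's
  summation theorem (\<open>gauss_sum\<close>), and the quotient of the limits is exactly \<open>K\<close> up to the normalising factor \<open>2\<close>.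

  Two points concern the function space. Strict convexity makes the maximiser in the definition
  of \<open>H\<^sub>0\<close> unique, hence continuous, and it is the gradient of \<open>H\<^sub>0\<close> (\<open>H0_has_derivative\<close>); so the test functions are
  of class \<open>C\<^sup>1\<close>, but in general no better. Functions of class \<open>C\<^sup>1\<close> with compact support belong to the
  weighted Sobolev space by mollification (\<open>C1c_in_D12\<close>).
\<close>

section \<open>Smooth functions\<close>

lemma C_k_on_UNIV_imp_continuous:
  "C_k_on k f UNIV \<Longrightarrow> continuous_on UNIV f"
  by (cases k) (auto simp: continuous_on_eq_continuous_at differentiable_imp_continuous_within)

lemma C_k_on_SucD: "C_k_on (Suc k) f UNIV \<Longrightarrow> C_k_on k f UNIV"
proof (induction k arbitrary: f)
  case 0
  then show ?case using C_k_on_UNIV_imp_continuous by fastforce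
next
  case (Suc k)
  then show ?case by (metis C_k_on.simps(2))
qed

text \<open>Any derivative serves: it agrees with the chosen \<^const>\<open>frechet_derivative\<close> by uniqueness.\<close>

lemma C_k_on_SucI:
  assumes "\<And>x. (f has_derivative f' x) (at x)" "\<And>v. C_k_on k (\<lambda>x. f' x v) UNIV"
  shows "C_k_on (Suc k) f UNIV"
proof -
  have "frechet_derivative f (at x) = f' x" for x
    using assms(1) frechet_derivative_at by metis
  then show ?thesis using assms by (auto simp: differentiable_def)
qed

lemma C_k_on_SucE:
  assumes "C_k_on (Suc k) f UNIV"
  obtains f' where "\<And>x. (f has_derivative f' x) (at x)" "\<And>v. C_k_on k (\<lambda>x. f' x v) UNIV"
  by (rule that[of "\<lambda>x. frechet_derivative f (at x)"]) (use assms in \<open>auto simp: frechet_derivative_works\<close>)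

lemma C_k_on_const: "C_k_on k (\<lambda>x. c) UNIV"
proof (induction k arbitrary: c)
  case (Suc k)
  show ?case by (rule C_k_on_SucI[where f'="\<lambda>x v. 0"]) (use Suc in auto)
qed auto

lemma C_k_on_add:
  "C_k_on k f UNIV \<Longrightarrow> C_k_on k g UNIV \<Longrightarrow> C_k_on k (\<lambda>x. f x + g x) UNIV"
proof (induction k arbitrary: f g)
  case (Suc k)
  from Suc.prems obtain f' g' where *: "\<And>x. (f has_derivative f' x) (at x)" "\<And>v. C_k_on k (\<lambda>x. f' x v) UNIV"
     "\<And>x. (g has_derivative g' x) (at x)" "\<And>v. C_k_on k (\<lambda>x. g' x v) UNIV"
    by (metis C_k_on_SucE)
  show ?case
    by (rule C_k_on_SucI[where f'="\<lambda>x v. f' x v + g' x v"]) (use * Suc.IH in \<open>auto intro!: derivative_intros\<close>)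
qed (auto intro: continuous_intros)

lemma C_k_on_mult:
  fixes f g :: "'a::real_normed_vector \<Rightarrow> real"
  shows "C_k_on k f UNIV \<Longrightarrow> C_k_on k g UNIV \<Longrightarrow> C_k_on k (\<lambda>x. f x * g x) UNIV"
proof (induction k arbitrary: f g)
  case (Suc k)
  from Suc.prems obtain f' g' where *: "\<And>x. (f has_derivative f' x) (at x)" "\<And>v. C_k_on k (\<lambda>x. f' x v) UNIV"
     "\<And>x. (g has_derivative g' x) (at x)" "\<And>v. C_k_on k (\<lambda>x. g' x v) UNIV"
    by (metis C_k_on_SucE)
  note ** = C_k_on_SucD[OF Suc.prems(1)] C_k_on_SucD[OF Suc.prems(2)]
  show ?case
    by (rule C_k_on_SucI[where f'="\<lambda>x v. f x * g' x v + f' x v * g x"]) 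
       (use * ** in \<open>auto intro!: derivative_intros C_k_on_add Suc.IH\<close>)
qed (auto intro: continuous_intros)

lemma C_k_on_bounded_linear:
  assumes "bounded_linear f" shows "C_k_on k f UNIV"
proof (cases k)
  case 0
  then show ?thesis using assms by (simp add: linear_continuous_on)
next
  case (Suc k')
  show ?thesis unfolding Suc
    by (rule C_k_on_SucI[where f'="\<lambda>x. f"])
       (auto intro: C_k_on_const bounded_linear.has_derivative[OF assms] has_derivative_ident
          simp: bounded_linear_imp_has_derivative assms)
qed

text \<open>Derivatives of \<open>exp (-1/t)\<close> are again of the form \<open>p (1/t) * exp (-1/t)\<close> with a
  polynomial \<open>p\<close>, so this family is closed under differentiation.\<close>

definition flat_exp :: "real poly \<Rightarrow> real \<Rightarrow> real" where
  "flat_exp p t = (if t > 0 then poly p (1 / t) * exp (- (1 / t)) else 0)"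

lemma flat_exp_quotient_tendsto_0: "((\<lambda>t. flat_exp p t / t) \<longlongrightarrow> 0) (at 0)"
proof -
  have pow: "((\<lambda>x::real. poly q x * exp (- x)) \<longlongrightarrow> 0) at_top" for q
  proof -
    have "((\<lambda>x::real. \<Sum>i\<le>degree q. coeff q i * (x ^ i / exp x)) \<longlongrightarrow> (\<Sum>i\<le>degree q. coeff q i * 0)) at_top"
      by (intro tendsto_intros tendsto_power_div_exp_0)
    then show ?thesis
      by (simp add: poly_altdef exp_minus divide_inverse sum_distrib_right mult.assoc)
  qed
  have R: "((\<lambda>t. flat_exp p t / t) \<longlongrightarrow> 0) (at_right 0)"
  proof -
    have "((\<lambda>t::real. poly (pCons 0 p) (inverse t) * exp (- (inverse t))) \<longlongrightarrow> 0) (at_right 0)"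
      by (rule filterlim_compose[OF pow filterlim_inverse_at_top_right])
    then show ?thesis
      by (rule Lim_transform_eventually)
         (auto simp: eventually_at_right_field flat_exp_def field_simps intro!: exI[of _ 1])
  qed
  have L: "((\<lambda>t. flat_exp p t / t) \<longlongrightarrow> 0) (at_left 0)"
    by (rule Lim_transform_eventually[OF tendsto_const])
       (auto simp: eventually_at_left_field flat_exp_def intro!: exI[of _ "-1"])
  show ?thesis using L R filterlim_split_at by blast
qed

lemma flat_exp_has_real_derivative:
  "(flat_exp p has_real_derivative flat_exp ([:0,0,1:] * (p - pderiv p)) t) (at t)"
proof -
  consider "t > 0" | "t = 0" | "t < 0" by linarith
  then show ?thesis
  proof cases
    case 1
    have "((\<lambda>t. poly p (1 / t) * exp (- (1 / t))) has_real_derivative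
        flat_exp ([:0,0,1:] * (p - pderiv p)) t) (at t)"
      using 1 by (auto intro!: derivative_eq_intros DERIV_chain2[OF poly_DERIV] simp: flat_exp_def)
        (simp add: field_simps power2_eq_square)
    then show ?thesis
      by (rule has_field_derivative_transform_within_open[where S="{0<..}"])
         (use 1 in \<open>auto simp: flat_exp_def\<close>)
  next
    case 2
    then show ?thesis using flat_exp_quotient_tendsto_0[of p]
      by (simp add: DERIV_def flat_exp_def cong: if_cong)
  next
    case 3
    have "((\<lambda>t. 0) has_real_derivative flat_exp ([:0,0,1:] * (p - pderiv p)) t) (at t)"
      using 3 by (simp add: flat_exp_def)
    then show ?thesis
      by (rule has_field_derivative_transform_within_open[where S="{..<0}"])
         (use 3 in \<open>auto simp: flat_exp_def\<close>)
  qed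
qed

lemma C_k_on_flat_exp_quadratic:
  "C_k_on k (\<lambda>z::'a::real_inner. flat_exp p (c - z \<bullet> z)) UNIV"
proof (induction k arbitrary: p)
  case 0
  have "continuous_on UNIV (flat_exp p)"
    by (intro continuous_at_imp_continuous_on ballI DERIV_isCont[OF flat_exp_has_real_derivative])
  then have "continuous_on UNIV (\<lambda>z::'a. flat_exp p (c - z \<bullet> z))"
    by (rule continuous_on_compose2) (auto intro!: continuous_intros)
  then show ?case by simp
next
  case (Suc k)
  let ?p = "[:0,0,1:] * (p - pderiv p)"
  show ?case
  proof (rule C_k_on_SucI)
    fix z :: 'a
    have "((\<lambda>z::'a. c - z \<bullet> z) has_derivative (\<lambda>v. - (2 * (z \<bullet> v)))) (at z)"
      by (auto intro!: derivative_eq_intros simp: inner_commute)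
    from has_derivative_compose[OF this flat_exp_has_real_derivative[unfolded has_field_derivative_def]]
    show "((\<lambda>z. flat_exp p (c - z \<bullet> z)) has_derivative 
        (\<lambda>v. flat_exp ?p (c - z \<bullet> z) * (- 2 * (z \<bullet> v)))) (at z)"
      by (simp add: mult.commute)
  next
    fix v :: 'a
    have "C_k_on k (\<lambda>z. - 2 * (z \<bullet> v)) UNIV"
      by (rule C_k_on_bounded_linear) (intro bounded_linear_const_mult bounded_linear_inner_left)
    from C_k_on_mult[OF Suc.IH this]
    show "C_k_on k (\<lambda>z. flat_exp ?p (c - z \<bullet> z) * (- 2 * (z \<bullet> v))) UNIV" .
  qed
qed

section \<open>Mollification\<close>

definition convolve :: "('a::euclidean_space \<Rightarrow> real) \<Rightarrow> ('a \<Rightarrow> real) \<Rightarrow> 'a \<Rightarrow> real" where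
  "convolve f g z = (LINT w|lborel. f (z - w) * g w)"

lemma continuous_compact_support_integrable:
  fixes g :: "'a::euclidean_space \<Rightarrow> real"
  assumes "continuous_on UNIV g" "compact S" "\<And>z. z \<notin> S \<Longrightarrow> g z = 0"
  shows "integrable lborel g"
proof -
  have "integrable lborel (\<lambda>x. indicator S x *\<^sub>R g x)"
    by (intro borel_integrable_compact assms continuous_on_subset[OF assms(1)]) auto
  moreover have "(\<lambda>x. indicator S x *\<^sub>R g x) = g" using assms(3) by (auto simp: indicator_def fun_eq_iff)
  ultimately show ?thesis by simp
qed

lemma bounded_continuous_times_integrable:
  fixes f g :: "'a::euclidean_space \<Rightarrow> real"
  assumes "continuous_on UNIV f" "\<And>z. \<bar>f z\<bar> \<le> B" "integrable lborel g"
  shows "integrable lborel (\<lambda>w. f (z - w) * g w)"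
proof (rule Bochner_Integration.integrable_bound)
  show "integrable lborel (\<lambda>w. B * g w)" using assms by auto
  have "continuous_on UNIV (\<lambda>w. f (z - w))"
    by (intro continuous_on_compose2[OF assms(1)] continuous_intros) auto
  then have "(\<lambda>w. f (z - w)) \<in> borel_measurable lborel"
    by (simp add: borel_measurable_continuous_onI)
  then show "(\<lambda>w. f (z - w) * g w) \<in> borel_measurable lborel"
    using assms(3) by measurable
  show "AE w in lborel. norm (f (z - w) * g w) \<le> norm (B * g w)"
    using order_trans[OF assms(2) abs_ge_self[of B]]
    by (auto simp: abs_mult intro!: mult_right_mono)
qed

lemma convolve_commute:
  fixes f g :: "'a::euclidean_space \<Rightarrow> real"
  assumes "continuous_on UNIV f" "continuous_on UNIV g"
  shows "convolve f g = convolve g f"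
proof
  fix z :: 'a
  have *: "lborel = distr lborel borel (\<lambda>w. z - w)"
    using lborel_affine[where c="-1" and t=z] by (simp add: density_1)
  have "(\<lambda>w. f (z - w) * g w) \<in> borel_measurable borel"
    by (intro borel_measurable_continuous_onI continuous_intros 
         continuous_on_compose2[OF assms(1)] assms(2)) auto
  then have "(LINT w|distr lborel borel (\<lambda>w. z - w). f (z - w) * g w) = 
      (LINT w|lborel. f (z - (z - w)) * g (z - w))"
    by (subst integral_distr) auto
  then show "convolve f g z = convolve g f z"
    unfolding convolve_def * [symmetric] by (simp add: mult.commute)
qed

lemma compact_support_bounded:
  fixes f :: "'a::euclidean_space \<Rightarrow> real"
  assumes "continuous_on UNIV f" "compact S" "\<And>z. z \<notin> S \<Longrightarrow> f z = 0"
  obtains B where "\<And>z. \<bar>f z\<bar> \<le> B"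
proof -
  have "bounded (f ` S)"
    using assms by (meson compact_continuous_image compact_imp_bounded continuous_on_subset subset_UNIV)
  then obtain B where B: "\<And>z. z \<in> S \<Longrightarrow> \<bar>f z\<bar> \<le> B" "0 < B" by (auto simp: bounded_pos)
  have "\<bar>f z\<bar> \<le> B" for z using B assms(3)[of z] by (cases "z \<in> S") auto
  then show ?thesis by (rule that)
qed

text \<open>Within distance one of the support, compactness applies; of two close points elsewhere, both
  lie off the support.\<close>

lemma compact_support_uniformly_continuous:
  fixes f :: "'a::euclidean_space \<Rightarrow> real"
  assumes "continuous_on UNIV f" "compact S" "\<And>z. z \<notin> S \<Longrightarrow> f z = 0"
  shows "uniformly_continuous_on UNIV f"
proof -
  obtain R where R: "S \<subseteq> cball 0 R" 
    using compact_imp_bounded[OF assms(2)] by (force simp: bounded_iff)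
  have "uniformly_continuous_on (cball 0 (R + 1)) f"
    by (intro compact_uniformly_continuous continuous_on_subset[OF assms(1)]) auto
  then have uc: "\<exists>d>0. \<forall>x\<in>cball 0 (R + 1). \<forall>y\<in>cball 0 (R + 1). dist y x < d \<longrightarrow> dist (f y) (f x) < e"
    if "e > 0" for e using that by (auto simp: uniformly_continuous_on_def)
  show ?thesis unfolding uniformly_continuous_on_def
  proof (intro allI impI)
    fix e :: real assume e: "e > 0"
    from uc[OF e] obtain d where d: "d > 0" "\<And>x y. x \<in> cball 0 (R + 1) \<Longrightarrow> 
        y \<in> cball 0 (R + 1) \<Longrightarrow> dist y x < d \<Longrightarrow> dist (f y) (f x) < e" by metis
    show "\<exists>d>0. \<forall>x\<in>UNIV. \<forall>y\<in>UNIV. dist y x < d \<longrightarrow> dist (f y) (f x) < e"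
    proof (intro exI conjI ballI impI)
      show "min d 1 > 0" using d by simp
      fix x y :: 'a assume xy: "dist y x < min d 1"
      have "norm x \<le> norm y + dist y x" "norm y \<le> norm x + dist y x"
        by (metis dist_commute dist_norm norm_triangle_sub add.commute)+
      then consider "x \<in> cball 0 (R+1)" "y \<in> cball 0 (R+1)" | "x \<notin> cball 0 R" "y \<notin> cball 0 R"
        using xy by fastforce
      then show "dist (f y) (f x) < e"
      proof cases
        case 1
        then show ?thesis using d xy by auto
      next
        case 2
        then have "f x = 0" "f y = 0" using R by (metis assms(3) subsetD)+
        then show ?thesis using e by simp
      qed
    qed
  qed
qed

text \<open>The derivative is carried along explicitly, in the form of directional derivatives: these are
  scalar functions, to which the same convolution lemmas apply.\<close>

definition C1c :: "('a::euclidean_space \<Rightarrow> real) \<Rightarrow> ('a \<Rightarrow> 'a \<Rightarrow> real) \<Rightarrow> 'a set \<Rightarrow> bool" where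
  "C1c f f' S \<longleftrightarrow> (\<forall>x. (f has_derivative f' x) (at x)) \<and> (\<forall>v. continuous_on UNIV (\<lambda>x. f' x v))
     \<and> compact S \<and> (\<forall>x. x \<notin> S \<longrightarrow> f x = 0)"

lemma C1c_continuous: "C1c f f' S \<Longrightarrow> continuous_on UNIV f"
  unfolding C1c_def by (intro has_derivative_continuous_on) (blast intro: has_derivative_at_withinI)

lemma C1c_derivative_support:
  assumes "C1c f f' S" "x \<notin> S"
  shows "f' x v = 0"
proof -
  have "open (- S)" using assms by (auto simp: C1c_def compact_imp_closed)
  then have "(f has_derivative (\<lambda>_. 0)) (at x)"
    by (rule has_derivative_transform_within_open[OF has_derivative_const[of 0]])
       (use assms in \<open>auto simp: C1c_def\<close>)
  then show ?thesis using assms has_derivative_unique unfolding C1c_def by metis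
qed

lemma C1c_derivative_uniformly_continuous:
  assumes "C1c f f' S" "e > 0"
  obtains d where "d > 0" "\<And>x y v. dist x y < d \<Longrightarrow> \<bar>f' x v - f' y v\<bar> \<le> e * norm v"
proof -
  define n where "n = real DIM('a)"
  have n: "n > 0" by (simp add: n_def)
  have "\<exists>d>0. \<forall>x y. dist x y < d \<longrightarrow> \<bar>f' x i - f' y i\<bar> < e / n" for i
  proof -
    have "uniformly_continuous_on UNIV (\<lambda>x. f' x i)"
      by (rule compact_support_uniformly_continuous[where S=S])
         (use assms C1c_derivative_support[OF assms(1)] in \<open>auto simp: C1c_def\<close>)
    then show ?thesis using assms(2) n
      by (auto simp: uniformly_continuous_on_def dist_real_def dest!: spec[of _ "e/n"])
  qed
  then obtain d where d: "\<And>i. d i > 0" "\<And>i x y. dist x y < d i \<Longrightarrow> \<bar>f' x i - f' y i\<bar> < e / n"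
    by metis
  show ?thesis
  proof (rule that)
    show "Min (d ` Basis) > 0" using d by (subst Min_gr_iff) auto
    fix x y v :: 'a assume xy: "dist x y < Min (d ` Basis)"
    have lin: "linear (f' z)" for z using assms by (auto simp: C1c_def dest: has_derivative_linear)
    have *: "f' z v = (\<Sum>i\<in>Basis. (v \<bullet> i) * f' z i)" for z
      by (subst euclidean_representation[symmetric, of v])
         (simp add: linear_sum[OF lin] linear_cmul[OF lin])
    have "\<bar>f' x v - f' y v\<bar> = \<bar>\<Sum>i\<in>Basis. (v \<bullet> i) * (f' x i - f' y i)\<bar>"
      unfolding *[of x] *[of y] by (simp add: sum_subtractf algebra_simps)
    also have "\<dots> \<le> (\<Sum>i\<in>Basis. \<bar>v \<bullet> i\<bar> * \<bar>f' x i - f' y i\<bar>)"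
      by (rule order_trans[OF sum_abs]) (simp add: abs_mult)
    also have "\<dots> \<le> (\<Sum>i\<in>(Basis::'a set). norm v * (e / n))"
    proof (intro sum_mono mult_mono)
      fix i :: 'a assume i: "i \<in> Basis"
      then have "dist x y < d i" using xy by (subst (asm) Min_gr_iff) auto
      then show "\<bar>f' x i - f' y i\<bar> \<le> e / n" using d(2) less_imp_le by blast
    qed (auto simp: Basis_le_norm)
    also have "\<dots> = e * norm v" using n by (simp add: n_def)
    finally show "\<bar>f' x v - f' y v\<bar> \<le> e * norm v" .
  qed
qed

text \<open>The mean value theorem applied to \<open>f\<close> minus its linearisation.\<close>

lemma C1c_uniformly_differentiable:
  assumes "C1c f f' S" "e > 0"
  obtains d where "d > 0" "\<And>x h. norm h < d \<Longrightarrow> \<bar>f (x + h) - f x - f' x h\<bar> \<le> e * norm h"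
proof -
  obtain d where d: "d > 0" "\<And>x y v. dist x y < d \<Longrightarrow> \<bar>f' x v - f' y v\<bar> \<le> e * norm v"
    using C1c_derivative_uniformly_continuous[OF assms] by metis
  show ?thesis
  proof (rule that[OF d(1)])
    fix x h :: 'a assume h: "norm h < d"
    have "norm (f (x + h) - f x - f' x ((x + h) - x)) \<le> norm ((x + h) - x) * e"
    proof (rule differentiable_bound_linearization[where S="ball x d"])
      fix t :: real assume t: "t \<in> {0..1}"
      have "norm (t *\<^sub>R h) \<le> 1 * norm h" unfolding norm_scaleR 
        by (rule mult_right_mono) (use t in auto)
      then show "x + t *\<^sub>R (x + h - x) \<in> ball x d" using h by (simp add: dist_norm)
    next
      fix z assume "z \<in> ball x d"
      then show "onorm (f' z - f' x) \<le> e"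
        using d(2)[of z x] by (intro onorm_le) (auto simp: dist_commute)
    qed (use assms d(1) in \<open>auto simp: C1c_def has_derivative_at_withinI\<close>)
    then show "\<bar>f (x + h) - f x - f' x h\<bar> \<le> e * norm h" by (simp add: mult.commute)
  qed
qed

lemma C1c_derivative_integrable:
  assumes f: "C1c f f' S" and g: "integrable lborel g"
  shows "integrable lborel (\<lambda>w. f (z - w) * g w)" "integrable lborel (\<lambda>w. f' (z - w) v * g w)"
proof -
  obtain B where "\<And>z. \<bar>f z\<bar> \<le> B"
    using compact_support_bounded[OF C1c_continuous[OF f]] f unfolding C1c_def by metis
  then show "integrable lborel (\<lambda>w. f (z - w) * g w)"
    using bounded_continuous_times_integrable[OF C1c_continuous[OF f] _ g] by blast
  have c: "continuous_on UNIV (\<lambda>x. f' x v)" "compact S" using f by (auto simp: C1c_def)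
  obtain B where "\<And>z. \<bar>f' z v\<bar> \<le> B"
    using compact_support_bounded[OF c] C1c_derivative_support[OF f] by metis
  then show "integrable lborel (\<lambda>w. f' (z - w) v * g w)"
    using bounded_continuous_times_integrable[OF c(1) _ g] by blast
qed

text \<open>The error of the linear approximation of \<open>f\<close> is uniform in the base point, so it survives integration
  against \<open>g\<close>.\<close>

lemma convolve_has_derivative:
  assumes f: "C1c f f' S" and g: "integrable lborel g"
  shows "(convolve f g has_derivative (\<lambda>v. convolve (\<lambda>x. f' x v) g z)) (at z)"
  unfolding has_derivative_at_alt
proof (intro conjI allI impI)
  have lin: "linear (f' z)" for z using assms by (auto simp: C1c_def dest: has_derivative_linear)
  note int = C1c_derivative_integrable[OF f g]
  show "bounded_linear (\<lambda>v. convolve (\<lambda>x. f' x v) g z)"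
    unfolding convolve_def
    by (intro linear_conv_bounded_linear[THEN iffD1] linearI)
       (simp_all add: linear_add[OF lin] linear_cmul[OF lin] distrib_right mult.assoc int)
  fix e :: real assume e: "e > 0"
  define I where "I = (LINT w|lborel. \<bar>g w\<bar>)"
  have I: "I \<ge> 0" by (simp add: I_def)
  from e I have "e / (I + 1) > 0" by simp
  from C1c_uniformly_differentiable[OF f this] 
  obtain d where d: "d > 0" "\<And>x h. norm h < d \<Longrightarrow> \<bar>f (x + h) - f x - f' x h\<bar> \<le> e / (I+1) * norm h"
    by metis
  show "\<exists>d>0. \<forall>y. norm (y - z) < d \<longrightarrow> norm (convolve f g y - convolve f g z - 
         convolve (\<lambda>x. f' x (y - z)) g z) \<le> e * norm (y - z)"
  proof (intro exI conjI allI impI, rule d(1))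
    fix y assume y: "norm (y - z) < d"
    have "convolve f g y - convolve f g z - convolve (\<lambda>x. f' x (y - z)) g z =
      (LINT w|lborel. (f (y - w) - f (z - w) - f' (z - w) (y - z)) * g w)"
      unfolding convolve_def by (simp add: left_diff_distrib int)
    also have "norm \<dots> \<le> (LINT w|lborel. norm ((f (y - w) - f (z - w) - f' (z - w) (y - z)) * g w))"
      by (rule integral_norm_bound)
    also have "\<dots> \<le> (LINT w|lborel. (e / (I+1) * norm (y - z)) * \<bar>g w\<bar>)"
    proof (rule integral_mono)
      fix w
      have "\<bar>f (z - w + (y - z)) - f (z - w) - f' (z - w) (y - z)\<bar> \<le> e / (I+1) * norm (y - z)"
        by (rule d(2)[OF y])
      then show "norm ((f (y - w) - f (z - w) - f' (z - w) (y - z)) * g w) \<le>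
           (e / (I+1) * norm (y - z)) * \<bar>g w\<bar>"
        unfolding real_norm_def abs_mult by (intro mult_right_mono) (auto simp: algebra_simps)
    qed (use g in \<open>auto simp: left_diff_distrib int intro!: integrable_norm Bochner_Integration.integrable_diff\<close>)
    also have "\<dots> = (I / (I + 1)) * (e * norm (y - z))" by (simp add: I_def)
    also have "\<dots> \<le> 1 * (e * norm (y - z))"
      by (rule mult_right_mono) (use I e in auto)
    finally show "norm (convolve f g y - convolve f g z - 
         convolve (\<lambda>x. f' x (y - z)) g z) \<le> e * norm (y - z)" by simp
  qed
qed

lemma Cc_infinity_imp_C1c:
  assumes "f \<in> Cc_infinity"
  obtains S where "C1c f (\<lambda>x. frechet_derivative f (at x)) S"
proof -
  obtain S where S: "compact S" "\<forall>z. z \<notin> S \<longrightarrow> f z = 0" using assms by (auto simp: Cc_infinity_def)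
  have "C_k_on (Suc 0) f UNIV" using assms unfolding Cc_infinity_def by blast
  then have "C1c f (\<lambda>x. frechet_derivative f (at x)) S"
    using S by (auto simp: C1c_def frechet_derivative_works)
  then show ?thesis by (rule that)
qed

lemma Cc_infinity_derivative:
  assumes "f \<in> Cc_infinity"
  shows "(\<lambda>x. frechet_derivative f (at x) v) \<in> Cc_infinity"
proof -
  obtain S where S: "C1c f (\<lambda>x. frechet_derivative f (at x)) S" 
    using Cc_infinity_imp_C1c[OF assms] .
  have "C_k_on (Suc k) f UNIV" for k using assms unfolding Cc_infinity_def by blast
  then have "C_k_on k (\<lambda>x. frechet_derivative f (at x) v) UNIV" for k by simp
  then show ?thesis using C1c_derivative_support[OF S] S 
    unfolding Cc_infinity_def C1c_def by blast
qed

text \<open>Each differentiation falls on the smooth factor, whose directional derivatives are again smooth.\<close>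

lemma C_k_on_convolve:
  assumes "f \<in> Cc_infinity" "integrable lborel g"
  shows "C_k_on k (convolve f g) UNIV"
  using assms(1)
proof (induction k arbitrary: f)
  case 0
  obtain S where S: "C1c f (\<lambda>x. frechet_derivative f (at x)) S" 
    using Cc_infinity_imp_C1c[OF 0] .
  from convolve_has_derivative[OF S assms(2)] show ?case
    by (auto intro!: has_derivative_continuous continuous_at_imp_continuous_on)
next
  case (Suc k)
  obtain S where S: "C1c f (\<lambda>x. frechet_derivative f (at x)) S" 
    using Cc_infinity_imp_C1c[OF Suc.prems] .
  show ?case
    by (rule C_k_on_SucI[OF convolve_has_derivative[OF S assms(2)]])
       (intro Suc.IH Cc_infinity_derivative Suc.prems)
qed

text \<open>The bump is a normalised \<open>exp (- 1 / (d\<^sup>2 - z \<bullet> z))\<close>. Its integral is not zero since it is continuous and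
  positive at the origin.\<close>

lemma bump_exists:
  assumes "(d::real) > 0"
  obtains \<eta> :: "'a::euclidean_space \<Rightarrow> real" where "\<eta> \<in> Cc_infinity" "\<And>z. \<eta> z \<ge> 0"
    "\<And>z. norm z > d \<Longrightarrow> \<eta> z = 0" "(LINT z|lborel. \<eta> z) = 1"
proof -
  define \<psi> where "\<psi> = (\<lambda>z::'a. flat_exp 1 (d\<^sup>2 - z \<bullet> z))"
  have supp: "\<psi> z = 0" if "norm z \<ge> d" for z 
  proof -
    have "d\<^sup>2 \<le> (norm z)\<^sup>2" using that assms by (intro power_mono) auto
    then show ?thesis unfolding \<psi>_def flat_exp_def by (simp add: power2_norm_eq_inner)
  qed
  have Ck: "C_k_on k \<psi> UNIV" for k unfolding \<psi>_def by (rule C_k_on_flat_exp_quadratic)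
  have nonneg: "\<psi> z \<ge> 0" for z by (simp add: \<psi>_def flat_exp_def)
  have cont: "continuous_on UNIV \<psi>" using Ck C_k_on_UNIV_imp_continuous by blast
  have int: "integrable lborel \<psi>"
    by (rule continuous_compact_support_integrable[OF cont compact_cball[of 0 d]]) (use supp in auto)
  define I where "I = (LINT z|lborel. \<psi> z)"
  have "I \<noteq> 0"
  proof
    assume "I = 0"
    then have "AE z in lborel. \<psi> z = 0"
      using integral_nonneg_eq_0_iff_AE[OF int] nonneg by (simp add: I_def)
    then have "AE z in lebesgue. z \<notin> {z. \<psi> z \<noteq> 0}" by (intro AE_completion) simp
    moreover have op: "open {z. \<psi> z \<noteq> 0}" 
      using open_Collect_neq[OF cont continuous_on_const[of UNIV 0]] by simp
    ultimately have "negligible {z. \<psi> z \<noteq> 0}"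
      unfolding negligible_iff_null_sets by (subst AE_iff_null_sets) (auto simp: lborelD)
    then have "{z. \<psi> z \<noteq> 0} = {}" using open_not_negligible op by blast
    moreover have "\<psi> 0 \<noteq> 0" using assms by (simp add: \<psi>_def flat_exp_def)
    ultimately show False by blast
  qed
  moreover have "I \<ge> 0" unfolding I_def using nonneg by simp
  ultimately have I: "I > 0" by simp
  show ?thesis
  proof (rule that[of "\<lambda>z. \<psi> z * (1 / I)"])
    show "(\<lambda>z. \<psi> z * (1 / I)) \<in> Cc_infinity"
      unfolding Cc_infinity_def
    proof (intro CollectI conjI allI exI)
      show "C_k_on k (\<lambda>z. \<psi> z * (1 / I)) UNIV" for k by (rule C_k_on_mult[OF Ck C_k_on_const])
      show "compact (cball (0::'a) d)" by simp
      show "z \<notin> cball 0 d \<longrightarrow> \<psi> z * (1 / I) = 0" for z using supp by auto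
    qed
    show "(LINT z|lborel. \<psi> z * (1 / I)) = 1"
      using I by (simp add: I_def[symmetric])
    show "\<psi> z * (1 / I) \<ge> 0" for z using I nonneg[of z] by simp
    show "\<psi> z * (1 / I) = 0" if "norm z > d" for z using supp[of z] that by simp
  qed
qed

lemma convolve_close:
  fixes f \<eta> :: "'a::euclidean_space \<Rightarrow> real"
  assumes "\<And>w. \<eta> w \<ge> 0" "(LINT w|lborel. \<eta> w) = 1"
    and "integrable lborel (\<lambda>w. f (z - w) * \<eta> w)"
    and "\<And>w. \<eta> w \<noteq> 0 \<Longrightarrow> \<bar>f (z - w) - f z\<bar> \<le> e"
  shows "\<bar>convolve f \<eta> z - f z\<bar> \<le> e"
proof -
  have i: "integrable lborel \<eta>" using assms(2) not_integrable_integral_eq by fastforce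
  have "convolve f \<eta> z - f z = (LINT w|lborel. f (z - w) * \<eta> w - f z * \<eta> w)"
    unfolding convolve_def using assms i by simp
  also have "\<bar>\<dots>\<bar> \<le> (LINT w|lborel. \<bar>f (z - w) * \<eta> w - f z * \<eta> w\<bar>)"
    by (rule integral_abs_bound)
  also have "\<dots> \<le> (LINT w|lborel. e * \<eta> w)"
  proof (rule integral_mono)
    fix w show "\<bar>f (z - w) * \<eta> w - f z * \<eta> w\<bar> \<le> e * \<eta> w"
      using mult_right_mono[OF assms(4)[of w] assms(1)[of w]] assms(1)[of w]
      by (cases "\<eta> w = 0") (auto simp: abs_mult left_diff_distrib[symmetric])
  qed (use assms i in auto)
  finally show ?thesis using assms(2) by simp
qed

text \<open>Both the values and the derivatives of a mollified function are averages of the original ones,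
  so uniform continuity makes the approximation uniform in \<open>C\<^sup>1\<close>.\<close>

lemma C1c_approximation:
  fixes f :: "'a::euclidean_space \<Rightarrow> real"
  assumes f: "C1c f f' S" and "e > 0" and S: "S \<subseteq> cball 0 R"
  obtains \<phi> where "\<phi> \<in> Cc_infinity" "\<And>z. norm z > R + 1 \<Longrightarrow> \<phi> z = 0" "\<And>z. \<bar>\<phi> z - f z\<bar> \<le> e"
    "\<And>z v. \<bar>frechet_derivative \<phi> (at z) v - f' z v\<bar> \<le> e * norm v"
proof -
  have cont: "continuous_on UNIV f" by (rule C1c_continuous[OF f])
  have "uniformly_continuous_on UNIV f"
    by (rule compact_support_uniformly_continuous[OF cont]) (use f in \<open>auto simp: C1c_def\<close>)
  then obtain d1 where d1: "d1 > 0" "\<And>x y. dist x y < d1 \<Longrightarrow> \<bar>f x - f y\<bar> < e"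
    using \<open>e > 0\<close> unfolding uniformly_continuous_on_def by (metis UNIV_I dist_real_def)
  obtain d2 where d2: "d2 > 0" "\<And>x y v. dist x y < d2 \<Longrightarrow> \<bar>f' x v - f' y v\<bar> \<le> e * norm v"
    using C1c_derivative_uniformly_continuous[OF f \<open>e > 0\<close>] by metis
  define d where "d = min 1 (min d1 d2) / 2"
  have d: "d > 0" "d < d1" "d < d2" "d < 1" using d1 d2 by (auto simp: d_def)
  obtain \<eta> :: "'a \<Rightarrow> real" where \<eta>: "\<eta> \<in> Cc_infinity" "\<And>z. \<eta> z \<ge> 0"
    "\<And>z. norm z > d \<Longrightarrow> \<eta> z = 0" "(LINT z|lborel. \<eta> z) = 1" using bump_exists[OF d(1)] by metis
  have i: "integrable lborel \<eta>" using \<eta>(4) not_integrable_integral_eq by fastforce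
  obtain T where "C1c \<eta> (\<lambda>x. frechet_derivative \<eta> (at x)) T" using Cc_infinity_imp_C1c[OF \<eta>(1)] .
  then have c\<eta>: "continuous_on UNIV \<eta>" by (rule C1c_continuous)
  have fi: "integrable lborel f"
    by (rule continuous_compact_support_integrable[OF cont]) (use f in \<open>auto simp: C1c_def\<close>)
  have near: "norm w \<le> d" if "\<eta> w \<noteq> 0" for w using \<eta>(3)[of w] that by fastforce
  have supp: "convolve f \<eta> z = 0" if "norm z > R + 1" for z
  proof -
    have "f (z - w) * \<eta> w = 0" for w
    proof (cases "\<eta> w = 0")
      case False
      then have "norm (z - w) > R" 
        using near[OF False] that d norm_triangle_ineq2[of z w] by linarith
      then show ?thesis using S f by (auto simp: C1c_def subset_iff)
    qed simp
    then have *: "(\<lambda>w. f (z - w) * \<eta> w) = (\<lambda>_. 0)" by (rule ext)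
    show ?thesis unfolding convolve_def * by simp
  qed
  show ?thesis
  proof (rule that[of "convolve f \<eta>"])
    show "convolve f \<eta> \<in> Cc_infinity"
      unfolding Cc_infinity_def
    proof (intro CollectI conjI allI exI)
      show "C_k_on k (convolve f \<eta>) UNIV" for k
        unfolding convolve_commute[OF cont c\<eta>] by (intro C_k_on_convolve \<eta>(1) fi)
      show "compact (cball (0::'a) (R + 1))" by simp
      show "z \<notin> cball 0 (R + 1) \<longrightarrow> convolve f \<eta> z = 0" for z using supp by auto
    qed
    show "\<bar>convolve f \<eta> z - f z\<bar> \<le> e" for z
    proof (rule convolve_close)
      fix w assume "\<eta> w \<noteq> 0"
      from near[OF this] have "dist (z - w) z < d1" using d by (simp add: dist_norm)
      then show "\<bar>f (z - w) - f z\<bar> \<le> e" using d1(2) less_imp_le by blast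
    qed (rule \<eta>(2,4) C1c_derivative_integrable(1)[OF f i])+
    show "\<bar>frechet_derivative (convolve f \<eta>) (at z) v - f' z v\<bar> \<le> e * norm v" for z v
      unfolding frechet_derivative_at[OF convolve_has_derivative[OF f i], symmetric]
    proof (rule convolve_close)
      fix w assume "\<eta> w \<noteq> 0"
      from near[OF this] have "dist (z - w) z < d2" using d by (simp add: dist_norm)
      then show "\<bar>f' (z - w) v - f' z v\<bar> \<le> e * norm v" by (rule d2(2))
    qed (rule \<eta>(2,4) C1c_derivative_integrable(2)[OF f i])+
  qed (rule supp)
qed

section \<open>Test functions of class \<open>C\<^sup>1\<close>\<close>

lemma nn_integral_lebesgue_on_borel:
  assumes "A \<in> sets borel"
  shows "(\<integral>\<^sup>+z. f z \<partial>lebesgue_on A) = (\<integral>\<^sup>+z. f z * indicator A z \<partial>lborel)"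
  using assms by (simp add: nn_integral_restrict_space nn_integral_completion)

lemma halfspace_borel [measurable]: "(halfspace :: ('a::euclidean_space \<times> real) set) \<in> sets borel"
proof -
  have "open (halfspace :: ('a \<times> real) set)"
    unfolding halfspace_def by (intro open_Collect_less continuous_intros)
  then show ?thesis by simp
qed

lemma nn_integral_halfspace:
  fixes f :: "'a::euclidean_space \<times> real \<Rightarrow> ennreal"
  assumes [measurable]: "f \<in> borel_measurable borel"
  shows "(\<integral>\<^sup>+z. f z \<partial>lebesgue_on halfspace) =
         (\<integral>\<^sup>+x. \<integral>\<^sup>+y. f (x, y) * indicator {0<..} y \<partial>lborel \<partial>lborel)"
proof -
  have [measurable]: "f \<in> borel_measurable (lborel \<Otimes>\<^sub>M lborel)" 
    unfolding lborel_prod using assms by simp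
  have "(\<integral>\<^sup>+z. f z \<partial>lebesgue_on halfspace) = (\<integral>\<^sup>+z. f z * indicator {0<..} (snd z) \<partial>lborel)"
    unfolding nn_integral_lebesgue_on_borel[OF halfspace_borel]
    by (intro nn_integral_cong) (auto simp: halfspace_def indicator_def)
  also have "\<dots> = (\<integral>\<^sup>+x. \<integral>\<^sup>+y. f (x, y) * indicator {0<..} y \<partial>lborel \<partial>lborel)"
    by (subst lborel_prod[symmetric], subst lborel.nn_integral_fst[symmetric]) auto
  finally show ?thesis .
qed

lemma weight_locally_integrable:
  fixes R \<alpha> :: real
  assumes "-1 < \<alpha>" "R \<ge> 0"
  shows "(\<integral>\<^sup>+z. ennreal (snd z powr \<alpha>) \<partial>lebesgue_on (halfspace \<inter> ball (0::'a::euclidean_space \<times> real) R)) < \<infinity>"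
proof -
  have "(\<integral>\<^sup>+z. ennreal (snd z powr \<alpha>) \<partial>lebesgue_on (halfspace \<inter> ball (0::'a \<times> real) R))
      = (\<integral>\<^sup>+z. ennreal (snd z powr \<alpha>) * indicator (ball (0::'a \<times> real) R) z \<partial>lebesgue_on halfspace)"
    by (simp add: nn_integral_lebesgue_on_borel indicator_inter_arith mult_ac)
  also have "\<dots> \<le> (\<integral>\<^sup>+z. (ennreal (snd z powr \<alpha>) * indicator {0..R} (snd z)) * indicator (ball (0::'a) R) (fst z) \<partial>lebesgue_on halfspace)"
  proof (rule nn_integral_mono)
    fix z :: "'a \<times> real" assume "z \<in> space (lebesgue_on halfspace)"
    then have "snd z > 0" by (auto simp: halfspace_def space_restrict_space)
    moreover have "norm (fst z) \<le> norm z" "\<bar>snd z\<bar> \<le> norm z" 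
      by (metis norm_fst_le prod.collapse) (metis norm_snd_le prod.collapse real_norm_def)
    ultimately show "ennreal (snd z powr \<alpha>) * indicator (ball 0 R) z \<le>
      (ennreal (snd z powr \<alpha>) * indicator {0..R} (snd z)) * indicator (ball 0 R) (fst z)"
      by (auto simp: indicator_def dist_norm)
  qed
  also have "\<dots> \<le> (\<integral>\<^sup>+x. \<integral>\<^sup>+y. (ennreal (y powr \<alpha>) * indicator {0..R} y) * indicator (ball (0::'a) R) x \<partial>lborel \<partial>lborel)"
  proof -
    have [measurable]: "ball (0::'a) R \<in> sets borel" by simp
    have "(\<lambda>z. (ennreal (snd z powr \<alpha>) * indicator {0..R} (snd z)) * indicator (ball (0::'a) R) (fst z))
      \<in> borel_measurable borel"
      unfolding borel_prod[symmetric] by measurable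
    from nn_integral_halfspace[OF this] show ?thesis
      by (auto intro!: nn_integral_mono simp: indicator_def)
  qed
  also have "\<dots> = (\<integral>\<^sup>+y. ennreal (y powr \<alpha>) * indicator {0..R} y \<partial>lborel) * emeasure lborel (ball (0::'a) R)"
    by (simp add: nn_integral_multc nn_integral_cmult_indicator)
  also have "(\<integral>\<^sup>+y. ennreal (y powr \<alpha>) * indicator {0..R} y \<partial>lborel) = ennreal (R powr (\<alpha>+1) / (\<alpha>+1))"
    by (rule nn_integral_has_integral_lebesgue'[OF _ has_integral_powr_from_0]) (use assms in auto)
  finally show ?thesis
    using emeasure_lborel_ball_finite[of "0::'a" R] ennreal_mult_less_top
    by (metis ennreal_less_top infinity_ennreal_def order_le_less_trans)
qed

lemma ennreal_times_null_sequence: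
  assumes "c \<longlonglongrightarrow> 0" "W < \<infinity>"
  shows "(\<lambda>k. ennreal (c k) * W) \<longlonglongrightarrow> 0"
proof -
  have "(\<lambda>k. ennreal (c k) * W) \<longlonglongrightarrow> ennreal 0 * W"
    using assms by (intro tendsto_mult_ennreal tendsto_ennrealI tendsto_const) auto
  then show ?thesis by simp
qed

text \<open>All three convergence requirements for membership in the weighted Sobolev space come from uniform
  convergence, with the weight as a common majorant.\<close>

lemma nn_integral_tendsto_0_bounded_support:
  fixes f :: "nat \<Rightarrow> 'a \<Rightarrow> real"
  assumes "\<And>k z. z \<in> space M \<Longrightarrow> 0 \<le> w z \<and> f k z \<le> c k * w z"
    and "c \<longlonglongrightarrow> 0" "\<And>k. c k \<ge> 0" and "(\<integral>\<^sup>+z. ennreal (w z) \<partial>M) < \<infinity>"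
    and [measurable]: "w \<in> borel_measurable M"
  shows "(\<lambda>k. \<integral>\<^sup>+z. ennreal (f k z) \<partial>M) \<longlonglongrightarrow> 0"
proof (rule tendsto_sandwich[OF _ _ tendsto_const ennreal_times_null_sequence[OF assms(2,4)]])
  have "(\<integral>\<^sup>+z. ennreal (f k z) \<partial>M) \<le> (\<integral>\<^sup>+z. ennreal (c k) * ennreal (w z) \<partial>M)" for k
    using assms by (intro nn_integral_mono) (auto simp: ennreal_mult[symmetric] intro!: ennreal_leI)
  then show "\<forall>\<^sub>F k in sequentially. (\<integral>\<^sup>+z. ennreal (f k z) \<partial>M) \<le> ennreal (c k) * (\<integral>\<^sup>+z. ennreal (w z) \<partial>M)"
    by (simp add: nn_integral_cmult)
qed simp

lemma C1c_in_D12: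
  fixes u :: "'a::euclidean_space \<times> real \<Rightarrow> real"
  assumes u: "C1c u u' S" and "-1 < \<alpha>"
  shows "in_D12 \<alpha> u (grad u) (\<lambda>x. u (x, 0))"
proof -
  have gu: "grad u z = (\<Sum>e\<in>Basis. u' z e *\<^sub>R e)" for z
    using u frechet_derivative_at unfolding grad_def C1c_def by metis
  have cont: "continuous_on UNIV u" by (rule C1c_continuous[OF u])
  have gcont: "continuous_on UNIV (grad u)"
    unfolding gu using u by (auto simp: C1c_def intro!: continuous_intros)
  have "compact S" using u by (simp add: C1c_def)
  from compact_imp_bounded[OF this] obtain R0 where R0: "\<forall>z\<in>S. norm z \<le> R0"
    unfolding bounded_iff by auto
  define R where "R = max R0 0"
  have R: "S \<subseteq> cball 0 R" "R \<ge> 0" using R0 by (auto simp: R_def)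
  define \<epsilon> where "\<epsilon> k = inverse (real (Suc k))" for k
  have \<epsilon>: "\<epsilon> k > 0" for k by (simp add: \<epsilon>_def)
  have \<epsilon>0: "\<epsilon> \<longlonglongrightarrow> 0" unfolding \<epsilon>_def by (rule LIMSEQ_inverse_real_of_nat)
  define \<Delta> where "\<Delta> = real DIM('a \<times> real)"
  have "\<forall>k. \<exists>\<phi>. \<phi> \<in> Cc_infinity \<and> (\<forall>z. norm z > R + 1 \<longrightarrow> \<phi> z = 0) \<and> (\<forall>z. \<bar>\<phi> z - u z\<bar> \<le> \<epsilon> k) \<and>
    (\<forall>z v. \<bar>frechet_derivative \<phi> (at z) v - u' z v\<bar> \<le> \<epsilon> k * norm v)"
    using C1c_approximation[OF u \<epsilon> R(1)] by metis
  then obtain \<phi> where \<phi>: "\<And>k. \<phi> k \<in> Cc_infinity" "\<And>k z. norm z > R + 1 \<Longrightarrow> \<phi> k z = 0"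
    "\<And>k z. \<bar>\<phi> k z - u z\<bar> \<le> \<epsilon> k"
    "\<And>k z v. \<bar>frechet_derivative (\<phi> k) (at z) v - u' z v\<bar> \<le> \<epsilon> k * norm v"
    by metis
  have u'0: "u' z v = 0" if "norm z > R + 1" for z v 
    by (rule C1c_derivative_support[OF u]) (use subsetD[OF R(1), of z] R(2) that in auto)
  have \<phi>0: "frechet_derivative (\<phi> k) (at z) v = 0" if "norm z > R + 1" for k z v
  proof -
    obtain T where "C1c (\<phi> k) (\<lambda>z. frechet_derivative (\<phi> k) (at z)) T"
      using Cc_infinity_imp_C1c[OF \<phi>(1)] .
    then have "C1c (\<phi> k) (\<lambda>z. frechet_derivative (\<phi> k) (at z)) (cball 0 (R + 1))"
      using \<phi>(2) by (auto simp: C1c_def)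
    from C1c_derivative_support[OF this, of z] show ?thesis using that by simp
  qed
  have gd: "norm (grad (\<phi> k) z - grad u z) \<le> \<Delta> * \<epsilon> k" for k z
  proof -
    have "norm (grad (\<phi> k) z - grad u z) = norm (\<Sum>e\<in>Basis. (frechet_derivative (\<phi> k) (at z) e - u' z e) *\<^sub>R e)"
      unfolding gu grad_def[of "\<phi> k"] by (simp only: sum_subtractf scaleR_diff_left)
    also have "\<dots> \<le> (\<Sum>e\<in>(Basis :: ('a \<times> real) set). \<epsilon> k)"
    proof (rule order_trans[OF norm_sum sum_mono])
      fix e :: "'a \<times> real" assume "e \<in> Basis"
      then show "norm ((frechet_derivative (\<phi> k) (at z) e - u' z e) *\<^sub>R e) \<le> \<epsilon> k"
        using \<phi>(4)[of k z e] by simp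
    qed
    finally show ?thesis by (simp add: \<Delta>_def)
  qed
  have gd0: "grad (\<phi> k) z - grad u z = 0" if "norm z > R + 1" for k z
    unfolding gu grad_def[of "\<phi> k"] by (simp add: \<phi>0[OF that] u'0[OF that])
  have sq: "(\<phi> k z - u z)\<^sup>2 \<le> (\<epsilon> k)\<^sup>2" for k z
    using power_mono[OF \<phi>(3)[of k z], of 2] by simp
  have sq0: "(\<lambda>k. (\<epsilon> k)\<^sup>2) \<longlonglongrightarrow> 0" "(\<lambda>k. (\<Delta> * \<epsilon> k)\<^sup>2) \<longlonglongrightarrow> 0"
    using tendsto_power[OF \<epsilon>0, of 2] tendsto_power[OF tendsto_mult_right_zero[OF \<epsilon>0], of \<Delta> 2] by simp_all
  have wmeas: "(\<lambda>z. snd z powr \<alpha>) \<in> borel_measurable (lebesgue_on A)" for A :: "('a \<times> real) set"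
  proof -
    have "(\<lambda>z :: 'a \<times> real. snd z powr \<alpha>) \<in> borel_measurable borel"
      unfolding borel_prod[symmetric] by measurable
    then show ?thesis by (auto intro!: measurable_restrict_space1 measurable_completion)
  qed
  have grad_conv: "(\<lambda>k. \<integral>\<^sup>+z. ennreal (snd z powr \<alpha> * (norm (grad (\<phi> k) z - grad u z))\<^sup>2)
      \<partial>lebesgue_on halfspace) \<longlonglongrightarrow> 0"
  proof -
    \<comment> \<open>The supports lie in a common ball, so the half-space may be replaced by a bounded part of it.\<close>
    have eq: "(\<integral>\<^sup>+z. ennreal (snd z powr \<alpha> * (norm (grad (\<phi> k) z - grad u z))\<^sup>2) \<partial>lebesgue_on halfspace) =
      (\<integral>\<^sup>+z. ennreal (snd z powr \<alpha> * (norm (grad (\<phi> k) z - grad u z))\<^sup>2) \<partial>lebesgue_on (halfspace \<inter> ball 0 (R + 2)))" for k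
    proof -
      have "grad (\<phi> k) z - grad u z = 0" if "z \<notin> ball 0 (R + 2)" for z
        by (rule gd0) (use that in simp)
      then show ?thesis
        by (subst (1 2) nn_integral_lebesgue_on_borel)
           (auto intro!: nn_integral_cong simp: indicator_def)
    qed
    show ?thesis unfolding eq
    proof (rule nn_integral_tendsto_0_bounded_support[OF _ sq0(2), where w="\<lambda>z. snd z powr \<alpha>"])
      fix k :: nat and z :: "'a \<times> real"
      have "(norm (grad (\<phi> k) z - grad u z))\<^sup>2 \<le> (\<Delta> * \<epsilon> k)\<^sup>2" by (rule power_mono[OF gd]) simp
      then show "0 \<le> snd z powr \<alpha> \<and> snd z powr \<alpha> * (norm (grad (\<phi> k) z - grad u z))\<^sup>2 \<le> (\<Delta> * \<epsilon> k)\<^sup>2 * (snd z powr \<alpha>)"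
        by (simp add: mult.commute mult_left_mono)
    qed (use weight_locally_integrable[OF \<open>-1 < \<alpha>\<close>, of "R + 2"] R wmeas in auto)
  qed
  have val_conv: "(\<lambda>k. \<integral>\<^sup>+z. ennreal (snd z powr \<alpha> * (\<phi> k z - u z)\<^sup>2)
      \<partial>lebesgue_on (halfspace \<inter> ball 0 r)) \<longlonglongrightarrow> 0" if "r > 0" for r
  proof (rule nn_integral_tendsto_0_bounded_support[OF _ sq0(1), where w="\<lambda>z. snd z powr \<alpha>"])
    fix k :: nat and z :: "'a \<times> real"
    show "0 \<le> snd z powr \<alpha> \<and> snd z powr \<alpha> * (\<phi> k z - u z)\<^sup>2 \<le> (\<epsilon> k)\<^sup>2 * (snd z powr \<alpha>)"
      using sq[of k z] by (simp add: mult.commute mult_left_mono)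
  qed (use weight_locally_integrable[OF \<open>-1 < \<alpha>\<close>, of r] that wmeas in auto)
  have trace_conv: "(\<lambda>k. \<integral>\<^sup>+x. ennreal ((\<phi> k (x, 0) - u (x, 0))\<^sup>2)
      \<partial>lebesgue_on (ball 0 r)) \<longlonglongrightarrow> 0" if "r > 0" for r
  proof (rule nn_integral_tendsto_0_bounded_support[OF _ sq0(1), where w="\<lambda>z. 1"])
    show "(\<integral>\<^sup>+z. ennreal 1 \<partial>lebesgue_on (ball (0::'a) r)) < \<infinity>"
      using emeasure_lborel_ball_finite[of "0::'a" r]
      by (subst nn_integral_lebesgue_on_borel) simp_all
  qed (use sq in auto)
  have "u \<in> borel_measurable (lebesgue_on halfspace)"
       "grad u \<in> borel_measurable (lebesgue_on halfspace)"
    using cont gcont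
    by (auto intro!: measurable_restrict_space1 measurable_completion borel_measurable_continuous_onI)
  moreover have "continuous_on UNIV (\<lambda>x. u (x, 0))"
    by (rule continuous_on_compose2[OF cont]) (auto intro!: continuous_intros)
  then have "(\<lambda>x. u (x, 0)) \<in> borel_measurable lebesgue"
    by (auto intro!: measurable_completion borel_measurable_continuous_onI)
  ultimately show ?thesis
    unfolding in_D12_def using \<phi>(1) grad_conv val_conv trace_conv by blast
qed

section \<open>The dual norm\<close>

locale norm_strictly_convex =
  fixes H :: "'a::euclidean_space \<Rightarrow> real"
  assumes is_norm: "is_norm H" and sconv: "strictly_convex (\<lambda>\<xi>. (H \<xi>)\<^sup>2)"
begin

lemma H_nonneg: "0 \<le> H x" and H_eq_0: "H x = 0 \<longleftrightarrow> x = 0" 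
  and H_scaleR: "H (c *\<^sub>R x) = \<bar>c\<bar> * H x" and H_triangle: "H (x + y) \<le> H x + H y"
  using is_norm by (auto simp: is_norm_def)

lemma H_pos: "x \<noteq> 0 \<Longrightarrow> 0 < H x"
  using H_nonneg H_eq_0 by (metis less_eq_real_def)

lemma H_minus: "H (x - y) = H (y - x)"
  using H_scaleR[of "-1" "y - x"] by simp

lemma H_bound: obtains B where "\<And>x. H x \<le> B * norm x" "B > 0"
proof
  define B where "B = (\<Sum>e\<in>(Basis::'a set). H e) + 1"
  show "B > 0" unfolding B_def using H_nonneg by (simp add: add_nonneg_pos sum_nonneg)
  fix x :: 'a
  have sum_le: "H (\<Sum>e\<in>F. f e) \<le> (\<Sum>e\<in>F. H (f e))" if "finite F" for F :: "'a set" and f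
    using that 
  proof induction
    case empty
    then show ?case using H_eq_0[of 0] by simp
  next
    case (insert e F)
    then show ?case using H_triangle[of "f e" "\<Sum>e\<in>F. f e"] by simp
  qed
  have "H x = H (\<Sum>e\<in>Basis. (x \<bullet> e) *\<^sub>R e)" by (simp add: euclidean_representation)
  also have "\<dots> \<le> (\<Sum>e\<in>Basis. H ((x \<bullet> e) *\<^sub>R e))" by (rule sum_le) simp
  also have "\<dots> \<le> (\<Sum>e\<in>Basis. norm x * H e)"
    unfolding H_scaleR by (intro sum_mono mult_right_mono H_nonneg Basis_le_norm)
  also have "\<dots> \<le> B * norm x"
    unfolding B_def sum_distrib_left[symmetric] by (simp add: algebra_simps)
  finally show "H x \<le> B * norm x" .
qed

lemma H_continuous: "continuous_on A H"
proof -
  obtain B where B: "\<And>x. H x \<le> B * norm x" "B > 0" using H_bound by blast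
  have "\<bar>H x - H y\<bar> \<le> B * dist x y" for x y
    using H_triangle[of "x - y" y] H_triangle[of "y - x" x] B(1)[of "x - y"] H_minus[of x y]
    by (auto simp: dist_norm)
  then have "B-lipschitz_on A H"
    using B by (auto simp: lipschitz_on_def dist_real_def)
  then show ?thesis by (rule lipschitz_on_continuous_on)
qed

lemma H_lower_bound: obtains b where "\<And>x. b * norm x \<le> H x" "b > 0"
proof -
  have "sphere (0::'a) 1 \<noteq> {}" by simp
  from continuous_attains_inf[OF compact_sphere this H_continuous]
  obtain x0 where x0: "x0 \<in> sphere 0 1" "\<And>y. y \<in> sphere 0 1 \<Longrightarrow> H x0 \<le> H y" by auto
  show ?thesis
  proof
    show "H x0 > 0" using x0 by (intro H_pos) auto
    fix x :: 'a
    show "H x0 * norm x \<le> H x"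
    proof (cases "x = 0")
      case False
      then have "H x0 \<le> H ((1 / norm x) *\<^sub>R x)" by (intro x0) auto
      then show ?thesis using False unfolding H_scaleR by (simp add: field_simps)
    qed (simp add: H_nonneg)
  qed
qed

definition unit_sphere where "unit_sphere = {\<xi>. H \<xi> = 1}"

lemma compact_unit_sphere: "compact unit_sphere"
proof -
  obtain b where b: "\<And>x. b * norm x \<le> H x" "b > 0" using H_lower_bound by blast
  have "norm x \<le> 1 / b" if "H x = 1" for x
    using b(1)[of x] b(2) that by (simp add: field_simps)
  then have "bounded unit_sphere" unfolding bounded_iff unit_sphere_def by blast
  moreover have "closed unit_sphere" unfolding unit_sphere_def
    by (rule closed_Collect_eq) (auto intro: H_continuous)
  ultimately show ?thesis by (simp add: compact_eq_bounded_closed)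
qed

lemma normalize_in_unit_sphere: "\<xi> \<noteq> 0 \<Longrightarrow> (1 / H \<xi>) *\<^sub>R \<xi> \<in> unit_sphere"
  using H_pos[of \<xi>] by (simp add: unit_sphere_def H_scaleR)

lemma unit_sphere_nonempty: "unit_sphere \<noteq> {}"
  using normalize_in_unit_sphere nonempty_Basis nonzero_Basis by blast

text \<open>The maximiser of \<open>\<xi> \<mapsto> x \<bullet> \<xi>\<close> on the unit sphere of \<open>H\<close>; it turns out to be the
  gradient of the dual norm at \<open>x\<close>.\<close>

definition dual_grad :: "'a \<Rightarrow> 'a" where
  "dual_grad x = (SOME \<xi>. \<xi> \<in> unit_sphere \<and> (\<forall>\<eta>\<in>unit_sphere. x \<bullet> \<eta> \<le> x \<bullet> \<xi>))"

lemma dual_grad: "dual_grad x \<in> unit_sphere" "\<eta> \<in> unit_sphere \<Longrightarrow> x \<bullet> \<eta> \<le> x \<bullet> dual_grad x"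
proof -
  have "\<exists>\<xi>. \<xi> \<in> unit_sphere \<and> (\<forall>\<eta>\<in>unit_sphere. x \<bullet> \<eta> \<le> x \<bullet> \<xi>)"
    using continuous_attains_sup[OF compact_unit_sphere unit_sphere_nonempty, of "\<lambda>\<xi>. x \<bullet> \<xi>"]
      continuous_on_inner[OF continuous_on_const continuous_on_id, of _ x] by auto
  from someI_ex[OF this, folded dual_grad_def]
  show "dual_grad x \<in> unit_sphere" "\<eta> \<in> unit_sphere \<Longrightarrow> x \<bullet> \<eta> \<le> x \<bullet> dual_grad x" by auto
qed

lemma H_dual_grad: "H (dual_grad x) = 1"
  using dual_grad(1) by (simp add: unit_sphere_def)

abbreviation H0 where "H0 \<equiv> dual_norm H"

lemma inner_le_dual_grad: "x \<bullet> \<xi> \<le> (x \<bullet> dual_grad x) * H \<xi>"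
proof (cases "\<xi> = 0")
  case True
  then show ?thesis using H_eq_0[of 0] by simp
next
  case False
  from dual_grad(2)[OF normalize_in_unit_sphere[OF this], of x] H_pos[OF False]
  show ?thesis by (simp add: field_simps)
qed

lemma H0_eq: "H0 x = x \<bullet> dual_grad x"
  unfolding dual_norm_def
proof (rule cSup_eq_maximum)
  have "dual_grad x \<noteq> 0" using H_dual_grad[of x] H_eq_0[of 0] by auto
  then show "x \<bullet> dual_grad x \<in> (\<lambda>\<xi>. x \<bullet> \<xi> / H \<xi>) ` (- {0})"
    using H_dual_grad[of x] by (intro image_eqI[of _ _ "dual_grad x"]) auto
  fix y assume "y \<in> (\<lambda>\<xi>. x \<bullet> \<xi> / H \<xi>) ` (- {0})"
  then obtain \<xi> where "\<xi> \<noteq> 0" "y = x \<bullet> \<xi> / H \<xi>" by auto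
  then show "y \<le> x \<bullet> dual_grad x"
    using inner_le_dual_grad[of x \<xi>] H_pos[of \<xi>] by (simp add: pos_divide_le_eq)
qed

lemma inner_le_H0: "x \<bullet> \<xi> \<le> H0 x * H \<xi>"
  using inner_le_dual_grad by (simp add: H0_eq)

lemma H0_0: "H0 0 = 0" by (simp add: H0_eq)

lemma H0_pos: assumes "x \<noteq> 0" shows "0 < H0 x"
proof -
  have "0 < x \<bullet> x" using assms by simp
  then have "0 < H0 x * H x" using inner_le_H0[of x x] by linarith
  then show ?thesis using H_pos[OF assms] zero_less_mult_pos2 by blast
qed

lemma H0_nonneg: "0 \<le> H0 x"
  using H0_pos[of x] H0_0 by (cases "x = 0") auto

lemma H0_eq_0: "H0 x = 0 \<longleftrightarrow> x = 0"
  using H0_pos[of x] H0_0 by fastforce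

lemma H0_scaleR: assumes "c > 0" shows "H0 (c *\<^sub>R x) = c * H0 x"
proof (rule antisym)
  show "H0 (c *\<^sub>R x) \<le> c * H0 x"
    using inner_le_H0[of x "dual_grad (c *\<^sub>R x)"] assms 
    by (subst H0_eq) (simp add: H_dual_grad mult_left_mono)
  show "c * H0 x \<le> H0 (c *\<^sub>R x)"
    using inner_le_H0[of "c *\<^sub>R x" "dual_grad x"] by (subst (1) H0_eq) (simp add: H_dual_grad)
qed

lemma H0_le_norm: obtains B where "\<And>x. H0 x \<le> B * norm x" "B > 0"
proof -
  obtain b where b: "\<And>x. b * norm x \<le> H x" "b > 0" using H_lower_bound by blast
  show ?thesis
  proof
    fix x :: 'a
    have "H0 x \<le> norm x * norm (dual_grad x)" unfolding H0_eq by (rule norm_cauchy_schwarz)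
    also have "\<dots> \<le> norm x * (1 / b)"
      using b(1)[of "dual_grad x"] b(2) H_dual_grad[of x] 
      by (intro mult_left_mono) (auto simp: field_simps)
    finally show "H0 x \<le> 1 / b * norm x" by simp
  qed (use b in auto)
qed

lemma H0_ge_norm: obtains b where "\<And>x. b * norm x \<le> H0 x" "b > 0"
proof -
  obtain B where B: "\<And>x. H x \<le> B * norm x" "B > 0" using H_bound by blast
  show ?thesis
  proof
    fix x :: 'a
    show "1 / B * norm x \<le> H0 x"
    proof (cases "x = 0")
      case False
      have "norm x * norm x \<le> H0 x * (B * norm x)"
        using inner_le_H0[of x x] mult_left_mono[OF B(1)[of x] H0_nonneg[of x]]
        by (simp add: dot_square_norm power2_eq_square)
      then show ?thesis using False B(2) by (simp add: field_simps)
    qed (simp add: H0_0)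
  qed (use B in auto)
qed

text \<open>Two maximisers would have a midpoint of norm less than one, by strict convexity, whose
  normalisation would do better than both.\<close>

lemma dual_grad_unique:
  assumes "x \<noteq> 0" "H \<xi> = 1" "x \<bullet> \<xi> = H0 x" shows "\<xi> = dual_grad x"
proof (rule ccontr)
  assume ne: "\<xi> \<noteq> dual_grad x"
  let ?m = "(1 - 1/2) *\<^sub>R \<xi> + (1/2) *\<^sub>R dual_grad x"
  have "(H ?m)\<^sup>2 < (1 - 1/2) * (H \<xi>)\<^sup>2 + (1/2) * (H (dual_grad x))\<^sup>2"
    by (rule sconv[unfolded strictly_convex_def, rule_format, OF ne]) auto
  then have "(H ?m)\<^sup>2 < 1\<^sup>2" using assms H_dual_grad by simp
  then have "H ?m < 1" by (rule power2_less_imp_less) simp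
  moreover have "x \<bullet> ?m = H0 x" using assms by (simp add: inner_add_right H0_eq)
  ultimately show False
    using inner_le_H0[of x ?m] H0_pos[OF assms(1)] mult_strict_left_mono[of "H ?m" 1 "H0 x"] by simp
qed

text \<open>\<open>H0\<close> is subadditive and bounded by a multiple of the Euclidean norm.\<close>

lemma H0_continuous: "continuous_on A H0"
proof -
  obtain B where B: "\<And>x. H0 x \<le> B * norm x" "B > 0" using H0_le_norm by blast
  have *: "H0 x - H0 y \<le> B * dist x y" for x y
  proof -
    have "H0 x - H0 y \<le> (x - y) \<bullet> dual_grad x"
      using inner_le_H0[of y "dual_grad x"] by (simp add: H0_eq[of x] inner_diff_left H_dual_grad)
    also have "\<dots> \<le> H0 (x - y)" using inner_le_H0[of "x - y" "dual_grad x"] by (simp add: H_dual_grad)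
    finally show ?thesis using B(1)[of "x - y"] by (simp add: dist_norm)
  qed
  have "\<bar>H0 x - H0 y\<bar> \<le> B * dist x y" for x y using *[of x y] *[of y x] by (simp add: dist_commute)
  then have "B-lipschitz_on A H0" using B by (auto simp: lipschitz_on_def dist_real_def)
  then show ?thesis by (rule lipschitz_on_continuous_on)
qed

text \<open>A limit of maximisers is a maximiser for the limit, and there is only one; compactness of the
  unit sphere does the rest.\<close>

lemma dual_grad_continuous: "continuous_on (- {0}) dual_grad"
proof (rule continuous_on_sequentiallyI)
  fix u :: "nat \<Rightarrow> 'a" and x
  assume u: "\<forall>n. u n \<in> - {0}" "x \<in> - {0}" "u \<longlonglongrightarrow> x"
  show "(\<lambda>n. dual_grad (u n)) \<longlonglongrightarrow> dual_grad x"
  proof (rule ccontr)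
    assume "\<not> ?thesis"
    then obtain e where e: "e > 0" "\<exists>\<^sub>F n in sequentially. dist (dual_grad (u n)) (dual_grad x) \<ge> e"
      by (auto simp: tendsto_iff not_eventually not_less)
    then have "infinite {n. dist (dual_grad (u n)) (dual_grad x) \<ge> e}"
      by (simp add: cofinite_eq_sequentially[symmetric] frequently_cofinite)
    then obtain r :: "nat \<Rightarrow> nat" where r: "strict_mono r" "\<And>n. dist (dual_grad (u (r n))) (dual_grad x) \<ge> e"
      using infinite_enumerate by force
    obtain l q where l: "l \<in> unit_sphere" "strict_mono q" "(\<lambda>n. dual_grad (u (r (q n)))) \<longlonglongrightarrow> l"
      using compact_unit_sphere[unfolded compact_def, rule_format, of "\<lambda>n. dual_grad (u (r n))"] dual_grad(1)
      by (auto simp: o_def)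
    have ux: "(\<lambda>n. u (r (q n))) \<longlonglongrightarrow> x"
      using LIMSEQ_subseq_LIMSEQ[OF u(3) strict_mono_o[OF r(1) l(2)]] by (simp add: o_def)
    have "(\<lambda>n. H0 (u (r (q n)))) \<longlonglongrightarrow> H0 x"
      by (rule continuous_on_tendsto_compose[OF H0_continuous[of UNIV] ux]) auto
    moreover have "(\<lambda>n. H0 (u (r (q n)))) \<longlonglongrightarrow> x \<bullet> l"
      unfolding H0_eq by (intro tendsto_inner ux l)
    ultimately have "x \<bullet> l = H0 x" using LIMSEQ_unique by blast
    then have "l = dual_grad x"
      using dual_grad_unique[of x l] l(1) u(2) by (auto simp: unit_sphere_def)
    then have "(\<lambda>n. dist (dual_grad (u (r (q n)))) (dual_grad x)) \<longlonglongrightarrow> 0"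
      using l(3) tendsto_dist_iff[of "\<lambda>n. dual_grad (u (r (q n)))"] by simp
    then have "e \<le> 0" by (rule LIMSEQ_le_const) (use r(2) in auto)
    then show False using e by simp
  qed
qed

text \<open>With \<open>\<xi>(y)\<close> the maximiser at \<open>y\<close>, testing the supremum for one point with the maximiser for the other squeezes
  \<open>H0 y - H0 x\<close> between \<open>(y - x) \<bullet> \<xi>(x)\<close> and \<open>(y - x) \<bullet> \<xi>(y)\<close>.\<close>

lemma H0_has_derivative:
  assumes "x \<noteq> 0"
  shows "(H0 has_derivative (\<lambda>h. h \<bullet> dual_grad x)) (at x)"
  unfolding has_derivative_at_alt
proof (intro conjI allI impI)
  show "bounded_linear (\<lambda>h. h \<bullet> dual_grad x)" by (rule bounded_linear_inner_left)
  fix e :: real assume e: "e > 0"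
  have "isCont dual_grad x"
    using dual_grad_continuous assms by (simp add: continuous_on_eq_continuous_at open_Compl)
  then obtain d where d: "d > 0" "\<And>y. dist y x < d \<Longrightarrow> dist (dual_grad y) (dual_grad x) < e"
    using e by (auto simp: continuous_at_eps_delta)
  show "\<exists>d>0. \<forall>y. norm (y - x) < d \<longrightarrow> norm (H0 y - H0 x - (y - x) \<bullet> dual_grad x) \<le> e * norm (y - x)"
  proof (intro exI conjI allI impI, rule d(1))
    fix y assume y: "norm (y - x) < d"
    have lo: "0 \<le> H0 y - H0 x - (y - x) \<bullet> dual_grad x"
      using inner_le_H0[of y "dual_grad x"] by (simp add: H0_eq[of x] inner_diff_left H_dual_grad)
    have "H0 y - H0 x - (y - x) \<bullet> dual_grad x \<le> (y - x) \<bullet> (dual_grad y - dual_grad x)"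
      using inner_le_H0[of x "dual_grad y"] by (simp add: H0_eq[of y] inner_diff_left inner_diff_right H_dual_grad)
    also have "\<dots> \<le> norm (y - x) * norm (dual_grad y - dual_grad x)" by (rule norm_cauchy_schwarz)
    also have "\<dots> \<le> norm (y - x) * e"
      using d(2)[of y] y by (intro mult_left_mono) (auto simp: dist_norm)
    finally show "norm (H0 y - H0 x - (y - x) \<bullet> dual_grad x) \<le> e * norm (y - x)"
      using lo by (simp add: mult.commute)
  qed
qed

end

section \<open>Partial sums of the hypergeometric series\<close>

definition beta_weight :: "real \<Rightarrow> real \<Rightarrow> real \<Rightarrow> real" where
  "beta_weight c e s = indicator {0<..<1} s * (s powr (c - 1) * (1 - s) powr e)"

lemma beta_weight_nonneg: "0 \<le> beta_weight c e s"
  by (simp add: beta_weight_def)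

lemma beta_weight_measurable [measurable]: "beta_weight c e \<in> borel_measurable borel"
  unfolding beta_weight_def by measurable

lemma nn_integral_beta_weight:
  assumes "c > 0" "e > -1"
  shows "(\<integral>\<^sup>+s. ennreal (beta_weight c e s) \<partial>lborel) = ennreal (Beta c (e + 1))"
proof -
  have "((\<lambda>s. s powr (c - 1) * (1 - s) powr e) has_integral Beta c (e + 1)) {0<..<1}"
    using has_integral_Beta_real[of c "e + 1"] assms by (simp add: has_integral_Icc_iff_Ioo)
  from nn_integral_has_integral_lebesgue[OF _ this] show ?thesis
    by (simp add: beta_weight_def)
qed

lemma Beta_pos: "c > 0 \<Longrightarrow> d > 0 \<Longrightarrow> Beta c d > (0::real)"
  by (simp add: Beta_def Gamma_real_pos)

lemma beta_weight_has_integral: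
  assumes "c > 0" "e > -1"
  shows "integrable lborel (beta_weight c e)" "(LINT s|lborel. beta_weight c e s) = Beta c (e + 1)"
proof -
  have "has_bochner_integral lborel (beta_weight c e) (Beta c (e + 1))"
    using nn_integral_beta_weight[OF assms] assms
    by (intro has_bochner_integral_nn_integral) (auto simp: beta_weight_nonneg intro!: less_imp_le Beta_pos)
  then show "integrable lborel (beta_weight c e)" "(LINT s|lborel. beta_weight c e s) = Beta c (e + 1)"
    by (auto simp: has_bochner_integral_iff)
qed

lemma beta_weight_times_continuous_integrable:
  assumes "c > 0" "e > -1" and g: "continuous_on UNIV g"
  shows "integrable lborel (\<lambda>s. beta_weight c e s * g s)"
proof -
  have [measurable]: "g \<in> borel_measurable borel" using g by (rule borel_measurable_continuous_onI)
  have "compact (g ` {0..1})" by (intro compact_continuous_image continuous_on_subset[OF g]) auto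
  from compact_imp_bounded[OF this] have "\<exists>B. \<forall>s\<in>{0..1}. \<bar>g s\<bar> \<le> B"
    unfolding bounded_iff by auto
  then obtain B where B: "\<And>s. s \<in> {0..1} \<Longrightarrow> \<bar>g s\<bar> \<le> B" by blast
  show ?thesis
  proof (rule Bochner_Integration.integrable_bound)
    show "integrable lborel (\<lambda>s. B * beta_weight c e s)" using beta_weight_has_integral[OF assms(1,2)] by simp
    have "norm (beta_weight c e s * g s) \<le> norm (B * beta_weight c e s)" for s
    proof (cases "s \<in> {0<..<1}")
      case True
      then have "\<bar>g s\<bar> \<le> \<bar>B\<bar>" using B[of s] by simp
      from mult_left_mono[OF this beta_weight_nonneg[of c e s]]
      show ?thesis using beta_weight_nonneg[of c e s] by (simp add: abs_mult mult.commute)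
    qed (auto simp: beta_weight_def)
    then show "AE s in lborel. norm (beta_weight c e s * g s) \<le> norm (B * beta_weight c e s)" by simp
  qed measurable
qed

lemma beta_weight_times_power: "beta_weight c e s * s ^ k = beta_weight (c + real k) e s"
proof (cases "s \<in> {0<..<1}")
  case True
  then have "s powr (c + real k - 1) = s powr (c - 1) * s powr real k"
    by (simp add: powr_add[symmetric] algebra_simps)
  then show ?thesis using True by (simp add: beta_weight_def powr_realpow)
qed (auto simp: beta_weight_def)

definition hyp_term :: "real \<Rightarrow> real \<Rightarrow> real \<Rightarrow> nat \<Rightarrow> real" where
  "hyp_term a b c k = pochhammer a k * pochhammer b k / (pochhammer c k * fact k)"

definition hyp_sum :: "real \<Rightarrow> real \<Rightarrow> real \<Rightarrow> nat \<Rightarrow> real \<Rightarrow> real" where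
  "hyp_sum a b c N s = (\<Sum>k\<le>N. hyp_term a b c k * s ^ k)"

definition hyp_sum' :: "real \<Rightarrow> real \<Rightarrow> real \<Rightarrow> nat \<Rightarrow> real \<Rightarrow> real" where
  "hyp_sum' a b c N s = (\<Sum>k\<le>N. hyp_term a b c k * (real k * s ^ (k - 1)))"

definition hyp_sum'' :: "real \<Rightarrow> real \<Rightarrow> real \<Rightarrow> nat \<Rightarrow> real \<Rightarrow> real" where
  "hyp_sum'' a b c N s = (\<Sum>k\<le>N. hyp_term a b c k * (real k * (real (k - 1) * s ^ (k - 1 - 1))))"

lemma hyp_sum_deriv: "(hyp_sum a b c N has_real_derivative hyp_sum' a b c N s) (at s)"
  unfolding hyp_sum_def hyp_sum'_def by (auto intro!: derivative_eq_intros sum.cong simp: mult_ac)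

lemma hyp_sum'_deriv: "(hyp_sum' a b c N has_real_derivative hyp_sum'' a b c N s) (at s)"
  unfolding hyp_sum'_def hyp_sum''_def by (auto intro!: derivative_eq_intros sum.cong simp: mult_ac)

lemma hyp_sum_continuous: "continuous_on A (hyp_sum a b c N)" "continuous_on A (hyp_sum' a b c N)"
  unfolding hyp_sum_def hyp_sum'_def by (auto intro!: continuous_intros)

lemma hyp_term_Suc:
  assumes "c > 0"
  shows "hyp_term a b c (Suc k) * (real (Suc k) * (c + real k)) = hyp_term a b c k * ((a + real k) * (b + real k))"
proof -
  have pos: "pochhammer c k > 0" "c + real k > 0" using assms by (auto intro: pochhammer_pos)
  have *: "A * x * (B * y) / (C * q * (m * F)) * (m * q) = A * B / (C * F) * (x * y)"
    if "m > 0" "q > 0" for A B C F m q x y :: real using that by (simp add: field_simps)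
  show ?thesis
    unfolding hyp_term_def pochhammer_Suc fact_Suc of_nat_mult
    by (rule *) (use pos in auto)
qed

text \<open>The terms of the hypergeometric equation telescope; truncation leaves only the top term.\<close>

lemma hyp_sum_ode:
  assumes "c > 0"
  shows "s * (1 - s) * hyp_sum'' a b c N s + (c - (a + b + 1) * s) * hyp_sum' a b c N s
     = a * b * hyp_sum a b c N s - (a + real N) * (b + real N) * hyp_term a b c N * s ^ N"
proof (induction N)
  case 0
  show ?case by (simp add: hyp_sum_def hyp_sum'_def hyp_sum''_def)
next
  case (Suc N)
  let ?t = "hyp_term a b c (Suc N)"
  have ex: "s * (1 - s) * (real (Suc N) * (real N * s ^ (N - 1))) + (c - (a + b + 1) * s) * (real (Suc N) * s ^ N)
     - a * b * s ^ Suc N = real (Suc N) * (c + real N) * s ^ N - (a + real (Suc N)) * (b + real (Suc N)) * s ^ Suc N"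
    by (cases N) (simp_all add: algebra_simps)
  have "s * (1 - s) * hyp_sum'' a b c (Suc N) s + (c - (a + b + 1) * s) * hyp_sum' a b c (Suc N) s
      - a * b * hyp_sum a b c (Suc N) s =
      (s * (1 - s) * hyp_sum'' a b c N s + (c - (a + b + 1) * s) * hyp_sum' a b c N s - a * b * hyp_sum a b c N s) +
      ?t * (s * (1 - s) * (real (Suc N) * (real N * s ^ (N - 1))) + (c - (a + b + 1) * s) * (real (Suc N) * s ^ N)
     - a * b * s ^ Suc N)"
    unfolding hyp_sum_def hyp_sum'_def hyp_sum''_def sum.atMost_Suc diff_Suc_1
    by (simp only: algebra_simps)
  also have "\<dots> = - (a + real N) * (b + real N) * hyp_term a b c N * s ^ N
      + (?t * (real (Suc N) * (c + real N))) * s ^ N - (a + real (Suc N)) * (b + real (Suc N)) * ?t * s ^ Suc N"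
    unfolding Suc.IH ex by (simp add: algebra_simps)
  finally show ?case unfolding hyp_term_Suc[OF assms] by (simp add: algebra_simps)
qed

context
  fixes a b c :: real
  assumes a: "0 < a" and b: "0 < b" and abc: "a + b < c" "c < a + b + 1"
begin

lemma c_pos: "0 < c" using a b abc by linarith

lemma hyp_term_pos: "0 < hyp_term a b c k"
  using a b c_pos by (simp add: hyp_term_def pochhammer_pos)

lemma hyp_sum_mono: "0 \<le> s \<Longrightarrow> s \<le> 1 \<Longrightarrow> hyp_sum a b c N s \<le> hyp_sum a b c N 1"
  unfolding hyp_sum_def by (intro sum_mono mult_left_mono less_imp_le[OF hyp_term_pos]) (auto simp: power_le_one)

text \<open>The lower bound is what keeps the test functions away from zero: the constant term is one and the
  remaining terms are nonnegative.\<close>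

lemma hyp_sum_ge_1: "0 \<le> s \<Longrightarrow> 1 \<le> hyp_sum a b c N s"
proof -
  assume "0 \<le> s"
  then have "(\<Sum>k\<le>0. hyp_term a b c k * s ^ k) \<le> hyp_sum a b c N s"
    unfolding hyp_sum_def by (intro sum_mono2) (auto intro!: mult_nonneg_nonneg less_imp_le[OF hyp_term_pos])
  then show ?thesis by (simp add: hyp_term_def)
qed

lemma hyp_term_eq_Beta:
  "hyp_term a b c k * Beta b (c - b) = pochhammer a k / fact k * Beta (b + real k) (c - b)"
proof -
  have "pochhammer b k = Gamma (b + real k) / Gamma b" "pochhammer c k = Gamma (c + real k) / Gamma c"
    using b c_pos by (auto intro!: pochhammer_Gamma)
  moreover have "Gamma b > 0" "Gamma c > 0" "Gamma (c + real k) > 0" using b c_pos by (auto simp: Gamma_real_pos)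
  ultimately show ?thesis
    by (simp add: hyp_term_def Beta_def field_simps)
qed

text \<open>Gauss's summation theorem, by integrating the binomial series of \<open>(1 - s) powr (- a)\<close>
  against a beta density.\<close>

lemma gauss_sum:
  "hyp_term a b c sums (Gamma c * Gamma (c - a - b) / (Gamma (c - a) * Gamma (c - b)))"
proof -
  have cb: "c - b > 0" and cab: "c - a - b > 0" using abc a by linarith+
  let ?w = "beta_weight b (c - b - 1)"
  have binom: "(\<Sum>k. ennreal (pochhammer a k / fact k * beta_weight (b + real k) (c - b - 1) s)) =
      ennreal (beta_weight b (c - a - b - 1) s)" for s
  proof (cases "s \<in> {0<..<1}")
    case True
    have "(\<lambda>k. (- a gchoose k) * (- s) ^ k) sums (1 + (- s)) powr (- a)"
      by (rule gen_binomial_real) (use True in auto)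
    moreover have "(- a gchoose k) * (- s) ^ k = pochhammer a k / fact k * s ^ k" for k
    proof -
      have "(- 1) ^ k * (- s) ^ k = s ^ k" by (simp only: power_mult_distrib[symmetric]) simp
      then show ?thesis unfolding gbinomial_pochhammer by (simp add: mult.commute mult.left_commute)
    qed
    ultimately have "(\<lambda>k. pochhammer a k / fact k * s ^ k) sums (1 - s) powr (- a)" by simp
    from sums_mult[OF this, of "?w s"]
    have "(\<lambda>k. pochhammer a k / fact k * beta_weight (b + real k) (c - b - 1) s) sums (?w s * (1 - s) powr (- a))"
      by (simp add: beta_weight_times_power[symmetric] mult_ac)
    moreover have "(1 - s) powr (c - b - 1) * (1 - s) powr (- a) = (1 - s) powr (c - a - b - 1)"
      using True by (simp add: powr_add[symmetric] algebra_simps)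
    then have "?w s * (1 - s) powr (- a) = beta_weight b (c - a - b - 1) s"
      by (simp add: beta_weight_def mult.assoc)
    moreover have "0 \<le> pochhammer a k / fact k * beta_weight (b + real k) (c - b - 1) s" for k
      using a by (intro mult_nonneg_nonneg beta_weight_nonneg divide_nonneg_pos) (auto simp: pochhammer_nonneg)
    ultimately have "(\<lambda>k. ennreal (pochhammer a k / fact k * beta_weight (b + real k) (c - b - 1) s)) sums 
      ennreal (beta_weight b (c - a - b - 1) s)"
      by (subst sums_ennreal) (auto simp: beta_weight_nonneg)
    then show ?thesis by (rule sums_unique[symmetric])
  qed (simp add: beta_weight_def)
  have "ennreal (Beta b (c - a - b)) = (\<integral>\<^sup>+s. (\<Sum>k. ennreal (pochhammer a k / fact k * beta_weight (b + real k) (c - b - 1) s)) \<partial>lborel)"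
    using nn_integral_beta_weight[of b "c - a - b - 1"] b cab unfolding binom by simp
  also have "\<dots> = (\<Sum>k. \<integral>\<^sup>+s. ennreal (pochhammer a k / fact k) * ennreal (beta_weight (b + real k) (c - b - 1) s) \<partial>lborel)"
    using a by (subst nn_integral_suminf) (auto simp: ennreal_mult[symmetric] pochhammer_nonneg beta_weight_nonneg)
  also have "\<dots> = (\<Sum>k. ennreal (hyp_term a b c k * Beta b (c - b)))"
  proof (intro suminf_cong)
    fix k
    have "(\<integral>\<^sup>+s. ennreal (beta_weight (b + real k) (c - b - 1) s) \<partial>lborel) = ennreal (Beta (b + real k) (c - b))"
      using nn_integral_beta_weight[of "b + real k" "c - b - 1"] b cb by simp
    then show "(\<integral>\<^sup>+s. ennreal (pochhammer a k / fact k) * ennreal (beta_weight (b + real k) (c - b - 1) s) \<partial>lborel)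
       = ennreal (hyp_term a b c k * Beta b (c - b))"
      using a b cb by (simp add: nn_integral_cmult hyp_term_eq_Beta ennreal_mult[symmetric] pochhammer_nonneg less_imp_le Beta_pos)
  qed
  finally have "(\<lambda>k. ennreal (hyp_term a b c k * Beta b (c - b))) sums ennreal (Beta b (c - a - b))"
    using summable_sums[OF summableI] by metis
  then have "(\<lambda>k. hyp_term a b c k * Beta b (c - b)) sums Beta b (c - a - b)"
    using b cb cab by (subst (asm) sums_ennreal) (auto intro!: mult_nonneg_nonneg less_imp_le[OF hyp_term_pos] less_imp_le[OF Beta_pos])
  from sums_divide[OF this, of "Beta b (c - b)"]
  have "hyp_term a b c sums (Beta b (c - a - b) / Beta b (c - b))"
    using Beta_pos[OF b cb] by simp
  moreover have "Beta b (c - a - b) / Beta b (c - b) = Gamma c * Gamma (c - a - b) / (Gamma (c - a) * Gamma (c - b))"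
    using Gamma_real_pos[OF b] by (simp add: Beta_def)
  ultimately show ?thesis by simp
qed

text \<open>The angular part of the quadratic form on the partial sum of order \<open>N\<close>, up to a constant factor.\<close>

definition energy :: "nat \<Rightarrow> real" where
  "energy N = (LINT s|lborel. beta_weight c (a + b - c) s * (s * (1 - s) * (hyp_sum' a b c N s)\<^sup>2 + a * b * (hyp_sum a b c N s)\<^sup>2))"

text \<open>The integral of the residual of the hypergeometric equation against the beta weight. As \<open>N\<close> tends to infinity the residual
  concentrates at \<open>s = 1\<close>, and \<open>flux\<close> tends to the boundary flux \<open>lim (1 - s) powr (a + b - c + 1) * F'(s)\<close>
  of the full series there.\<close>

definition flux :: "nat \<Rightarrow> real" where
  "flux N = (a + real N) * (b + real N) * hyp_term a b c N * Beta (c + real N) (a + b - c + 1)"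

text \<open>Multiplying the equation by the partial sum and integrating by parts leaves only the residual:
  the boundary terms vanish because \<open>c\<close> and \<open>a + b - c + 1\<close> are positive.\<close>

lemma energy_le: "energy N \<le> flux N * hyp_sum a b c N 1"
proof -
  let ?S = "hyp_sum a b c N" and ?S' = "hyp_sum' a b c N" and ?S'' = "hyp_sum'' a b c N"
  let ?w = "beta_weight c (a + b - c)"
  let ?q = "(a + real N) * (b + real N) * hyp_term a b c N"
  let ?D = "\<lambda>s. ?w s * (s * (1 - s) * (?S' s)\<^sup>2 + a * b * (?S s)\<^sup>2) - ?q * (?w s * (s ^ N * ?S s))"
  define P where "P s = s powr c * (1 - s) powr (a + b - c + 1) * (?S' s * ?S s)" for s
  have ce: "c > 0" "a + b - c > -1" using c_pos abc by linarith+
  note int = beta_weight_times_continuous_integrable[OF ce]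
  have i1: "integrable lborel (\<lambda>s. ?w s * (s * (1 - s) * (?S' s)\<^sup>2 + a * b * (?S s)\<^sup>2))"
    by (intro int continuous_intros hyp_sum_continuous)
  have i2: "integrable lborel (\<lambda>s. ?w s * (s ^ N * ?S s))"
    by (intro int continuous_intros hyp_sum_continuous)
  have i3: "integrable lborel (\<lambda>s. ?w s * s ^ N)"
    by (intro int continuous_intros)
  have "(P has_real_derivative ?D s) (at s)" if s: "s \<in> {0<..<1}" for s
  proof -
    have p: "s powr c = s powr (c - 1) * s" "(1 - s) powr (a + b - c + 1) = (1 - s) powr (a + b - c) * (1 - s)"
      using s powr_add[of s "c - 1" 1] powr_add[of "1 - s" "a + b - c" 1] by simp_all
    have d1: "((\<lambda>s. s powr c) has_real_derivative c * s powr (c - 1)) (at s)"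
      using s by (intro has_real_derivative_powr) auto
    have d2: "((\<lambda>s. (1 - s) powr (a + b - c + 1)) has_real_derivative 
        (a + b - c + 1) * (1 - s) powr (a + b - c + 1 - of_nat 1) * (0 - 1)) (at s)"
      by (rule DERIV_fun_powr[OF DERIV_diff[OF DERIV_const DERIV_ident]]) (use s in auto)
    have "(P has_real_derivative 
       (c * s powr (c - 1)) * (1 - s) powr (a + b - c + 1) * (?S' s * ?S s)
       - s powr c * ((a + b - c + 1) * (1 - s) powr (a + b - c)) * (?S' s * ?S s)
       + s powr c * (1 - s) powr (a + b - c + 1) * (?S'' s * ?S s + ?S' s * ?S' s)) (at s)"
      unfolding P_def
      by (rule DERIV_cong[OF DERIV_mult[OF DERIV_mult[OF d1 d2] DERIV_mult[OF hyp_sum'_deriv hyp_sum_deriv]]])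
         (simp add: algebra_simps)
    also have "(c * s powr (c - 1)) * (1 - s) powr (a + b - c + 1) * (?S' s * ?S s)
       - s powr c * ((a + b - c + 1) * (1 - s) powr (a + b - c)) * (?S' s * ?S s)
       + s powr c * (1 - s) powr (a + b - c + 1) * (?S'' s * ?S s + ?S' s * ?S' s) =
       ?w s * (s * (1 - s) * (?S' s)\<^sup>2 + ?S s * (s * (1 - s) * ?S'' s + (c - (a + b + 1) * s) * ?S' s))"
      using s unfolding p beta_weight_def by (simp add: algebra_simps power2_eq_square)
    also have "\<dots> = ?D s" unfolding hyp_sum_ode[OF c_pos] by (simp add: algebra_simps power2_eq_square)
    finally show ?thesis .
  qed
  moreover have "continuous_on {0..1} P"
    unfolding P_def using ce by (intro continuous_intros continuous_on_powr' hyp_sum_continuous) auto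
  ultimately have "(?D has_integral (P 1 - P 0)) {0..1}"
    by (intro fundamental_theorem_of_calculus_interior) (auto simp: has_real_derivative_iff_has_vector_derivative)
  then have "(?D has_integral 0) {0..1}" using ce by (simp add: P_def)
  moreover have "?D s = 0" if "s \<notin> {0..1}" for s using that by (auto simp: beta_weight_def)
  ultimately have "(?D has_integral 0) UNIV"
    by (subst (asm) has_integral_restrict_UNIV[symmetric]) (auto elim!: has_integral_eq[rotated])
  moreover have "(?D has_integral (energy N - ?q * (LINT s|lborel. ?w s * (s ^ N * ?S s)))) UNIV"
    using has_integral_integral_lborel[of ?D] i1 i2 by (simp add: energy_def)
  ultimately have "0 = energy N - ?q * (LINT s|lborel. ?w s * (s ^ N * ?S s))"
    by (rule has_integral_unique)
  then have "energy N = ?q * (LINT s|lborel. ?w s * (s ^ N * ?S s))" by simp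
  also have "\<dots> \<le> ?q * (LINT s|lborel. ?w s * s ^ N * ?S 1)"
  proof (intro mult_left_mono integral_mono i2)
    show "?w s * (s ^ N * ?S s) \<le> ?w s * s ^ N * ?S 1" for s
    proof (cases "s \<in> {0<..<1}")
      case True
      then show ?thesis using hyp_sum_mono[of s N] 
        by (auto simp: mult.assoc beta_weight_nonneg intro!: mult_left_mono)
    qed (auto simp: beta_weight_def)
    show "?q \<ge> 0" using a b hyp_term_pos[of N] by simp
  qed (use i3 in simp)
  also have "\<dots> = flux N * hyp_sum a b c N 1"
    using beta_weight_has_integral(2)[of "c + real N" "a + b - c"] ce
    by (simp add: flux_def beta_weight_times_power)
  finally show ?thesis .
qed

text \<open>The coefficients combine into quotients of the products \<open>pochhammer z (N+1) / (N! * N powr z)\<close>,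
  whose limits are reciprocal Gamma values. The powers of \<open>N\<close> cancel because the parameters satisfy
  \<open>c + (a + b - c + 1) = (a + b) + 1\<close>.\<close>

lemma flux_tendsto: "flux \<longlonglongrightarrow> Gamma c * Gamma (a + b - c + 1) / (Gamma a * Gamma b)"
proof -
  have ab: "a + b > 0" using a b by linarith
  have G: "Gamma a > 0" "Gamma b > 0" "Gamma (a + b) > 0" "Gamma c > 0"
    using a b ab c_pos by (auto simp: Gamma_real_pos)
  let ?K = "Gamma c * Gamma (a + b - c + 1) / Gamma (a + b)"
  have flux_eq: "flux N = rGamma_series a N * rGamma_series b N / rGamma_series (a + b) N * ?K" for N
  proof -
    have c: "Gamma (c + real N) = pochhammer c N * Gamma c"
    proof -
      have "pochhammer c N = Gamma (c + real N) / Gamma c" using c_pos by (auto intro!: pochhammer_Gamma)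
      then show ?thesis using G by simp
    qed
    have g: "Gamma (a + b + real N + 1) = pochhammer (a + b) (Suc N) * Gamma (a + b)"
    proof -
      have "pochhammer (a + b) (Suc N) = Gamma (a + b + real (Suc N)) / Gamma (a + b)"
        using ab by (intro pochhammer_Gamma) (auto elim!: nonpos_Ints_cases)
      moreover have "a + b + real (Suc N) = a + b + real N + 1" by simp
      ultimately show ?thesis using G by (simp del: pochhammer_Suc of_nat_Suc)
    qed
    have pos: "pochhammer c N > 0" "pochhammer (a + b) (Suc N) > 0" 
      using c_pos ab by (auto intro: pochhammer_pos)
    have arg: "c + real N + (a + b - c + 1) = a + b + real N + 1" by simp
    have "flux N = (pochhammer a (Suc N) * pochhammer b (Suc N)) / (fact N * pochhammer (a + b) (Suc N)) * ?K"
      unfolding flux_def hyp_term_def Beta_def arg c g using pos G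
      by (simp add: pochhammer_Suc[of a] pochhammer_Suc[of b] field_simps del: pochhammer_Suc)
    also have "\<dots> = rGamma_series a N * rGamma_series b N / rGamma_series (a + b) N * ?K"
      using pos by (simp add: rGamma_series_def exp_add field_simps)
    finally show ?thesis .
  qed
  have "(\<lambda>N. rGamma_series a N * rGamma_series b N / rGamma_series (a + b) N * ?K) \<longlonglongrightarrow> 
     rGamma a * rGamma b / rGamma (a + b) * ?K"
    using ab by (intro tendsto_intros) (auto simp: rGamma_eq_zero_iff)
  moreover have "rGamma a * rGamma b / rGamma (a + b) * ?K = Gamma c * Gamma (a + b - c + 1) / (Gamma a * Gamma b)"
    using G by (simp add: rGamma_inverse_Gamma field_simps)
  ultimately show ?thesis unfolding flux_eq[abs_def] by simp
qed

text \<open>The value at one of the hypergeometric function with parameters \<open>a\<close>, \<open>b\<close>, \<open>c\<close>.\<close>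

definition gauss :: real where
  "gauss = Gamma c * Gamma (c - a - b) / (Gamma (c - a) * Gamma (c - b))"

text \<open>The limit of \<open>flux\<close> divided by \<open>gauss\<close>; the constant \<open>K\<close> is twice this number.\<close>

definition trace_const :: real where
  "trace_const = Gamma (a + b - c + 1) * Gamma (c - a) * Gamma (c - b) / (Gamma a * Gamma b * Gamma (c - a - b))"

lemma hyp_sum_le_gauss: "hyp_sum a b c N 1 \<le> gauss"
proof -
  have "sum (hyp_term a b c) {..<Suc N} \<le> suminf (hyp_term a b c)"
    by (intro sum_le_suminf sums_summable[OF gauss_sum]) (auto intro!: less_imp_le[OF hyp_term_pos])
  then show ?thesis using sums_unique[OF gauss_sum] 
    by (simp add: hyp_sum_def gauss_def lessThan_Suc_atMost)
qed

text \<open>By \<open>energy_le\<close> the excess is at most \<open>(flux N - trace_const * S\<^sub>N(1)) * S\<^sub>N(1)\<close>. The first factor tends to zero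
  and the second one is bounded.\<close>

lemma energy_nearly_minimal:
  assumes "\<epsilon> > 0"
  shows "\<exists>N. energy N \<le> trace_const * (hyp_sum a b c N 1)\<^sup>2 + \<epsilon>"
proof -
  have p: "c - a > 0" "c - b > 0" "c - a - b > 0" "a + b - c + 1 > 0" using a b abc by linarith+
  have G: "Gamma a > 0" "Gamma b > 0" "Gamma c > 0" "Gamma (c - a) > 0" "Gamma (c - b) > 0" "Gamma (c - a - b) > 0"
    using a b c_pos p by (auto simp: Gamma_real_pos)
  have "(\<lambda>N. hyp_sum a b c N 1) \<longlonglongrightarrow> gauss"
    using gauss_sum by (simp add: hyp_sum_def gauss_def sums_def_le)
  then have "(\<lambda>N. (flux N - trace_const * hyp_sum a b c N 1)) \<longlonglongrightarrow> 
      Gamma c * Gamma (a + b - c + 1) / (Gamma a * Gamma b) - trace_const * gauss"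
    by (intro tendsto_intros flux_tendsto)
  moreover have "Gamma c * Gamma (a + b - c + 1) / (Gamma a * Gamma b) - trace_const * gauss = 0"
    using G by (simp add: trace_const_def gauss_def field_simps)
  moreover have g: "gauss > 0" using G by (simp add: gauss_def)
  ultimately have "\<forall>\<^sub>F N in sequentially. flux N - trace_const * hyp_sum a b c N 1 < \<epsilon> / gauss"
    using assms by (intro order_tendstoD(2)[of _ 0]) auto
  then obtain N where N: "flux N - trace_const * hyp_sum a b c N 1 < \<epsilon> / gauss"
    by (auto simp: eventually_sequentially)
  have S: "0 \<le> hyp_sum a b c N 1" using hyp_sum_ge_1[of 1 N] by simp
  have "(flux N - trace_const * hyp_sum a b c N 1) * hyp_sum a b c N 1 \<le> \<epsilon> / gauss * gauss"
  proof (rule order_trans[OF mult_right_mono mult_left_mono])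
    show "flux N - trace_const * hyp_sum a b c N 1 \<le> \<epsilon> / gauss" using N by simp
    show "0 \<le> \<epsilon> / gauss" using assms g by simp
  qed (use S hyp_sum_le_gauss[of N] in auto)
  then have "flux N * hyp_sum a b c N 1 \<le> trace_const * (hyp_sum a b c N 1)\<^sup>2 + \<epsilon>"
    using g by (simp add: algebra_simps power2_eq_square)
  then show ?thesis using energy_le[of N] by (intro exI[of _ N]) linarith
qed

end

section \<open>Polar coordinates adapted to the dual norm\<close>

text \<open>A measure on the line is determined by its values on \<open>{..<t}\<close> if these are finite. The reflection
  \<open>\<tau> \<mapsto> - \<tau>\<close> in the proof turns these intervals into the rays \<open>{t<..}\<close> of the uniqueness lemma; the rays
  themselves would have infinite measure.\<close>

lemma nn_integral_pushforward:
  fixes \<phi> :: "'a \<Rightarrow> real" and w f :: "real \<Rightarrow> ennreal"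
  assumes [measurable]: "\<phi> \<in> borel_measurable M" "w \<in> borel_measurable borel" "f \<in> borel_measurable borel"
    and sub: "\<And>t. emeasure M {x\<in>space M. \<phi> x < t} = (\<integral>\<^sup>+\<tau>. w \<tau> * indicator {..<t} \<tau> \<partial>lborel)"
    and fin: "\<And>t. emeasure M {x\<in>space M. \<phi> x < t} < \<infinity>"
  shows "(\<integral>\<^sup>+x. f (\<phi> x) \<partial>M) = (\<integral>\<^sup>+\<tau>. f \<tau> * w \<tau> \<partial>lborel)"
proof -
  have m1: "emeasure (distr M borel (\<lambda>x. - \<phi> x)) {t<..} = emeasure M {x\<in>space M. \<phi> x < - t}" for t
    by (subst emeasure_distr) (auto intro!: arg_cong[where f="emeasure M"])
  have m2: "emeasure (distr (density lborel w) borel uminus) {t<..} = (\<integral>\<^sup>+\<tau>. w \<tau> * indicator {..<-t} \<tau> \<partial>lborel)" for t :: real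
  proof -
    have "uminus -` {t<..} = {..<-t}" by auto
    then show ?thesis by (simp add: emeasure_distr emeasure_density)
  qed
  have "distr M borel (\<lambda>x. - \<phi> x) = distr (density lborel w) borel uminus"
    by (rule measure_eqI_lessThan) (simp_all add: m1 m2 sub[symmetric] fin[unfolded infinity_ennreal_def])
  then have "(\<integral>\<^sup>+y. f (- y) \<partial>distr M borel (\<lambda>x. - \<phi> x)) = (\<integral>\<^sup>+y. f (- y) \<partial>distr (density lborel w) borel uminus)"
    by simp
  then show ?thesis
    by (simp add: nn_integral_distr nn_integral_density mult.commute)
qed

text \<open>The substitution \<open>\<tau> = sqrt (1/s - 1)\<close>, which turns the slope \<open>\<tau> = y / \<rho>\<close> into
  \<open>s = \<rho>\<^sup>2 / (\<rho>\<^sup>2 + y\<^sup>2)\<close>.\<close>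

lemma nn_integral_slope_substitution:
  fixes f :: "real \<Rightarrow> ennreal"
  assumes [measurable]: "f \<in> borel_measurable borel"
  shows "(\<integral>\<^sup>+\<tau>. f \<tau> * indicator {0<..} \<tau> \<partial>lborel) =
    (\<integral>\<^sup>+s. ennreal (1/2 * beta_weight (-1/2) (-1/2) s) * f (sqrt (1 / s - 1)) \<partial>lborel)"
proof -
  let ?d = "\<lambda>s. 1/2 * beta_weight (-1/2) (-1/2) s"
  let ?g = "\<lambda>s::real. sqrt (1 / s - 1)"
  have r: "(\<integral>\<^sup>+\<tau>. indicator {0<..} \<tau> * indicator {..<t} \<tau> \<partial>lborel) = ennreal (max t 0)" for t :: real
  proof -
    have "(\<integral>\<^sup>+\<tau>. indicator {0<..} \<tau> * indicator {..<t} \<tau> \<partial>lborel) = (\<integral>\<^sup>+\<tau>. indicator {0<..<t} \<tau> \<partial>lborel)"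
      by (intro nn_integral_cong) (auto simp: indicator_def)
    then show ?thesis by (simp add: max_def)
  qed
  have l: "emeasure (density lborel ?d) {s \<in> space (density lborel ?d). ?g s < t} = ennreal (max t 0)" for t
  proof -
    have "emeasure (density lborel ?d) {s \<in> space (density lborel ?d). ?g s < t} 
       = (\<integral>\<^sup>+s. ennreal (?d s) * indicator {s. ?g s < t} s \<partial>lborel)"
      by (subst emeasure_density) auto
    also have "\<dots> = ennreal (max t 0)"
    proof (cases "t > 0")
      case False
      have "ennreal (?d s) * indicator {s. ?g s < t} s = 0" for s
      proof (cases "s \<in> {0<..<1}")
        case True
        then have "1 / s - 1 > 0" by simp
        then have "?g s > 0" by (rule real_sqrt_gt_zero)
        then have "\<not> ?g s < t" using False by linarith
        then show ?thesis by (simp add: indicator_def)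
      qed (simp add: beta_weight_def)
      then have "(\<integral>\<^sup>+s. ennreal (?d s) * indicator {s. ?g s < t} s \<partial>lborel) = (\<integral>\<^sup>+(s::real). 0 \<partial>lborel)"
        by (intro nn_integral_cong)
      then show ?thesis using False by (simp add: max_def)
    next
      case True
      \<comment> \<open>\<open>s0\<close> is the parameter at which the slope equals \<open>t\<close>; larger parameters give smaller slopes.\<close>
      define s0 where "s0 = 1 / (1 + t\<^sup>2)"
      have s0: "0 < s0" "s0 < 1" using True by (simp_all add: s0_def add_pos_nonneg)
      have inv: "1 / s0 - 1 = t\<^sup>2" by (simp add: s0_def)
      have "((\<lambda>s. - ?g s) has_real_derivative ?d s) (at s)" if s: "s \<in> {s0<..<1}" for s
      proof -
        have s': "0 < s" "s < 1" using s s0 by auto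
        have pos: "1 / s - 1 > 0" using s' by simp
        have "((\<lambda>s. - ?g s) has_real_derivative (1 / (2 * sqrt (1 / s - 1)) / s\<^sup>2)) (at s)"
          using s' pos by (auto intro!: derivative_eq_intros simp: field_simps power2_eq_square)
        also have "1 / (2 * sqrt (1 / s - 1)) / s\<^sup>2 = ?d s"
        proof -
          have "1 / s - 1 = (1 - s) / s" using s' by (simp add: field_simps)
          then have q: "sqrt (1 / s - 1) = (1 - s) powr (1/2) * s powr (- (1/2))"
            using s' by (simp add: powr_half_sqrt real_sqrt_divide powr_minus_divide)
          have "s powr (-1/2 - 1) * (1 - s) powr (-1/2) * (s\<^sup>2 * ((1 - s) powr (1/2) * s powr (- (1/2)))) =
             (s powr (-1/2 - 1) * s powr 2 * s powr (-1/2)) * ((1 - s) powr (-1/2) * (1 - s) powr (1/2))"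
          proof -
            have "s\<^sup>2 = s powr 2" using s' by simp
            then show ?thesis by (simp only: mult_ac minus_divide_left)
          qed
          also have "\<dots> = 1" using s' by (simp only: powr_add[symmetric]) simp
          finally show ?thesis using s' pos unfolding q
            by (simp add: beta_weight_def field_simps)
        qed
        finally show ?thesis .
      qed
      then have "(?d has_integral (- ?g 1 - - ?g s0)) {s0..1}"
        using s0 by (intro fundamental_theorem_of_calculus_interior)
          (auto simp: has_real_derivative_iff_has_vector_derivative intro!: continuous_intros)
      then have "(?d has_integral t) {s0..1}" unfolding inv using True by simp
      from nn_integral_has_integral_lebesgue'[OF _ this]
      have "(\<integral>\<^sup>+s. ennreal (?d s) * indicator {s0..1} s \<partial>lborel) = ennreal t"
        by (simp add: beta_weight_nonneg)
      moreover have "(\<integral>\<^sup>+s. ennreal (?d s) * indicator {s0..1} s \<partial>lborel) =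
        (\<integral>\<^sup>+s. ennreal (?d s) * indicator {s. ?g s < t} s \<partial>lborel)"
      proof (rule nn_integral_cong_AE, rule eventually_mono[OF AE_lborel_singleton[of s0]])
        fix s assume "s \<noteq> s0"
        show "ennreal (?d s) * indicator {s0..1} s = ennreal (?d s) * indicator {s. ?g s < t} s"
        proof (cases "s \<in> {0<..<1}")
          case T: True
          have "?g s < t \<longleftrightarrow> 1 / s - 1 < t\<^sup>2" using True
            by (metis real_sqrt_abs real_sqrt_less_iff abs_of_pos)
          also have "\<dots> \<longleftrightarrow> s0 < s" using T s0 by (simp add: s0_def field_simps)
          finally show ?thesis using T \<open>s \<noteq> s0\<close> by (auto simp: indicator_def)
        qed (simp add: beta_weight_def)
      qed
      ultimately show ?thesis using True by (simp add: max_def)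
    qed
    finally show ?thesis .
  qed
  have "(\<integral>\<^sup>+s. f (?g s) \<partial>density lborel ?d) = (\<integral>\<^sup>+\<tau>. f \<tau> * indicator {0<..} \<tau> \<partial>lborel)"
  proof (rule nn_integral_pushforward)
    show "emeasure (density lborel ?d) {s \<in> space (density lborel ?d). ?g s < t} = 
      (\<integral>\<^sup>+\<tau>. indicator {0<..} \<tau> * indicator {..<t} \<tau> \<partial>lborel)" for t
      unfolding l r ..
    show "emeasure (density lborel ?d) {s \<in> space (density lborel ?d). ?g s < t} < \<infinity>" for t
      unfolding l by simp
  qed auto
  then show ?thesis by (simp add: nn_integral_density)
qed

lemma nn_integral_lborel_scale:
  fixes f :: "'a::euclidean_space \<Rightarrow> ennreal"
  assumes [measurable]: "f \<in> borel_measurable borel" and c: "c > 0"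
  shows "(\<integral>\<^sup>+x. f x \<partial>lborel) = ennreal (c powr DIM('a)) * (\<integral>\<^sup>+x. f (c *\<^sub>R x) \<partial>lborel)"
  using c by (subst lborel_affine[of c 0])
    (auto simp: nn_integral_density nn_integral_distr nn_integral_cmult powr_realpow)

context norm_strictly_convex
begin

lemma H0_measurable [measurable]: "H0 \<in> borel_measurable borel"
  by (intro borel_measurable_continuous_onI H0_continuous)

text \<open>The volume of the unit ball of \<open>H0\<close>.\<close>

definition \<kappa> :: real where "\<kappa> = measure lborel {x. H0 x < 1}"

lemma \<kappa>_nonneg: "0 \<le> \<kappa>" by (simp add: \<kappa>_def)

lemma emeasure_H0_ball: "emeasure lborel {x. H0 x < 1} = ennreal \<kappa>"
proof -
  obtain b where b: "\<And>x. b * norm x \<le> H0 x" "b > 0" using H0_ge_norm by blast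
  have "{x. H0 x < 1} \<subseteq> ball 0 (1 / b)"
  proof
    fix x assume "x \<in> {x. H0 x < 1}"
    then have "b * norm x < 1" using b(1)[of x] by simp
    then show "x \<in> ball 0 (1 / b)" using b(2) by (simp add: field_simps)
  qed
  then have "emeasure lborel {x. H0 x < 1} \<le> emeasure lborel (ball (0::'a) (1 / b))"
    by (intro emeasure_mono) auto
  then have "emeasure lborel {x. H0 x < 1} \<noteq> \<infinity>"
    using emeasure_lborel_ball_finite[of "0::'a" "1/b"] by (auto simp: top_unique)
  then show ?thesis by (simp add: \<kappa>_def emeasure_eq_ennreal_measure)
qed

lemma emeasure_H0_sublevel:
  "emeasure lborel {x. H0 x < t} = ennreal (\<kappa> * (max t 0) powr DIM('a))"
proof (cases "t > 0")
  case True
  have [measurable]: "{x. H0 x < t} \<in> sets borel" for t by measurable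
  have "emeasure lborel {x. H0 x < t} = (\<integral>\<^sup>+x. indicator {x. H0 x < t} x \<partial>lborel)" by simp
  also have "\<dots> = ennreal (t powr DIM('a)) * (\<integral>\<^sup>+x. indicator {x. H0 x < t} (t *\<^sub>R x) \<partial>lborel)"
    by (rule nn_integral_lborel_scale) (use True in auto)
  also have "(\<integral>\<^sup>+x. indicator {x. H0 x < t} (t *\<^sub>R x) \<partial>lborel) = (\<integral>\<^sup>+x. indicator {x. H0 x < 1} x \<partial>lborel)"
    using True by (intro nn_integral_cong) (auto simp: indicator_def H0_scaleR)
  also have "\<dots> = ennreal \<kappa>" by (simp add: emeasure_H0_ball)
  finally show ?thesis using True \<kappa>_nonneg by (simp add: max_def ennreal_mult mult.commute)
next
  case False
  then have "{x. H0 x < t} = {}" using H0_nonneg by (auto simp: not_less intro: order_trans)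
  then show ?thesis using False by (simp add: max_def)
qed

text \<open>By homogeneity, the sublevel set at height \<open>t\<close> has volume \<open>\<kappa> * t powr n\<close>.\<close>

lemma nn_integral_H0:
  assumes [measurable]: "f \<in> borel_measurable borel"
  shows "(\<integral>\<^sup>+x. f (H0 x) \<partial>lborel) =
    (\<integral>\<^sup>+\<rho>. f \<rho> * ennreal (\<kappa> * DIM('a) * (indicator {0<..} \<rho> * \<rho> powr (real DIM('a) - 1))) \<partial>lborel)"
proof (rule nn_integral_pushforward)
  have \<kappa>: "\<kappa> \<ge> 0" by (simp add: \<kappa>_def)
  define n where "n = real DIM('a)"
  have n: "n > 0" by (simp add: n_def)
  fix t
  have "(\<integral>\<^sup>+\<tau>. ennreal (\<kappa> * n * (indicator {0<..} \<tau> * \<tau> powr (n - 1))) * indicator {..<t} \<tau> \<partial>lborel)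
    = ennreal (\<kappa> * (max t 0) powr n)"
  proof (cases "t > 0")
    case True
    have "((\<lambda>\<tau>. \<tau> powr (n - 1)) has_integral t powr (n - 1 + 1) / (n - 1 + 1)) {0..t}"
      by (rule has_integral_powr_from_0) (use n True in auto)
    from has_integral_mult_right[OF this, of "\<kappa> * n"]
    have "((\<lambda>\<tau>. \<kappa> * n * \<tau> powr (n - 1)) has_integral (\<kappa> * t powr n)) {0..t}"
      using n by simp
    from nn_integral_has_integral_lebesgue'[OF _ this]
    have "(\<integral>\<^sup>+\<tau>. ennreal (\<kappa> * n * \<tau> powr (n - 1)) * indicator {0..t} \<tau> \<partial>lborel) = ennreal (\<kappa> * t powr n)"
      using \<kappa> n by simp
    moreover have "(\<integral>\<^sup>+\<tau>. ennreal (\<kappa> * n * (indicator {0<..} \<tau> * \<tau> powr (n - 1))) * indicator {..<t} \<tau> \<partial>lborel) =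
      (\<integral>\<^sup>+\<tau>. ennreal (\<kappa> * n * \<tau> powr (n - 1)) * indicator {0..t} \<tau> \<partial>lborel)"
      by (rule nn_integral_cong_AE, rule eventually_mono[OF eventually_conj[OF 
            AE_lborel_singleton[of 0] AE_lborel_singleton[of t]]]) (auto simp: indicator_def)
    ultimately show ?thesis using True by (simp add: max_def)
  next
    case False
    then have "(\<integral>\<^sup>+\<tau>. ennreal (\<kappa> * n * (indicator {0<..} \<tau> * \<tau> powr (n - 1))) * indicator {..<t} \<tau> \<partial>lborel) =
      (\<integral>\<^sup>+(\<tau>::real). 0 \<partial>lborel)"
      by (intro nn_integral_cong) (auto simp: indicator_def)
    then show ?thesis using False by (simp add: max_def)
  qed
  then show "emeasure lborel {x \<in> space lborel. H0 x < t} = (\<integral>\<^sup>+\<tau>. ennreal (\<kappa> * DIM('a) * (indicator {0<..} \<tau> * \<tau> powr (real DIM('a) - 1))) * indicator {..<t} \<tau> \<partial>lborel)"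
    using emeasure_H0_sublevel[of t] by (simp add: n_def)
  show "emeasure lborel {x \<in> space lborel. H0 x < t} < \<infinity>"
    using emeasure_H0_sublevel[of t] by simp
qed (auto)

text \<open>Substituting \<open>y = H0 x * sqrt (1/s - 1)\<close> and then rescaling \<open>x\<close> by \<open>sqrt s\<close> separates
  the variables \<open>r\<close> and \<open>s\<close> using one-dimensional substitutions and homogeneity only.\<close>

lemma nn_integral_polar:
  fixes A B :: "real \<Rightarrow> real" and \<alpha> :: real
  assumes [measurable]: "A \<in> borel_measurable borel" "B \<in> borel_measurable borel"
    and nonneg: "\<And>\<rho>. A \<rho> \<ge> 0" "\<And>s. 0 \<le> s \<Longrightarrow> s \<le> 1 \<Longrightarrow> B s \<ge> 0"
  shows "(\<integral>\<^sup>+z. ennreal (snd z powr \<alpha> * (A (Phi_dual H z) * B ((H0 (fst z))\<^sup>2 / (Phi_dual H z)\<^sup>2))) \<partial>lebesgue_on halfspace)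
    = (\<integral>\<^sup>+s. ennreal (1/2 * beta_weight (DIM('a) / 2) ((\<alpha> - 1) / 2) s * B s) \<partial>lborel) *
      (\<integral>\<^sup>+\<rho>. ennreal (\<kappa> * DIM('a) * (indicator {0<..} \<rho> * (\<rho> powr (DIM('a) + \<alpha>) * A \<rho>))) \<partial>lborel)"
proof -
  define n where "n = real DIM('a)"
  have \<kappa>: "\<kappa> \<ge> 0" by (simp add: \<kappa>_def)
  let ?F = "\<lambda>h y. ennreal (y powr \<alpha> * (A (sqrt (h\<^sup>2 + y\<^sup>2)) * B (h\<^sup>2 / (h\<^sup>2 + y\<^sup>2))))"
  let ?G = "\<lambda>s h. ennreal (1/2 * (s powr (- (\<alpha> + 3) / 2) * (1 - s) powr ((\<alpha> - 1) / 2)) * B s) * 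
       ennreal (A (h / sqrt s) * h powr (1 + \<alpha>))"
  have Phi2: "(Phi_dual H z)\<^sup>2 = (H0 (fst z))\<^sup>2 + (snd z)\<^sup>2" for z
    by (simp add: Phi_dual_def)
  \<comment> \<open>On the line through \<open>x\<close> one has \<open>y = h * sqrt (1 / s - 1)\<close> and \<open>r = h / sqrt s\<close> with \<open>h = H0 x\<close>.\<close>
  have inner: "(\<integral>\<^sup>+y. ?F h y * indicator {0<..} y \<partial>lborel) = (\<integral>\<^sup>+s. ?G s h * indicator {0<..<1} s \<partial>lborel)"
    if h: "h > 0" for h
  proof -
    have "(\<integral>\<^sup>+y. ?F h y * indicator {0<..} y \<partial>lborel) = ennreal h * (\<integral>\<^sup>+y. ?F h (h * y) * indicator {0<..} y \<partial>lborel)"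
      using h by (subst nn_integral_real_affine[of _ h 0]) (auto intro!: arg_cong2[where f="(*)"] nn_integral_cong simp: indicator_def zero_less_mult_iff)
    also have "\<dots> = ennreal h * (\<integral>\<^sup>+s. ennreal (1/2 * beta_weight (-1/2) (-1/2) s) * ?F h (h * sqrt (1 / s - 1)) \<partial>lborel)"
      by (subst nn_integral_slope_substitution) auto
    also have "\<dots> = (\<integral>\<^sup>+s. ennreal h * (ennreal (1/2 * beta_weight (-1/2) (-1/2) s) * ?F h (h * sqrt (1 / s - 1))) \<partial>lborel)"
      by (rule nn_integral_cmult[symmetric]) measurable
    also have "\<dots> = (\<integral>\<^sup>+s. ?G s h * indicator {0<..<1} s \<partial>lborel)"
    proof (rule nn_integral_cong)
      fix s
      show "ennreal h * (ennreal (1/2 * beta_weight (-1/2) (-1/2) s) * ?F h (h * sqrt (1 / s - 1))) = ?G s h * indicator {0<..<1} s"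
      proof (cases "s \<in> {0<..<1}")
        case True
        then have s: "0 < s" "s < 1" by auto
        have pos: "1 / s - 1 \<ge> 0" using s by simp
        have R: "h\<^sup>2 + (h * sqrt (1 / s - 1))\<^sup>2 = h\<^sup>2 / s"
          using pos s by (simp add: power_mult_distrib algebra_simps)
        have r1: "sqrt (h\<^sup>2 / s) = h / sqrt s" using h by (simp add: real_sqrt_divide)
        have r2: "h\<^sup>2 / (h\<^sup>2 / s) = s" using h s by simp
        have "1 / s - 1 = (1 - s) / s" using s by (simp add: field_simps)
        then have "sqrt (1 / s - 1) = (1 - s) powr (1/2) * s powr (- (1/2))"
          using s by (simp add: powr_half_sqrt real_sqrt_divide powr_minus_divide)
        then have y: "(h * sqrt (1 / s - 1)) powr \<alpha> = h powr \<alpha> * ((1 - s) powr (\<alpha> / 2) * s powr (- \<alpha> / 2))"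
          using h s by (simp add: powr_mult powr_powr)
        have "h * (1/2 * beta_weight (-1/2) (-1/2) s * ((h * sqrt (1 / s - 1)) powr \<alpha> * (A (h / sqrt s) * B s)))
          = (1/2 * ((s powr (-1/2 - 1) * s powr (- \<alpha> / 2)) * ((1 - s) powr (-1/2) * (1 - s) powr (\<alpha> / 2))) * B s) * (A (h / sqrt s) * (h * h powr \<alpha>))"
          unfolding y using s by (simp add: beta_weight_def)
        also have "s powr (-1/2 - 1) * s powr (- \<alpha> / 2) = s powr (- (\<alpha> + 3) / 2)"
          by (simp add: powr_add[symmetric] field_simps)
        also have "(1 - s) powr (-1/2) * (1 - s) powr (\<alpha> / 2) = (1 - s) powr ((\<alpha> - 1) / 2)"
          by (simp add: powr_add[symmetric] field_simps)
        also have "h * h powr \<alpha> = h powr (1 + \<alpha>)" using h by (simp add: powr_add)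
        finally have eq: "h * (1/2 * beta_weight (-1/2) (-1/2) s * ((h * sqrt (1 / s - 1)) powr \<alpha> * (A (h / sqrt s) * B s)))
          = (1/2 * (s powr (- (\<alpha> + 3) / 2) * (1 - s) powr ((\<alpha> - 1) / 2)) * B s) * (A (h / sqrt s) * h powr (1 + \<alpha>))" .
        have B: "B s \<ge> 0" using nonneg(2) s by simp
        have "ennreal h * (ennreal (1/2 * beta_weight (-1/2) (-1/2) s) * ?F h (h * sqrt (1 / s - 1))) =
          ennreal (h * (1/2 * beta_weight (-1/2) (-1/2) s * ((h * sqrt (1 / s - 1)) powr \<alpha> * (A (h / sqrt s) * B s))))"
          unfolding R r1 r2
        proof -
          have "ennreal x * (ennreal y * ennreal z) = ennreal (x * (y * z))" 
            if "x \<ge> 0" "y \<ge> 0" "z \<ge> 0" for x y z using that by (simp add: ennreal_mult)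
          then show "ennreal h * (ennreal (1/2 * beta_weight (-1/2) (-1/2) s) * 
              ennreal ((h * sqrt (1 / s - 1)) powr \<alpha> * (A (h / sqrt s) * B s))) = 
              ennreal (h * (1/2 * beta_weight (-1/2) (-1/2) s * ((h * sqrt (1 / s - 1)) powr \<alpha> * (A (h / sqrt s) * B s))))"
            using h B by (auto simp: beta_weight_nonneg nonneg)
        qed
        also have "\<dots> = ?G s h" unfolding eq using B by (subst ennreal_mult) (auto simp: nonneg)
        finally show ?thesis using True by simp
      qed (simp add: beta_weight_def)
    qed
    finally show ?thesis .
  qed
  have outer: "(\<integral>\<^sup>+x. ?G s (H0 x) * indicator {0<..<1} s \<partial>lborel) =
      ennreal (1/2 * beta_weight (n / 2) ((\<alpha> - 1) / 2) s * B s) * (\<integral>\<^sup>+x. ennreal (A (H0 x) * H0 x powr (1 + \<alpha>)) \<partial>lborel)" for s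
  proof (cases "s \<in> {0<..<1}")
    case True
    then have s: "0 < s" "s < 1" by auto
    have B: "B s \<ge> 0" using nonneg(2) s by simp
    let ?J = "\<integral>\<^sup>+x. ennreal (A (H0 x) * H0 x powr (1 + \<alpha>)) \<partial>lborel"
    have "(\<integral>\<^sup>+x. ennreal (A (H0 x / sqrt s) * H0 x powr (1 + \<alpha>)) \<partial>lborel) =
      ennreal (sqrt s powr n) * (\<integral>\<^sup>+x. ennreal (A (H0 (sqrt s *\<^sub>R x) / sqrt s) * H0 (sqrt s *\<^sub>R x) powr (1 + \<alpha>)) \<partial>lborel)"
      unfolding n_def by (rule nn_integral_lborel_scale) (use s in auto)
    also have "(\<integral>\<^sup>+x. ennreal (A (H0 (sqrt s *\<^sub>R x) / sqrt s) * H0 (sqrt s *\<^sub>R x) powr (1 + \<alpha>)) \<partial>lborel) =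
       (\<integral>\<^sup>+x. ennreal (sqrt s powr (1 + \<alpha>)) * ennreal (A (H0 x) * H0 x powr (1 + \<alpha>)) \<partial>lborel)"
      using s by (intro nn_integral_cong) (auto simp: H0_scaleR powr_mult H0_nonneg ennreal_mult[symmetric] nonneg mult_ac)
    also have "\<dots> = ennreal (sqrt s powr (1 + \<alpha>)) * ?J" by (rule nn_integral_cmult) measurable
    finally have J: "(\<integral>\<^sup>+x. ennreal (A (H0 x / sqrt s) * H0 x powr (1 + \<alpha>)) \<partial>lborel) =
       ennreal (sqrt s powr n) * (ennreal (sqrt s powr (1 + \<alpha>)) * ?J)" .
    have pw: "s powr (- (\<alpha> + 3) / 2) * (sqrt s powr n * sqrt s powr (1 + \<alpha>)) = s powr (n / 2 - 1)"
    proof -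
      have "s powr (- (\<alpha> + 3) / 2) * (sqrt s powr n * sqrt s powr (1 + \<alpha>)) =
          s powr (- (\<alpha> + 3) / 2 + (1 / 2 * n + 1 / 2 * (1 + \<alpha>)))"
        unfolding powr_add[of s "- (\<alpha> + 3) / 2"] powr_add[of s "1 / 2 * n"]
        using s by (simp only: powr_half_sqrt[symmetric] less_imp_le powr_powr)
      also have "- (\<alpha> + 3) / 2 + (1 / 2 * n + 1 / 2 * (1 + \<alpha>)) = n / 2 - 1" by (simp add: field_simps)
      finally show ?thesis .
    qed
    have "(\<integral>\<^sup>+x. ?G s (H0 x) * indicator {0<..<1} s \<partial>lborel) = (\<integral>\<^sup>+x. ?G s (H0 x) \<partial>lborel)"
      using True by simp
    also have "\<dots> = ennreal (1/2 * (s powr (- (\<alpha> + 3) / 2) * (1 - s) powr ((\<alpha> - 1) / 2)) * B s) * 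
       (ennreal (sqrt s powr n) * (ennreal (sqrt s powr (1 + \<alpha>)) * ?J))"
      unfolding J[symmetric] by (rule nn_integral_cmult) measurable
    also have "\<dots> = ennreal ((1/2 * (s powr (- (\<alpha> + 3) / 2) * (1 - s) powr ((\<alpha> - 1) / 2)) * B s) * 
       (sqrt s powr n * sqrt s powr (1 + \<alpha>))) * ?J"
    proof -
      have "ennreal x * (ennreal y * (ennreal z * J)) = ennreal (x * (y * z)) * J"
        if "x \<ge> 0" "y \<ge> 0" "z \<ge> 0" for x y z J using that by (simp add: ennreal_mult mult.assoc)
      then show ?thesis using B by simp
    qed
    also have "(1/2 * (s powr (- (\<alpha> + 3) / 2) * (1 - s) powr ((\<alpha> - 1) / 2)) * B s) * 
       (sqrt s powr n * sqrt s powr (1 + \<alpha>)) = 1/2 * beta_weight (n / 2) ((\<alpha> - 1) / 2) s * B s"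
      using True unfolding beta_weight_def pw[symmetric] by simp
    finally show ?thesis .
  qed (simp add: beta_weight_def)
  have "(\<integral>\<^sup>+z. ennreal (snd z powr \<alpha> * (A (Phi_dual H z) * B ((H0 (fst z))\<^sup>2 / (Phi_dual H z)\<^sup>2))) \<partial>lebesgue_on halfspace)
    = (\<integral>\<^sup>+x. \<integral>\<^sup>+y. ?F (H0 x) y * indicator {0<..} y \<partial>lborel \<partial>lborel)"
  proof (subst nn_integral_halfspace)
    show "(\<lambda>z. ennreal (snd z powr \<alpha> * (A (Phi_dual H z) * B ((H0 (fst z))\<^sup>2 / (Phi_dual H z)\<^sup>2)))) \<in> borel_measurable borel"
      unfolding borel_prod[symmetric] Phi_dual_def by measurable
  qed (simp add: Phi_dual_def)
  also have "\<dots> = (\<integral>\<^sup>+x. \<integral>\<^sup>+s. ?G s (H0 x) * indicator {0<..<1} s \<partial>lborel \<partial>lborel)"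
    by (rule nn_integral_cong_AE, rule eventually_mono[OF AE_lborel_singleton[of 0]]) (rule inner, rule H0_pos)
  also have "\<dots> = (\<integral>\<^sup>+s. \<integral>\<^sup>+x. ?G s (H0 x) * indicator {0<..<1} s \<partial>lborel \<partial>lborel)"
    by (rule lborel_pair.Fubini') measurable
  also have "\<dots> = (\<integral>\<^sup>+s. ennreal (1/2 * beta_weight (n / 2) ((\<alpha> - 1) / 2) s * B s) \<partial>lborel) * 
     (\<integral>\<^sup>+x. ennreal (A (H0 x) * H0 x powr (1 + \<alpha>)) \<partial>lborel)"
    unfolding outer by (rule nn_integral_multc) measurable
  also have "(\<integral>\<^sup>+x. ennreal (A (H0 x) * H0 x powr (1 + \<alpha>)) \<partial>lborel) =
    (\<integral>\<^sup>+\<rho>. ennreal (A \<rho> * \<rho> powr (1 + \<alpha>)) * ennreal (\<kappa> * n * (indicator {0<..} \<rho> * \<rho> powr (n - 1))) \<partial>lborel)"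
    unfolding n_def by (rule nn_integral_H0[where f="\<lambda>h. ennreal (A h * h powr (1 + \<alpha>))"]) measurable
  also have "\<dots> = (\<integral>\<^sup>+\<rho>. ennreal (\<kappa> * n * (indicator {0<..} \<rho> * (\<rho> powr (n + \<alpha>) * A \<rho>))) \<partial>lborel)"
  proof (rule nn_integral_cong)
    fix \<rho> :: real
    show "ennreal (A \<rho> * \<rho> powr (1 + \<alpha>)) * ennreal (\<kappa> * n * (indicator {0<..} \<rho> * \<rho> powr (n - 1))) =
      ennreal (\<kappa> * n * (indicator {0<..} \<rho> * (\<rho> powr (n + \<alpha>) * A \<rho>)))"
    proof (cases "\<rho> > 0")
      case True
      have "\<rho> powr (1 + \<alpha>) * \<rho> powr (n - 1) = \<rho> powr (n + \<alpha>)" by (simp add: powr_add[symmetric] algebra_simps)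
      then show ?thesis using True \<kappa> nonneg(1)[of \<rho>] by (subst ennreal_mult[symmetric]) (auto simp: n_def mult_ac)
    qed simp
  qed
  finally show ?thesis by (simp add: n_def)
qed

end

section \<open>Functions with separated radial and angular parts\<close>

context norm_strictly_convex
begin

lemma Phi_dual_sq: "(Phi_dual H z)\<^sup>2 = (H0 (fst z))\<^sup>2 + (snd z)\<^sup>2"
  by (simp add: Phi_dual_def)

lemma Phi_dual_nonneg: "0 \<le> Phi_dual H z"
  by (simp add: Phi_dual_def)

lemma Phi_dual_pos: "z \<noteq> 0 \<Longrightarrow> 0 < Phi_dual H z"
  using H0_eq_0[of "fst z"] by (auto simp: Phi_dual_def prod_eq_iff sum_power2_gt_zero_iff)

lemma Phi_dual_continuous: "continuous_on A (Phi_dual H)"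
  unfolding Phi_dual_def
  by (intro continuous_intros continuous_on_compose2[OF H0_continuous[of UNIV]]) auto

lemma compact_Phi_dual_ball: "compact {z. Phi_dual H z \<le> M}"
proof -
  obtain b where b: "\<And>x. b * norm x \<le> H0 x" "b > 0" using H0_ge_norm by blast
  have "norm z \<le> \<bar>M\<bar> / b + \<bar>M\<bar>" if "Phi_dual H z \<le> M" for z
  proof -
    have "H0 (fst z) \<le> Phi_dual H z" "\<bar>snd z\<bar> \<le> Phi_dual H z"
      unfolding Phi_dual_def by (simp_all add: real_le_rsqrt)
    then have 1: "b * norm (fst z) \<le> \<bar>M\<bar>" and 2: "\<bar>snd z\<bar> \<le> \<bar>M\<bar>" using b(1)[of "fst z"] that by linarith+
    have "norm (fst z) \<le> \<bar>M\<bar> / b" using 1 b(2) by (simp add: field_simps)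
    then show ?thesis using 2 norm_Pair_le[of "fst z" "snd z"] by simp
  qed
  then have "bounded {z. Phi_dual H z \<le> M}" unfolding bounded_iff by blast
  moreover have "closed {z. Phi_dual H z \<le> M}"
    by (intro closed_Collect_le Phi_dual_continuous continuous_on_const)
  ultimately show ?thesis by (simp add: compact_eq_bounded_closed)
qed

text \<open>The derivative of \<open>H0\<^sup>2\<close>, which unlike \<open>H0\<close> is continuously differentiable at the origin as well.\<close>

definition H0_sq_deriv :: "'a \<Rightarrow> 'a \<Rightarrow> real" where
  "H0_sq_deriv x v = 2 * H0 x * (v \<bullet> dual_grad x)"

lemma H0_sq_has_derivative: "((\<lambda>x. (H0 x)\<^sup>2) has_derivative H0_sq_deriv x) (at x)"
proof (cases "x = 0")
  case False
  have "((\<lambda>x. (H0 x)\<^sup>2) has_derivative (\<lambda>v. 2 * (v \<bullet> dual_grad x * H0 x))) (at x)"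
    using has_derivative_power[OF H0_has_derivative[OF False], of 2] by (simp add: mult.assoc)
  then show ?thesis by (simp add: H0_sq_deriv_def[abs_def] mult_ac)
next
  case True
  obtain B where B: "\<And>x. H0 x \<le> B * norm x" "B > 0" using H0_le_norm by blast
  show ?thesis unfolding has_derivative_at_alt True
  proof (intro conjI allI impI)
    show "bounded_linear (H0_sq_deriv 0)"
      by (simp add: H0_sq_deriv_def[abs_def] H0_0 bounded_linear_zero)
    fix e :: real assume e: "e > 0"
    show "\<exists>d>0. \<forall>y. norm (y - 0) < d \<longrightarrow> norm ((H0 y)\<^sup>2 - (H0 0)\<^sup>2 - H0_sq_deriv 0 (y - 0)) \<le> e * norm (y - 0)"
    proof (intro exI conjI allI impI)
      show "e / B\<^sup>2 > 0" using e B by simp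
      fix y :: 'a assume y: "norm (y - 0) < e / B\<^sup>2"
      have "(H0 y)\<^sup>2 \<le> (B * norm y)\<^sup>2" by (intro power_mono B H0_nonneg)
      also have "\<dots> = (B\<^sup>2 * norm y) * norm y" by (simp add: power2_eq_square)
      also have "\<dots> \<le> e * norm y" using y B by (intro mult_right_mono) (auto simp: field_simps)
      finally show "norm ((H0 y)\<^sup>2 - (H0 0)\<^sup>2 - H0_sq_deriv 0 (y - 0)) \<le> e * norm (y - 0)"
        by (simp add: H0_sq_deriv_def H0_0)
    qed
  qed
qed

lemma H0_sq_deriv_continuous: "continuous_on UNIV (\<lambda>x. H0_sq_deriv x v)"
proof -
  have "isCont (\<lambda>x. H0_sq_deriv x v) x" for x
  proof (cases "x = 0")
    case False
    have "continuous_on (- {0}) (\<lambda>x. H0_sq_deriv x v)"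
      unfolding H0_sq_deriv_def by (intro continuous_intros H0_continuous dual_grad_continuous)
    then show ?thesis using False by (simp add: continuous_on_eq_continuous_at open_Compl)
  next
    case True
    obtain b where b: "\<And>x. b * norm x \<le> H x" "b > 0" using H_lower_bound by blast
    have bound: "\<bar>H0_sq_deriv y v\<bar> \<le> 2 * H0 y * (norm v / b)" for y
    proof -
      have "\<bar>v \<bullet> dual_grad y\<bar> \<le> norm v * norm (dual_grad y)" by (rule Cauchy_Schwarz_ineq2)
      also have "\<dots> \<le> norm v * (1 / b)" using b(1)[of "dual_grad y"] b(2) H_dual_grad[of y]
        by (intro mult_left_mono) (auto simp: field_simps)
      finally have "\<bar>v \<bullet> dual_grad y\<bar> \<le> norm v * (1 / b)" .
      from mult_left_mono[OF this, of "2 * H0 y"] show ?thesis using H0_nonneg[of y] 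
        by (simp add: H0_sq_deriv_def abs_mult)
    qed
    have "((\<lambda>y. 2 * H0 y * (norm v / b)) \<longlongrightarrow> 2 * H0 0 * (norm v / b)) (at 0)"
      using H0_continuous[of UNIV] by (intro tendsto_intros) (auto simp: continuous_on_def)
    then have z: "((\<lambda>y. 2 * H0 y * (norm v / b)) \<longlongrightarrow> 0) (at 0)" by (simp add: H0_0)
    have "((\<lambda>y. H0_sq_deriv y v) \<longlongrightarrow> 0) (at 0)"
      by (rule Lim_null_comparison[OF _ z]) (use bound in auto)
    then show ?thesis by (simp add: True isCont_def H0_sq_deriv_def H0_0)
  qed
  then show ?thesis by (simp add: continuous_at_imp_continuous_on)
qed

text \<open>\<open>r\<close> is not differentiable at the origin, and \<open>s\<close> is not even continuous there; the radial factor has to vanish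
  near it.\<close>

lemma continuous_on_UNIV_if_zero_near_origin:
  assumes "continuous_on {z. 0 < Phi_dual H z} P" "\<And>z. Phi_dual H z < m \<Longrightarrow> P z = (0::real)" "0 < m"
  shows "continuous_on UNIV P"
proof -
  have "continuous_on {z. Phi_dual H z < m} P"
    using assms(2) by (auto intro: continuous_on_eq[OF continuous_on_const[of _ 0]])
  moreover have "open {z. 0 < Phi_dual H z}" "open {z. Phi_dual H z < m}"
    by (auto intro!: open_Collect_less Phi_dual_continuous continuous_on_const)
  ultimately have "continuous_on ({z. 0 < Phi_dual H z} \<union> {z. Phi_dual H z < m}) P"
    using assms(1) by (intro continuous_on_open_Un)
  moreover have "{z. 0 < Phi_dual H z} \<union> {z. Phi_dual H z < m} = UNIV" using assms(3) by auto
  ultimately show ?thesis by simp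
qed

text \<open>A function of \<open>r\<close> times a function of \<open>s\<close>, in the notation of the introduction.\<close>

definition polar :: "(real \<Rightarrow> real) \<Rightarrow> (real \<Rightarrow> real) \<Rightarrow> 'a \<times> real \<Rightarrow> real" where
  "polar f S z = f (Phi_dual H z) * S ((H0 (fst z))\<^sup>2 / (Phi_dual H z)\<^sup>2)"

context
  fixes f f' S S' :: "real \<Rightarrow> real" and m M :: real
  assumes f: "\<And>\<rho>. \<rho> > 0 \<Longrightarrow> (f has_real_derivative f' \<rho>) (at \<rho>)" "continuous_on {0<..} f'"
    and supp: "\<And>\<rho>. 0 \<le> \<rho> \<Longrightarrow> \<rho> < m \<or> \<rho> > M \<Longrightarrow> f \<rho> = 0 \<and> f' \<rho> = 0" and m: "0 < m"
    and S: "\<And>s. (S has_real_derivative S' s) (at s)" "continuous_on UNIV S'"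
begin

text \<open>The partial derivatives of \<open>polar f S\<close>, seen as a function of \<open>r\<^sup>2\<close> and \<open>H0\<^sup>2\<close>.\<close>

definition polar_r where
  "polar_r z = f' (Phi_dual H z) * S ((H0 (fst z))\<^sup>2 / (Phi_dual H z)\<^sup>2) / (2 * Phi_dual H z)
     - f (Phi_dual H z) * S' ((H0 (fst z))\<^sup>2 / (Phi_dual H z)\<^sup>2) * (H0 (fst z))\<^sup>2 / ((Phi_dual H z)\<^sup>2)\<^sup>2"

definition polar_h where
  "polar_h z = f (Phi_dual H z) * S' ((H0 (fst z))\<^sup>2 / (Phi_dual H z)\<^sup>2) / (Phi_dual H z)\<^sup>2"

definition polar_deriv where
  "polar_deriv z v = polar_r z * (H0_sq_deriv (fst z) (fst v) + 2 * (snd z * snd v))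
     + polar_h z * H0_sq_deriv (fst z) (fst v)"

lemma polar_zero: 
  assumes "Phi_dual H z < m \<or> Phi_dual H z > M"
  shows "polar f S z = 0" "polar_r z = 0" "polar_h z = 0"
  using supp[OF Phi_dual_nonneg assms] by (simp_all add: polar_def polar_r_def polar_h_def)

lemma polar_has_derivative: "(polar f S has_derivative polar_deriv z) (at z)"
proof (cases "Phi_dual H z < m")
  case True
  have "open {z. Phi_dual H z < m}" by (intro open_Collect_less Phi_dual_continuous continuous_on_const)
  then have "(polar f S has_derivative (\<lambda>_. 0)) (at z)"
    by (rule has_derivative_transform_within_open[OF has_derivative_const[of 0]])
       (use True polar_zero in auto)
  moreover have "polar_deriv z = (\<lambda>_. 0)" using True by (simp add: polar_deriv_def[abs_def] polar_zero)
  ultimately show ?thesis by simp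
next
  case False
  then have r: "Phi_dual H z > 0" using m by linarith
  let ?r = "Phi_dual H z" and ?q = "(H0 (fst z))\<^sup>2"
  let ?Dq = "\<lambda>v. H0_sq_deriv (fst z) (fst v)"
  let ?DR = "\<lambda>v. H0_sq_deriv (fst z) (fst v) + 2 * (snd z * snd v)"
  have dq: "((\<lambda>z. (H0 (fst z))\<^sup>2) has_derivative ?Dq) (at z)"
    by (rule has_derivative_compose[OF has_derivative_fst[OF has_derivative_ident] H0_sq_has_derivative])
  have "((\<lambda>z::'a \<times> real. (snd z)\<^sup>2) has_derivative (\<lambda>v. 2 * (snd z * snd v))) (at z)"
    by (auto intro!: derivative_eq_intros)
  from has_derivative_add[OF dq this]
  have dR: "((\<lambda>z. (Phi_dual H z)\<^sup>2) has_derivative ?DR) (at z)" by (simp add: Phi_dual_sq)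
  have "((\<lambda>z. sqrt ((Phi_dual H z)\<^sup>2)) has_derivative (\<lambda>v. ?DR v * (inverse (sqrt (?r\<^sup>2)) / 2))) (at z)"
    by (rule DERIV_compose_FDERIV[OF DERIV_real_sqrt dR]) (use r in auto)
  then have dr: "(Phi_dual H has_derivative (\<lambda>v. ?DR v / (2 * ?r))) (at z)"
    using r by (simp add: Phi_dual_nonneg field_simps)
  have ds: "((\<lambda>z. (H0 (fst z))\<^sup>2 / (Phi_dual H z)\<^sup>2) has_derivative 
      (\<lambda>v. (?Dq v * ?r\<^sup>2 - ?q * ?DR v) / (?r\<^sup>2 * ?r\<^sup>2))) (at z)"
    by (rule has_derivative_divide'[OF dq dR]) (use r in simp)
  have "(polar f S has_derivative (\<lambda>v. f ?r * ((?Dq v * ?r\<^sup>2 - ?q * ?DR v) / (?r\<^sup>2 * ?r\<^sup>2) * S' (?q / ?r\<^sup>2))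
     + (?DR v / (2 * ?r) * f' ?r) * S (?q / ?r\<^sup>2))) (at z)"
    unfolding polar_def[abs_def]
    by (rule has_derivative_mult[OF DERIV_compose_FDERIV[OF f(1)[OF r] dr] DERIV_compose_FDERIV[OF S(1) ds]])
  moreover have "f ?r * ((?Dq v * ?r\<^sup>2 - ?q * ?DR v) / (?r\<^sup>2 * ?r\<^sup>2) * S' (?q / ?r\<^sup>2))
     + (?DR v / (2 * ?r) * f' ?r) * S (?q / ?r\<^sup>2) = polar_deriv z v" for v
  proof -
    define A D X Y Z W t where "A = ?Dq v" and "D = ?DR v" and "X = f ?r" and "Y = f' ?r" 
      and "Z = S (?q / ?r\<^sup>2)" and "W = S' (?q / ?r\<^sup>2)" and "t = ?r"
    have t: "t > 0" using r by (simp add: t_def)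
    have "X * ((A * t\<^sup>2 - ?q * D) / (t\<^sup>2 * t\<^sup>2) * W) + (D / (2 * t) * Y) * Z =
       (Y * Z / (2 * t) - X * W * ?q / (t\<^sup>2)\<^sup>2) * D + X * W / t\<^sup>2 * A"
      using t by (simp add: field_simps power2_eq_square)
    then show ?thesis 
      unfolding polar_deriv_def polar_r_def polar_h_def A_def D_def X_def Y_def Z_def W_def t_def .
  qed
  ultimately show ?thesis by (simp add: polar_deriv_def[abs_def])
qed

lemma polar_coefficients_continuous: "continuous_on UNIV polar_r" "continuous_on UNIV polar_h"
proof -
  let ?U = "{z. 0 < Phi_dual H z}"
  have fc: "continuous_on {0<..} f"
    by (rule DERIV_continuous_on[where D=f'], rule has_field_derivative_at_within, rule f(1)) simp
  have Sc: "continuous_on UNIV S" by (rule DERIV_continuous_on[where D=S'], rule S(1))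
  have s: "continuous_on ?U (\<lambda>z. (H0 (fst z))\<^sup>2 / (Phi_dual H z)\<^sup>2)"
    by (intro continuous_intros Phi_dual_continuous continuous_on_compose2[OF H0_continuous[of UNIV]]) auto
  have h: "continuous_on ?U (\<lambda>z. (H0 (fst z))\<^sup>2)"
    by (intro continuous_intros continuous_on_compose2[OF H0_continuous[of UNIV]]) auto
  have c1: "continuous_on ?U (\<lambda>z. f (Phi_dual H z))" "continuous_on ?U (\<lambda>z. f' (Phi_dual H z))"
    by (auto intro!: continuous_on_compose2[OF fc] continuous_on_compose2[OF f(2)] Phi_dual_continuous)
  have c2: "continuous_on ?U (\<lambda>z. S ((H0 (fst z))\<^sup>2 / (Phi_dual H z)\<^sup>2))" 
      "continuous_on ?U (\<lambda>z. S' ((H0 (fst z))\<^sup>2 / (Phi_dual H z)\<^sup>2))"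
    using continuous_on_compose2[OF Sc s] continuous_on_compose2[OF S(2) s] by auto
  have "continuous_on ?U polar_r" unfolding polar_r_def
    by (intro continuous_intros c1 c2 h Phi_dual_continuous) auto
  then show "continuous_on UNIV polar_r"
    by (rule continuous_on_UNIV_if_zero_near_origin[OF _ _ m]) (use polar_zero in auto)
  have "continuous_on ?U polar_h" unfolding polar_h_def
    by (intro continuous_intros c1 c2 Phi_dual_continuous) auto
  then show "continuous_on UNIV polar_h"
    by (rule continuous_on_UNIV_if_zero_near_origin[OF _ _ m]) (use polar_zero in auto)
qed

lemma polar_C1c: "C1c (polar f S) polar_deriv {z. Phi_dual H z \<le> M}"
proof -
  have "continuous_on UNIV (\<lambda>z. polar_deriv z v)" for v
    unfolding polar_deriv_def
    by (intro continuous_intros polar_coefficients_continuous 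
        continuous_on_compose2[OF H0_sq_deriv_continuous]) auto
  then show ?thesis
    using polar_has_derivative compact_Phi_dual_ball polar_zero by (auto simp: C1c_def not_le)
qed

text \<open>The mixed terms cancel because \<open>r\<close> and \<open>s\<close> have orthogonal gradients; \<open>H (\<nabla>H0) = 1\<close> turns
  the anisotropic length of the gradient into the Euclidean one in the variables \<open>(H0, y)\<close>.\<close>

lemma Phi_grad_polar:
  assumes "z \<noteq> 0"
  shows "(Phi H (grad (polar f S) z))\<^sup>2 = 
    (f' (Phi_dual H z))\<^sup>2 * (S ((H0 (fst z))\<^sup>2 / (Phi_dual H z)\<^sup>2))\<^sup>2 +
    (f (Phi_dual H z) / Phi_dual H z)\<^sup>2 * (4 * (((H0 (fst z))\<^sup>2 / (Phi_dual H z)\<^sup>2) * (1 - (H0 (fst z))\<^sup>2 / (Phi_dual H z)\<^sup>2) 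
      * (S' ((H0 (fst z))\<^sup>2 / (Phi_dual H z)\<^sup>2))\<^sup>2))"
proof -
  let ?h = "H0 (fst z)" and ?y = "snd z"
  let ?G = "((2 * (polar_r z + polar_h z) * ?h) *\<^sub>R dual_grad (fst z), 2 * polar_r z * ?y)"
  have "frechet_derivative (polar f S) (at z) = polar_deriv z"
    using polar_has_derivative frechet_derivative_at by metis
  moreover have "polar_deriv z v = ?G \<bullet> v" for v
    by (simp add: polar_deriv_def H0_sq_deriv_def inner_prod_def inner_commute algebra_simps)
  ultimately have "grad (polar f S) z = (\<Sum>e\<in>Basis. (?G \<bullet> e) *\<^sub>R e)" by (simp only: grad_def)
  then have g: "grad (polar f S) z = ?G" by (simp only: euclidean_representation)
  define t where "t = Phi_dual H z"
  have t: "t > 0" using Phi_dual_pos[OF assms] by (simp add: t_def)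
  have ty: "?y\<^sup>2 = t\<^sup>2 - ?h\<^sup>2" by (simp add: t_def Phi_dual_sq)
  define X Y Z W where "X = f t" and "Y = f' t" and "Z = S (?h\<^sup>2 / t\<^sup>2)" and "W = S' (?h\<^sup>2 / t\<^sup>2)"
  have P: "polar_r z = Y * Z / (2 * t) - X * W * ?h\<^sup>2 / (t\<^sup>2)\<^sup>2" "polar_h z = X * W / t\<^sup>2"
    by (simp_all add: polar_r_def polar_h_def X_def Y_def Z_def W_def t_def)
  have "(Phi H (grad (polar f S) z))\<^sup>2 = (2 * (polar_r z + polar_h z) * ?h)\<^sup>2 + (2 * polar_r z)\<^sup>2 * ?y\<^sup>2"
    unfolding g by (simp add: Phi_def H_scaleR H_dual_grad power_mult_distrib)
  also have "\<dots> = 4 * ((polar_r z)\<^sup>2 * t\<^sup>2 + 2 * polar_r z * polar_h z * ?h\<^sup>2 + (polar_h z)\<^sup>2 * ?h\<^sup>2)"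
    unfolding ty by (simp add: power2_eq_square algebra_simps)
  also have "\<dots> = Y\<^sup>2 * Z\<^sup>2 + (X / t)\<^sup>2 * (4 * ((?h\<^sup>2 / t\<^sup>2) * (1 - ?h\<^sup>2 / t\<^sup>2) * W\<^sup>2))"
    unfolding P using t by (simp add: power2_eq_square field_simps)
  finally show ?thesis unfolding X_def Y_def Z_def W_def t_def .
qed

end

end

section \<open>Logarithmic cutoff\<close>

text \<open>The cutoff is \<open>(1 - t\<^sup>2)\<^sup>2\<close> in the variable \<open>t = ln \<rho> / L\<close>; the outer square makes it continuously differentiable
  at \<open>t = \<plusminus>1\<close>.\<close>

definition log_cutoff :: "real \<Rightarrow> real \<Rightarrow> real" where
  "log_cutoff L \<rho> = (max 0 (1 - (ln \<rho> / L)\<^sup>2))\<^sup>2"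

definition log_cutoff' :: "real \<Rightarrow> real \<Rightarrow> real" where
  "log_cutoff' L \<rho> = 2 * max 0 (1 - (ln \<rho> / L)\<^sup>2) * (- 2 * ln \<rho> / (L\<^sup>2 * \<rho>))"

text \<open>At \<open>\<rho> = 0\<close>, where \<open>ln 0 = 0\<close> makes the cutoff one, the factor \<open>0 powr (- \<gamma>) = 0\<close> still gives the
  right value.\<close>

definition profile :: "real \<Rightarrow> real \<Rightarrow> real \<Rightarrow> real" where
  "profile \<gamma> L \<rho> = \<rho> powr (- \<gamma>) * log_cutoff L \<rho>"

definition profile' :: "real \<Rightarrow> real \<Rightarrow> real \<Rightarrow> real" where
  "profile' \<gamma> L \<rho> = \<rho> powr (- \<gamma>) * (log_cutoff' L \<rho> - \<gamma> * log_cutoff L \<rho> / \<rho>)"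

lemma square_pos_part_deriv: "((\<lambda>x::real. (max 0 x)\<^sup>2) has_real_derivative 2 * max 0 x) (at x)"
proof -
  consider "x > 0" | "x = 0" | "x < 0" by linarith
  then show ?thesis
  proof cases
    case 1
    have "((\<lambda>x. x\<^sup>2) has_real_derivative 2 * max 0 x) (at x)"
      using 1 by (auto intro!: derivative_eq_intros)
    then show ?thesis
      by (rule has_field_derivative_transform_within_open[where S="{0<..}"]) (use 1 in auto)
  next
    case 2
    have "((\<lambda>h::real. (max 0 h)\<^sup>2 / h) \<longlongrightarrow> 0) (at 0)"
    proof (rule Lim_null_comparison)
      show "\<forall>\<^sub>F h in at 0. norm ((max 0 h)\<^sup>2 / h :: real) \<le> \<bar>h\<bar>"
        by (auto simp: max_def power2_eq_square)
    qed (auto intro!: tendsto_eq_intros)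
    then show ?thesis using 2 by (simp add: DERIV_def)
  next
    case 3
    have "((\<lambda>x. 0) has_real_derivative 2 * max 0 x) (at x)"
      using 3 by auto
    then show ?thesis
      by (rule has_field_derivative_transform_within_open[where S="{..<0}"]) (use 3 in auto)
  qed
qed

lemma log_cutoff_deriv:
  assumes "\<rho> > 0"
  shows "(log_cutoff L has_real_derivative log_cutoff' L \<rho>) (at \<rho>)"
proof -
  have "((\<lambda>\<rho>. 1 - (ln \<rho> / L)\<^sup>2) has_real_derivative (- 2 * ln \<rho> / (L\<^sup>2 * \<rho>))) (at \<rho>)"
    using assms by (cases "L = 0") (auto intro!: derivative_eq_intros simp: power2_eq_square field_simps)
  from DERIV_chain2[OF square_pos_part_deriv this] show ?thesis
    by (simp add: log_cutoff_def[abs_def] log_cutoff'_def)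
qed

lemma log_cutoff_continuous: "continuous_on {0<..} (log_cutoff L)" "continuous_on {0<..} (log_cutoff' L)"
  unfolding log_cutoff_def[abs_def] log_cutoff'_def[abs_def]
  by (cases "L = 0"; auto intro!: continuous_intros)+

lemma log_cutoff_nonneg: "0 \<le> log_cutoff L \<rho>"
  by (simp add: log_cutoff_def)

lemma log_cutoff_le_1: "log_cutoff L \<rho> \<le> 1"
  unfolding log_cutoff_def by (rule power_le_one) auto

lemma log_cutoff_outside:
  assumes "L > 0" "\<rho> > 0" "\<rho> \<notin> {exp (- L)..exp L}"
  shows "log_cutoff L \<rho> = 0" "log_cutoff' L \<rho> = 0"
proof -
  have "\<rho> < exp (- L) \<or> exp L < \<rho>" using assms(3) by auto
  then have "ln \<rho> < - L \<or> ln \<rho> > L"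
    using ln_less_cancel_iff[of \<rho> "exp (- L)"] ln_less_cancel_iff[of "exp L" \<rho>] assms(2) by auto
  then have "\<bar>ln \<rho> / L\<bar> > 1" using assms(1) by (auto simp: field_simps abs_if)
  then have "1 < (ln \<rho> / L)\<^sup>2" by (metis one_less_power power2_abs pos2)
  then show "log_cutoff L \<rho> = 0" "log_cutoff' L \<rho> = 0" by (auto simp: log_cutoff_def log_cutoff'_def)
qed

lemma profile_deriv:
  assumes "\<rho> > 0"
  shows "(profile \<gamma> L has_real_derivative profile' \<gamma> L \<rho>) (at \<rho>)"
proof -
  have "((\<lambda>\<rho>. \<rho> powr (- \<gamma>)) has_real_derivative (- \<gamma>) * \<rho> powr (- \<gamma> - 1)) (at \<rho>)"
    using assms by (intro has_real_derivative_powr) auto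
  from DERIV_mult[OF this log_cutoff_deriv[OF assms, of L]]
  have "(profile \<gamma> L has_real_derivative (- \<gamma>) * \<rho> powr (- \<gamma> - 1) * log_cutoff L \<rho> + log_cutoff' L \<rho> * \<rho> powr (- \<gamma>)) (at \<rho>)"
    by (simp add: profile_def[abs_def])
  moreover have "\<rho> powr (- \<gamma> - 1) = \<rho> powr (- \<gamma>) / \<rho>" using assms by (simp add: powr_diff)
  ultimately show ?thesis by (simp add: profile'_def algebra_simps)
qed

lemma profile'_continuous: "continuous_on {0<..} (profile' \<gamma> L)"
  unfolding profile'_def[abs_def] by (intro continuous_intros log_cutoff_continuous) auto

lemma profile_outside:
  assumes "L > 0" "\<rho> \<ge> 0" "\<rho> < exp (- L) \<or> \<rho> > exp L"
  shows "profile \<gamma> L \<rho> = 0 \<and> profile' \<gamma> L \<rho> = 0"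
  using log_cutoff_outside[of L \<rho>] assms by (cases "\<rho> = 0") (auto simp: profile_def profile'_def)

lemma profile_nonneg: "0 \<le> profile \<gamma> L \<rho>"
  by (simp add: profile_def log_cutoff_nonneg)

lemma profile_mono: assumes "0 < L" "L \<le> L'" shows "profile \<gamma> L \<rho> \<le> profile \<gamma> L' \<rho>"
proof -
  have "\<bar>ln \<rho> / L'\<bar> \<le> \<bar>ln \<rho> / L\<bar>" using assms by (auto intro!: divide_left_mono)
  then have "(ln \<rho> / L')\<^sup>2 \<le> (ln \<rho> / L)\<^sup>2" by (rule abs_le_square_iff[THEN iffD1])
  then show ?thesis
    unfolding profile_def log_cutoff_def by (intro mult_left_mono power_mono) auto
qed

lemma profile_pos: assumes "0 < L" "\<bar>ln \<rho>\<bar> < L" "\<rho> > 0" shows "0 < profile \<gamma> L \<rho>"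
proof -
  have "\<bar>ln \<rho> / L\<bar> < 1" using assms by simp
  then have "(ln \<rho> / L)\<^sup>2 < 1" using abs_square_less_1 by blast
  then show ?thesis using assms by (simp add: profile_def log_cutoff_def)
qed

lemma profile_measurable [measurable]: 
  "profile \<gamma> L \<in> borel_measurable borel" "profile' \<gamma> L \<in> borel_measurable borel"
  unfolding profile_def[abs_def] profile'_def[abs_def] log_cutoff_def[abs_def] log_cutoff'_def[abs_def] by measurable

text \<open>In the variable \<open>ln \<rho>\<close> the cutoff has slope of order \<open>1/L\<close> on an interval of length \<open>2L\<close>; the mixed
  term is a total derivative.\<close>

lemma profile_integrals:
  assumes L: "L > 0"
  obtains D X where "0 \<le> D" "D \<le> 32 / L" "0 \<le> X" "X \<le> 2 * L"
    "(\<integral>\<^sup>+\<rho>. ennreal (indicator {0<..} \<rho> * (\<rho> powr (2 * \<gamma> + 1) * (profile' \<gamma> L \<rho>)\<^sup>2)) \<partial>lborel) = ennreal (D + \<gamma>\<^sup>2 * X)"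
    "(\<integral>\<^sup>+\<rho>. ennreal (indicator {0<..} \<rho> * (\<rho> powr (2 * \<gamma> - 1) * (profile \<gamma> L \<rho>)\<^sup>2)) \<partial>lborel) = ennreal X"
proof -
  let ?J = "{exp (- L)..exp L}" and ?c = "log_cutoff L" and ?c' = "log_cutoff' L"
  have Jpos: "\<rho> > 0" if "\<rho> \<in> ?J" for \<rho> using that less_le_trans[OF exp_gt_zero] by auto
  have le: "exp (- L) \<le> exp L" using L by simp
  have JU: "?J \<subseteq> {0<..}" using Jpos by auto
  note cont = continuous_on_subset[OF log_cutoff_continuous(1) JU] continuous_on_subset[OF log_cutoff_continuous(2) JU]
  have inv: "((\<lambda>\<rho>. 1 / \<rho>) has_integral 2 * L) ?J"
  proof -
    have "((\<lambda>\<rho>. 1 / \<rho>) has_integral (ln (exp L) - ln (exp (- L)))) ?J"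
      by (intro fundamental_theorem_of_calculus le)
         (use Jpos in \<open>auto intro!: derivative_eq_intros simp: has_real_derivative_iff_has_vector_derivative[symmetric]\<close>)
    then show ?thesis by simp
  qed
  define X where "X = integral ?J (\<lambda>\<rho>. (?c \<rho>)\<^sup>2 / \<rho>)"
  define D where "D = integral ?J (\<lambda>\<rho>. \<rho> * (?c' \<rho>)\<^sup>2)"
  have iX: "((\<lambda>\<rho>. (?c \<rho>)\<^sup>2 / \<rho>) has_integral X) ?J" unfolding X_def
    by (intro integrable_integral integrable_continuous_real continuous_intros cont) (use Jpos in force)
  have iD: "((\<lambda>\<rho>. \<rho> * (?c' \<rho>)\<^sup>2) has_integral D) ?J" unfolding D_def
    by (intro integrable_integral integrable_continuous_real continuous_intros cont)
  have iM: "((\<lambda>\<rho>. 2 * ?c \<rho> * ?c' \<rho>) has_integral 0) ?J"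
  proof -
    have "((\<lambda>\<rho>. (?c \<rho>)\<^sup>2) has_vector_derivative 2 * ?c \<rho> * ?c' \<rho>) (at \<rho> within ?J)" if "\<rho> \<in> ?J" for \<rho>
      using DERIV_power[OF log_cutoff_deriv[OF Jpos[OF that]], of L 2]
      by (simp add: has_real_derivative_iff_has_vector_derivative mult_ac has_vector_derivative_at_within)
    from fundamental_theorem_of_calculus[OF le this]
    have "((\<lambda>\<rho>. 2 * ?c \<rho> * ?c' \<rho>) has_integral ((?c (exp L))\<^sup>2 - (?c (exp (- L)))\<^sup>2)) ?J" .
    then show ?thesis using L by (simp add: log_cutoff_def)
  qed
  have X0: "0 \<le> X" using Jpos by (intro has_integral_nonneg[OF iX]) (auto intro!: divide_nonneg_pos)
  have D0: "0 \<le> D" 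
  proof (rule has_integral_nonneg[OF iD])
    show "0 \<le> \<rho> * (?c' \<rho>)\<^sup>2" if "\<rho> \<in> ?J" for \<rho> using Jpos[OF that] by simp
  qed
  have X2: "X \<le> 2 * L"
  proof (rule has_integral_le[OF iX inv])
    fix \<rho> assume "\<rho> \<in> ?J"
    then show "(?c \<rho>)\<^sup>2 / \<rho> \<le> 1 / \<rho>"
      using Jpos[of \<rho>] by (intro divide_right_mono power_le_one log_cutoff_le_1 log_cutoff_nonneg) auto
  qed
  have D2: "D \<le> (16 / L\<^sup>2) * (2 * L)"
  proof (rule has_integral_le[OF iD has_integral_mult_right[OF inv]])
    fix \<rho> assume \<rho>: "\<rho> \<in> ?J"
    have r: "\<rho> > 0" by (rule Jpos[OF \<rho>])
    have "\<bar>ln \<rho>\<bar> \<le> L"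
      using \<rho> r ln_le_cancel_iff[of "exp (- L)" \<rho>] ln_le_cancel_iff[of \<rho> "exp L"] by (auto simp: abs_le_iff)
    then have t: "(ln \<rho> / L)\<^sup>2 \<le> 1" using L by (simp add: abs_square_le_1)
    have "(?c' \<rho>)\<^sup>2 = (max 0 (1 - (ln \<rho> / L)\<^sup>2))\<^sup>2 * ((ln \<rho> / L)\<^sup>2 * (16 / (L\<^sup>2 * \<rho>\<^sup>2)))"
      using L r unfolding log_cutoff'_def by (simp add: power_mult_distrib power_divide power2_eq_square mult_ac)
    also have "\<dots> \<le> 1 * (1 * (16 / (L\<^sup>2 * \<rho>\<^sup>2)))"
      by (intro mult_mono t power_le_one) auto
    finally have "(?c' \<rho>)\<^sup>2 \<le> 16 / (L\<^sup>2 * \<rho>\<^sup>2)" by simp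
    from mult_left_mono[OF this less_imp_le[OF r]]
    have "\<rho> * (?c' \<rho>)\<^sup>2 \<le> \<rho> * (16 / (L\<^sup>2 * \<rho>\<^sup>2))" .
    also have "\<dots> = 16 / L\<^sup>2 * (1 / \<rho>)" using r by (simp add: power2_eq_square)
    finally show "\<rho> * (?c' \<rho>)\<^sup>2 \<le> 16 / L\<^sup>2 * (1 / \<rho>)" .
  qed
  have pw: "\<rho> powr (2 * \<gamma> + 1) * (\<rho> powr (- \<gamma>))\<^sup>2 = \<rho>" "\<rho> powr (2 * \<gamma> - 1) * (\<rho> powr (- \<gamma>))\<^sup>2 = 1 / \<rho>" if "\<rho> > 0" for \<rho> :: real
  proof -
    have "(\<rho> powr (- \<gamma>))\<^sup>2 = \<rho> powr (- 2 * \<gamma>)" using that by (simp add: power2_eq_square powr_add[symmetric])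
    then show "\<rho> powr (2 * \<gamma> + 1) * (\<rho> powr (- \<gamma>))\<^sup>2 = \<rho>" "\<rho> powr (2 * \<gamma> - 1) * (\<rho> powr (- \<gamma>))\<^sup>2 = 1 / \<rho>" 
      using that by (simp_all add: powr_add powr_diff powr_minus_divide)
  qed
  have ext: "(\<integral>\<^sup>+\<rho>. ennreal (indicator {0<..} \<rho> * g \<rho>) \<partial>lborel) = ennreal I"
    if "(g has_integral I) ?J" "\<And>\<rho>. \<rho> > 0 \<Longrightarrow> g \<rho> \<ge> 0" "\<And>\<rho>. \<rho> > 0 \<Longrightarrow> \<rho> \<notin> ?J \<Longrightarrow> g \<rho> = 0" for g I
  proof -
    have "(\<integral>\<^sup>+\<rho>. ennreal (indicator {0<..} \<rho> * g \<rho>) \<partial>lborel) = (\<integral>\<^sup>+\<rho>. ennreal (g \<rho>) * indicator ?J \<rho> \<partial>lborel)"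
    proof (rule nn_integral_cong)
      fix \<rho> :: real
      show "ennreal (indicator {0<..} \<rho> * g \<rho>) = ennreal (g \<rho>) * indicator ?J \<rho>"
        using that(3)[of \<rho>] Jpos[of \<rho>] by (cases "\<rho> > 0"; cases "\<rho> \<in> ?J") auto
    qed
    also have "\<dots> = ennreal I"
      by (rule nn_integral_has_integral_lebesgue'[OF _ that(1)]) (use that(2) Jpos in auto)
    finally show ?thesis .
  qed
  have e1: "\<rho> powr (2 * \<gamma> + 1) * (profile' \<gamma> L \<rho>)\<^sup>2 = \<rho> * (?c' \<rho>)\<^sup>2 - \<gamma> * (2 * ?c \<rho> * ?c' \<rho>) + \<gamma>\<^sup>2 * ((?c \<rho>)\<^sup>2 / \<rho>)"
    if r: "\<rho> > 0" for \<rho>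
  proof -
    have "\<rho> powr (2 * \<gamma> + 1) * (profile' \<gamma> L \<rho>)\<^sup>2 = (\<rho> powr (2 * \<gamma> + 1) * (\<rho> powr (- \<gamma>))\<^sup>2) * (?c' \<rho> - \<gamma> * ?c \<rho> / \<rho>)\<^sup>2"
      by (simp only: profile'_def power_mult_distrib mult.assoc)
    also have "\<dots> = \<rho> * (?c' \<rho> - \<gamma> * ?c \<rho> / \<rho>)\<^sup>2" by (simp only: pw(1)[OF r])
    also have "\<dots> = \<rho> * (?c' \<rho>)\<^sup>2 - \<gamma> * (2 * ?c \<rho> * ?c' \<rho>) + \<gamma>\<^sup>2 * ((?c \<rho>)\<^sup>2 / \<rho>)"
      using r by (simp add: power2_eq_square field_simps)
    finally show ?thesis .
  qed
  have e2: "\<rho> powr (2 * \<gamma> - 1) * (profile \<gamma> L \<rho>)\<^sup>2 = (?c \<rho>)\<^sup>2 / \<rho>" if r: "\<rho> > 0" for \<rho>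
  proof -
    have "\<rho> powr (2 * \<gamma> - 1) * (profile \<gamma> L \<rho>)\<^sup>2 = (\<rho> powr (2 * \<gamma> - 1) * (\<rho> powr (- \<gamma>))\<^sup>2) * (?c \<rho>)\<^sup>2"
      by (simp only: profile_def power_mult_distrib mult.assoc)
    also have "\<dots> = (?c \<rho>)\<^sup>2 / \<rho>" by (simp only: pw(2)[OF r]) simp
    finally show ?thesis .
  qed
  have "((\<lambda>\<rho>. \<rho> * (?c' \<rho>)\<^sup>2 - \<gamma> * (2 * ?c \<rho> * ?c' \<rho>) + \<gamma>\<^sup>2 * ((?c \<rho>)\<^sup>2 / \<rho>)) has_integral (D - \<gamma> * 0 + \<gamma>\<^sup>2 * X)) ?J"
    by (intro has_integral_add has_integral_diff has_integral_mult_right iD iM iX)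
  then have h1: "((\<lambda>\<rho>. \<rho> powr (2 * \<gamma> + 1) * (profile' \<gamma> L \<rho>)\<^sup>2) has_integral (D + \<gamma>\<^sup>2 * X)) ?J"
    by (subst has_integral_cong[OF e1[OF Jpos]]) auto
  have h2: "((\<lambda>\<rho>. \<rho> powr (2 * \<gamma> - 1) * (profile \<gamma> L \<rho>)\<^sup>2) has_integral X) ?J"
    using iX by (subst has_integral_cong[OF e2[OF Jpos]]) auto
  have out: "profile \<gamma> L \<rho> = 0 \<and> profile' \<gamma> L \<rho> = 0" if "\<rho> > 0" "\<rho> \<notin> ?J" for \<rho>
    by (rule profile_outside[OF L]) (use that in auto)
  show ?thesis
  proof (rule that)
    show "D \<le> 32 / L" using D2 L by (simp add: power2_eq_square)
    show "(\<integral>\<^sup>+\<rho>. ennreal (indicator {0<..} \<rho> * (\<rho> powr (2 * \<gamma> + 1) * (profile' \<gamma> L \<rho>)\<^sup>2)) \<partial>lborel) = ennreal (D + \<gamma>\<^sup>2 * X)"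
      by (rule ext[OF h1]) (use out in auto)
    show "(\<integral>\<^sup>+\<rho>. ennreal (indicator {0<..} \<rho> * (\<rho> powr (2 * \<gamma> - 1) * (profile \<gamma> L \<rho>)\<^sup>2)) \<partial>lborel) = ennreal X"
      by (rule ext[OF h2]) (use out in auto)
  qed (fact D0 X0 X2)+
qed

section \<open>The quadratic form on the test functions\<close>

lemma beta_weight_nn_integral_times:
  assumes "c > 0" "e > -1" "continuous_on UNIV B" "\<And>s. 0 \<le> s \<Longrightarrow> s \<le> 1 \<Longrightarrow> 0 \<le> B s"
  shows "(\<integral>\<^sup>+s. ennreal (1/2 * beta_weight c e s * B s) \<partial>lborel) = ennreal (1/2 * (LINT s|lborel. beta_weight c e s * B s))"
    and "0 \<le> (LINT s|lborel. beta_weight c e s * B s)"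
proof -
  have nn: "0 \<le> beta_weight c e s * B s" for s
    using assms(4)[of s] by (cases "s \<in> {0<..<1}") (auto simp: beta_weight_nonneg beta_weight_def)
  then show "0 \<le> (LINT s|lborel. beta_weight c e s * B s)" by simp
  have "(\<integral>\<^sup>+s. ennreal (1/2 * (beta_weight c e s * B s)) \<partial>lborel) = ennreal (LINT s|lborel. 1/2 * (beta_weight c e s * B s))"
    using nn beta_weight_times_continuous_integrable[OF assms(1-3)]
    by (intro nn_integral_eq_integral) auto
  then show "(\<integral>\<^sup>+s. ennreal (1/2 * beta_weight c e s * B s) \<partial>lborel) = ennreal (1/2 * (LINT s|lborel. beta_weight c e s * B s))"
    by (simp add: mult.assoc)
qed

context norm_strictly_convex
begin

lemma polar_integral:
  fixes A B :: "real \<Rightarrow> real" and \<alpha> RA :: real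
  assumes \<alpha>: "-1 < \<alpha>"
    and A [measurable]: "A \<in> borel_measurable borel" and A0: "\<And>\<rho>. 0 \<le> A \<rho>"
    and RA: "(\<integral>\<^sup>+\<rho>. ennreal (indicator {0<..} \<rho> * (\<rho> powr (real DIM('a) + \<alpha>) * A \<rho>)) \<partial>lborel) = ennreal RA" "0 \<le> RA"
    and B: "continuous_on UNIV B" "\<And>s. 0 \<le> s \<Longrightarrow> s \<le> 1 \<Longrightarrow> 0 \<le> B s"
  shows "has_bochner_integral (lebesgue_on halfspace)
      (\<lambda>z. snd z powr \<alpha> * (A (Phi_dual H z) * B ((H0 (fst z))\<^sup>2 / (Phi_dual H z)\<^sup>2)))
      (1/2 * (LINT s|lborel. beta_weight (DIM('a) / 2) ((\<alpha> - 1) / 2) s * B s) * (\<kappa> * DIM('a) * RA))"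
proof (rule has_bochner_integral_nn_integral)
  have B' [measurable]: "B \<in> borel_measurable borel" using B(1) by (rule borel_measurable_continuous_onI)
  have ce: "real DIM('a) / 2 > 0" "(\<alpha> - 1) / 2 > -1" using \<alpha> by auto
  have ang: "(\<integral>\<^sup>+s. ennreal (1/2 * beta_weight (DIM('a) / 2) ((\<alpha> - 1) / 2) s * B s) \<partial>lborel)
      = ennreal (1/2 * (LINT s|lborel. beta_weight (DIM('a) / 2) ((\<alpha> - 1) / 2) s * B s))"
    "0 \<le> (LINT s|lborel. beta_weight (DIM('a) / 2) ((\<alpha> - 1) / 2) s * B s)"
    by (rule beta_weight_nn_integral_times[OF ce B(1)]; rule B(2); assumption)+
  show "0 \<le> 1/2 * (LINT s|lborel. beta_weight (DIM('a) / 2) ((\<alpha> - 1) / 2) s * B s) * (\<kappa> * DIM('a) * RA)"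
    using ang(2) RA(2) \<kappa>_nonneg by simp
  have "(\<lambda>z::'a \<times> real. snd z powr \<alpha> * (A (Phi_dual H z) * B ((H0 (fst z))\<^sup>2 / (Phi_dual H z)\<^sup>2))) \<in> borel_measurable borel"
    unfolding borel_prod[symmetric] Phi_dual_def by measurable
  then show "(\<lambda>z. snd z powr \<alpha> * (A (Phi_dual H z) * B ((H0 (fst z))\<^sup>2 / (Phi_dual H z)\<^sup>2))) \<in> borel_measurable (lebesgue_on halfspace)"
    by (auto intro!: measurable_restrict_space1 measurable_completion)
  have "(H0 (fst z))\<^sup>2 / (Phi_dual H z)\<^sup>2 \<le> 1" for z
  proof -
    have "(H0 (fst z))\<^sup>2 \<le> (Phi_dual H z)\<^sup>2" by (simp add: Phi_dual_sq)
    then show ?thesis by (cases "Phi_dual H z = 0") (auto simp: divide_le_eq_1)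
  qed
  then show "AE z in lebesgue_on halfspace. 0 \<le> snd z powr \<alpha> * (A (Phi_dual H z) * B ((H0 (fst z))\<^sup>2 / (Phi_dual H z)\<^sup>2))"
    using A0 B(2) by (intro AE_I2 mult_nonneg_nonneg) auto
  have "(\<integral>\<^sup>+\<rho>. ennreal (\<kappa> * DIM('a) * (indicator {0<..} \<rho> * (\<rho> powr (DIM('a) + \<alpha>) * A \<rho>))) \<partial>lborel) =
    (\<integral>\<^sup>+\<rho>. ennreal (\<kappa> * DIM('a)) * ennreal (indicator {0<..} \<rho> * (\<rho> powr (DIM('a) + \<alpha>) * A \<rho>)) \<partial>lborel)"
    using \<kappa>_nonneg A0 by (intro nn_integral_cong ennreal_mult) auto
  also have "\<dots> = ennreal (\<kappa> * DIM('a)) * ennreal RA"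
    by (subst nn_integral_cmult) (simp_all add: RA)
  also have "\<dots> = ennreal (\<kappa> * DIM('a) * RA)" using \<kappa>_nonneg RA(2) by (simp add: ennreal_mult)
  finally have rad: "(\<integral>\<^sup>+\<rho>. ennreal (\<kappa> * DIM('a) * (indicator {0<..} \<rho> * (\<rho> powr (DIM('a) + \<alpha>) * A \<rho>))) \<partial>lborel) = ennreal (\<kappa> * DIM('a) * RA)" .
  show "(\<integral>\<^sup>+z. ennreal (snd z powr \<alpha> * (A (Phi_dual H z) * B ((H0 (fst z))\<^sup>2 / (Phi_dual H z)\<^sup>2))) \<partial>lebesgue_on halfspace) = 
     ennreal (1/2 * (LINT s|lborel. beta_weight (DIM('a) / 2) ((\<alpha> - 1) / 2) s * B s) * (\<kappa> * DIM('a) * RA))"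
  proof (subst nn_integral_polar)
    show "(\<integral>\<^sup>+s. ennreal (1/2 * beta_weight (DIM('a) / 2) ((\<alpha> - 1) / 2) s * B s) \<partial>lborel) *
      (\<integral>\<^sup>+\<rho>. ennreal (\<kappa> * DIM('a) * (indicator {0<..} \<rho> * (\<rho> powr (DIM('a) + \<alpha>) * A \<rho>))) \<partial>lborel) =
      ennreal (1/2 * (LINT s|lborel. beta_weight (DIM('a) / 2) ((\<alpha> - 1) / 2) s * B s) * (\<kappa> * DIM('a) * RA))"
      unfolding rad ang(1) using ang(2) RA(2) \<kappa>_nonneg by (intro ennreal_mult[symmetric]) auto
  qed (use A B' A0 B(2) in auto)
qed

text \<open>On the boundary \<open>y = 0\<close> one has \<open>r = H0 x\<close> and \<open>s = 1\<close>.\<close>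

lemma trace_integral:
  fixes \<alpha> RX :: real
  assumes [measurable]: "f \<in> borel_measurable borel"
    and RX: "(\<integral>\<^sup>+\<rho>. ennreal (indicator {0<..} \<rho> * (\<rho> powr (real DIM('a) + \<alpha> - 2) * (f \<rho>)\<^sup>2)) \<partial>lborel) = ennreal RX" "0 \<le> RX"
    and f0: "f 0 = 0"
  shows "has_bochner_integral lebesgue (\<lambda>x. (polar f S (x, 0))\<^sup>2 / H0 x powr (1 - \<alpha>)) (\<kappa> * DIM('a) * RX * (S 1)\<^sup>2)"
proof -
  have eq: "(polar f S (x, 0))\<^sup>2 / H0 x powr (1 - \<alpha>) = (f (H0 x) * S 1)\<^sup>2 / H0 x powr (1 - \<alpha>)" for x
    by (cases "x = 0") (auto simp: polar_def Phi_dual_def H0_nonneg H0_0 f0 H0_eq_0)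
  let ?A = "\<lambda>\<rho>. (f \<rho> * S 1)\<^sup>2 / \<rho> powr (1 - \<alpha>)"
  have "(\<integral>\<^sup>+x. ennreal (?A (H0 x)) \<partial>lebesgue) = 
     (\<integral>\<^sup>+\<rho>. ennreal (?A \<rho>) * ennreal (\<kappa> * DIM('a) * (indicator {0<..} \<rho> * \<rho> powr (real DIM('a) - 1))) \<partial>lborel)"
    unfolding nn_integral_completion by (rule nn_integral_H0[where f="\<lambda>\<rho>. ennreal (?A \<rho>)"]) measurable
  also have "\<dots> = (\<integral>\<^sup>+\<rho>. ennreal (\<kappa> * DIM('a) * (S 1)\<^sup>2) * ennreal (indicator {0<..} \<rho> * (\<rho> powr (real DIM('a) + \<alpha> - 2) * (f \<rho>)\<^sup>2)) \<partial>lborel)"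
  proof (rule nn_integral_cong)
    fix \<rho> :: real
    show "ennreal (?A \<rho>) * ennreal (\<kappa> * DIM('a) * (indicator {0<..} \<rho> * \<rho> powr (real DIM('a) - 1))) =
      ennreal (\<kappa> * DIM('a) * (S 1)\<^sup>2) * ennreal (indicator {0<..} \<rho> * (\<rho> powr (real DIM('a) + \<alpha> - 2) * (f \<rho>)\<^sup>2))"
    proof (cases "\<rho> > 0")
      case True
      have "\<rho> powr (real DIM('a) + \<alpha> - 2) * \<rho> powr (1 - \<alpha>) = \<rho> powr (real DIM('a) - 1)"
        by (simp add: powr_add[symmetric])
      then have "?A \<rho> * (\<kappa> * DIM('a) * (indicator {0<..} \<rho> * \<rho> powr (real DIM('a) - 1))) =
        \<kappa> * DIM('a) * (S 1)\<^sup>2 * (indicator {0<..} \<rho> * (\<rho> powr (real DIM('a) + \<alpha> - 2) * (f \<rho>)\<^sup>2))"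
        using True by (simp add: field_simps power_mult_distrib)
      then show ?thesis using \<kappa>_nonneg by (subst (1 2) ennreal_mult[symmetric]) auto
    qed simp
  qed
  also have "\<dots> = ennreal (\<kappa> * DIM('a) * RX * (S 1)\<^sup>2)"
    using \<kappa>_nonneg RX by (subst nn_integral_cmult) (auto simp: ennreal_mult[symmetric] mult_ac)
  finally have i: "(\<integral>\<^sup>+x. ennreal (?A (H0 x)) \<partial>lebesgue) = ennreal (\<kappa> * DIM('a) * RX * (S 1)\<^sup>2)" .
  have "(\<lambda>x. ?A (H0 x)) \<in> borel_measurable borel" by measurable
  then have "(\<lambda>x. ?A (H0 x)) \<in> borel_measurable lebesgue" by (auto intro!: measurable_completion)
  then show ?thesis unfolding eq
    by (rule has_bochner_integral_nn_integral[OF _ _ _ i]) (use \<kappa>_nonneg RX in auto)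
qed

end

text \<open>\<open>p\<close> and \<open>q\<close> are the upper parameters of the hypergeometric series and \<open>n / 2\<close> is the lower one; \<open>\<beta>\<close> stands for
  the \<open>b\<close> of the theorem. The dimension is a parameter of its own, so that the constants derived from it
  are plain functions of real numbers.\<close>

locale hardy_parameters = norm_strictly_convex H for H :: "'a::euclidean_space \<Rightarrow> real" +
  fixes n \<alpha> \<beta> :: real
  assumes n_eq: "n = real DIM('a)" and \<alpha>: "-1 < \<alpha>" "\<alpha> < 1" and \<beta>: "2 - \<alpha> \<le> \<beta>" "\<beta> < real DIM('a) + 1"
begin

definition \<gamma> :: real where "\<gamma> = (n + \<alpha> - 1) / 2"
definition \<delta> :: real where "\<delta> = (\<alpha> + \<beta> - 2) / 2"
definition p :: real where "p = (\<gamma> + \<delta>) / 2"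
definition q :: real where "q = (\<gamma> - \<delta>) / 2"

text \<open>The bound \<open>\<beta> < n + 1\<close> says that \<open>q\<close> is positive, \<open>2 - \<alpha> \<le> \<beta>\<close> that \<open>\<delta>\<close> is nonnegative, which with \<open>q > 0\<close> gives
  \<open>p > 0\<close>. The last two inequalities are \<open>\<bar>\<alpha>\<bar> < 1\<close>.\<close>

lemma params: "0 < p" "0 < q" "p + q < n / 2" "n / 2 < p + q + 1"
  using \<alpha> \<beta> by (auto simp: p_def q_def \<gamma>_def \<delta>_def n_eq[symmetric] field_simps)

lemma exponent: "p + q - n / 2 = (\<alpha> - 1) / 2"
  by (simp add: p_def q_def \<gamma>_def field_simps)

abbreviation "S N \<equiv> hyp_sum p q (n / 2) N"
abbreviation "S' N \<equiv> hyp_sum' p q (n / 2) N"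

definition test_function :: "real \<Rightarrow> nat \<Rightarrow> 'a \<times> real \<Rightarrow> real" where
  "test_function L N = polar (profile \<gamma> L) (S N)"

lemma K_const_eq: "K_const DIM('a) \<alpha> \<beta> = 2 * trace_const p q (n / 2)"
proof -
  have args: "n / 2 - p = (real DIM('a) - 2 * \<alpha> - \<beta> + 3) / 4" "n / 2 - q = (real DIM('a) + \<beta> - 1) / 4"
    "p + q - n / 2 + 1 = (\<alpha> + 1) / 2" "q = (real DIM('a) + 1 - \<beta>) / 4" "p = (real DIM('a) + 2 * \<alpha> + \<beta> - 3) / 4"
    "(real DIM('a) - 2 * \<alpha> - \<beta> + 3) / 4 - q = (1 - \<alpha>) / 2"
    by (simp_all add: p_def q_def \<gamma>_def \<delta>_def n_eq[symmetric] field_simps)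
  have "(1 - \<alpha>) / 2 \<noteq> 0" using \<alpha> by simp
  then have "Gamma ((1 - \<alpha>) / 2 + 1) = (1 - \<alpha>) / 2 * Gamma ((1 - \<alpha>) / 2)"
    using \<alpha> by (intro Gamma_plus1) (auto elim!: nonpos_Ints_cases)
  moreover have "(1 - \<alpha>) / 2 + 1 = (3 - \<alpha>) / 2" by (simp add: field_simps)
  ultimately have g: "Gamma ((3 - \<alpha>) / 2) = (1 - \<alpha>) / 2 * Gamma ((1 - \<alpha>) / 2)" by simp
  have X: "x * (A * B * C) / (x / 2 * G * D * E) = 2 * (C * A * B / (E * D * G))" if "x > 0" for x A B C D E G :: real
    using that by (simp add: field_simps)
  show ?thesis
    unfolding K_const_def trace_const_def[OF params] args(6) args(1,2,3) args(4)[symmetric] args(5)[symmetric] g by (rule X) (use \<alpha> in simp)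
qed

lemma test_function_C1c:
  assumes "L > 0"
  shows "\<exists>u' T. C1c (test_function L N) u' T"
  unfolding test_function_def
  using polar_C1c[OF profile_deriv profile'_continuous profile_outside[OF assms] exp_gt_zero hyp_sum_deriv hyp_sum_continuous(2)]
  by blast

lemma Phi_grad_test_function:
  assumes "L > 0" "z \<noteq> 0"
  shows "(Phi H (grad (test_function L N) z))\<^sup>2 = 
    (profile' \<gamma> L (Phi_dual H z))\<^sup>2 * (S N ((H0 (fst z))\<^sup>2 / (Phi_dual H z)\<^sup>2))\<^sup>2 +
    (profile \<gamma> L (Phi_dual H z) / Phi_dual H z)\<^sup>2 * (4 * (((H0 (fst z))\<^sup>2 / (Phi_dual H z)\<^sup>2) * (1 - (H0 (fst z))\<^sup>2 / (Phi_dual H z)\<^sup>2) 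
      * (S' N ((H0 (fst z))\<^sup>2 / (Phi_dual H z)\<^sup>2))\<^sup>2))"
  unfolding test_function_def
  by (rule Phi_grad_polar[OF profile_deriv profile'_continuous profile_outside[OF assms(1)] exp_gt_zero hyp_sum_deriv hyp_sum_continuous(2) assms(2)])

text \<open>By \<open>\<gamma>\<^sup>2 - \<delta>\<^sup>2 = 4 p q\<close>, the three terms with the factor \<open>X\<close> combine to \<open>2 X\<close> times the excess of the angular energy.
  Since \<open>X\<close> grows like \<open>L\<close>, an excess of \<open>1/L\<^sup>2\<close> contributes \<open>O(1/L)\<close>, as much as the cutoff does.\<close>

lemma quadratic_form_bound:
  assumes L: "L > 0" and N: "energy p q (n / 2) N \<le> trace_const p q (n / 2) * (S N 1)\<^sup>2 + 1 / L\<^sup>2"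
  shows "(LINT z|lebesgue_on halfspace. snd z powr \<alpha> * (Phi H (grad (test_function L N) z))\<^sup>2)
       - K_const DIM('a) \<alpha> \<beta> * (LINT x|lebesgue. (test_function L N (x, 0))\<^sup>2 / H0 x powr (1 - \<alpha>))
       - (\<alpha> + \<beta> - 2)\<^sup>2 / 4 *
           (LINT z|lebesgue_on halfspace. snd z powr \<alpha> * (test_function L N z)\<^sup>2 / (Phi_dual H z)\<^sup>2)
     \<le> \<kappa> * n * (16 * ((gauss p q (n / 2))\<^sup>2 * Beta (n / 2) ((\<alpha> + 1) / 2)) + 4) / L"
proof -
  obtain D X where DX: "0 \<le> D" "D \<le> 32 / L" "0 \<le> X" "X \<le> 2 * L"
    "(\<integral>\<^sup>+\<rho>. ennreal (indicator {0<..} \<rho> * (\<rho> powr (2 * \<gamma> + 1) * (profile' \<gamma> L \<rho>)\<^sup>2)) \<partial>lborel) = ennreal (D + \<gamma>\<^sup>2 * X)"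
    "(\<integral>\<^sup>+\<rho>. ennreal (indicator {0<..} \<rho> * (\<rho> powr (2 * \<gamma> - 1) * (profile \<gamma> L \<rho>)\<^sup>2)) \<partial>lborel) = ennreal X"
    using profile_integrals[OF L, of \<gamma>] by blast
  have ex: "2 * \<gamma> + 1 = n + \<alpha>" "2 * \<gamma> - 1 = n + \<alpha> - 2"
    by (simp_all add: \<gamma>_def field_simps)
  let ?w = "beta_weight (n / 2) ((\<alpha> - 1) / 2)"
  define a2 where "a2 = (LINT s|lborel. ?w s * (S N s)\<^sup>2)"
  define e1 where "e1 = (LINT s|lborel. ?w s * (s * (1 - s) * (S' N s)\<^sup>2))"
  have ce: "n / 2 > 0" "(\<alpha> - 1) / 2 > -1" using \<alpha> by (auto simp: n_eq)
  note int = beta_weight_times_continuous_integrable[OF ce]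
  have cS: "continuous_on UNIV (\<lambda>s. (S N s)\<^sup>2)" and cS': "continuous_on UNIV (\<lambda>s. s * (1 - s) * (S' N s)\<^sup>2)"
    by (intro continuous_intros hyp_sum_continuous)+
  have R2: "(\<integral>\<^sup>+\<rho>. ennreal (indicator {0<..} \<rho> * (\<rho> powr (n + \<alpha>) * (profile \<gamma> L \<rho> / \<rho>)\<^sup>2)) \<partial>lborel) = ennreal X"
    unfolding DX(6)[symmetric] ex(1)[symmetric]
  proof (rule nn_integral_cong)
    fix \<rho> :: real
    have "\<rho> powr (2 * \<gamma> + 1) * (profile \<gamma> L \<rho> / \<rho>)\<^sup>2 = \<rho> powr (2 * \<gamma> - 1) * (profile \<gamma> L \<rho>)\<^sup>2" if "\<rho> > 0"
      using that by (simp add: powr_add powr_diff power_divide power2_eq_square)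
    then show "ennreal (indicator {0<..} \<rho> * (\<rho> powr (2 * \<gamma> + 1) * (profile \<gamma> L \<rho> / \<rho>)\<^sup>2)) =
      ennreal (indicator {0<..} \<rho> * (\<rho> powr (2 * \<gamma> - 1) * (profile \<gamma> L \<rho>)\<^sup>2))"
      by (cases "\<rho> > 0") auto
  qed
  have rn: "0 \<le> D + \<gamma>\<^sup>2 * X" using DX by simp
  let ?s = "\<lambda>z. (H0 (fst z))\<^sup>2 / (Phi_dual H z)\<^sup>2"
  have I1: "has_bochner_integral (lebesgue_on halfspace)
      (\<lambda>z. snd z powr \<alpha> * ((profile' \<gamma> L (Phi_dual H z))\<^sup>2 * (S N (?s z))\<^sup>2)) (1/2 * a2 * (\<kappa> * n * (D + \<gamma>\<^sup>2 * X)))"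
    unfolding a2_def 
    by (rule polar_integral[where A="\<lambda>\<rho>. (profile' \<gamma> L \<rho>)\<^sup>2", folded n_eq, OF \<alpha>(1) _ _ DX(5)[unfolded ex] rn cS]) auto
  have I3: "has_bochner_integral (lebesgue_on halfspace)
      (\<lambda>z. snd z powr \<alpha> * ((profile \<gamma> L (Phi_dual H z) / Phi_dual H z)\<^sup>2 * (S N (?s z))\<^sup>2)) (1/2 * a2 * (\<kappa> * n * X))"
    unfolding a2_def by (rule polar_integral[where A="\<lambda>\<rho>. (profile \<gamma> L \<rho> / \<rho>)\<^sup>2", folded n_eq, OF \<alpha>(1) _ _ R2 DX(3) cS]) auto
  have I2: "has_bochner_integral (lebesgue_on halfspace)
      (\<lambda>z. snd z powr \<alpha> * ((profile \<gamma> L (Phi_dual H z) / Phi_dual H z)\<^sup>2 * (?s z * (1 - ?s z) * (S' N (?s z))\<^sup>2))) (1/2 * e1 * (\<kappa> * n * X))"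
    unfolding e1_def by (rule polar_integral[where A="\<lambda>\<rho>. (profile \<gamma> L \<rho> / \<rho>)\<^sup>2", folded n_eq, OF \<alpha>(1) _ _ R2 DX(3) cS']) auto
  have "(LINT z|lebesgue_on halfspace. snd z powr \<alpha> * (Phi H (grad (test_function L N) z))\<^sup>2) =
     (LINT z|lebesgue_on halfspace. snd z powr \<alpha> * ((profile' \<gamma> L (Phi_dual H z))\<^sup>2 * (S N (?s z))\<^sup>2)
       + 4 * (snd z powr \<alpha> * ((profile \<gamma> L (Phi_dual H z) / Phi_dual H z)\<^sup>2 * (?s z * (1 - ?s z) * (S' N (?s z))\<^sup>2))))"
  proof (rule Bochner_Integration.integral_cong[OF refl])
    fix z assume "z \<in> space (lebesgue_on (halfspace :: ('a \<times> real) set))"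
    then have "z \<noteq> 0" by (auto simp: halfspace_def space_restrict_space)
    from Phi_grad_test_function[OF L this, of N]
    show "snd z powr \<alpha> * (Phi H (grad (test_function L N) z))\<^sup>2 = snd z powr \<alpha> * ((profile' \<gamma> L (Phi_dual H z))\<^sup>2 * (S N (?s z))\<^sup>2)
       + 4 * (snd z powr \<alpha> * ((profile \<gamma> L (Phi_dual H z) / Phi_dual H z)\<^sup>2 * (?s z * (1 - ?s z) * (S' N (?s z))\<^sup>2)))"
      by (simp only: distrib_left mult.assoc mult.left_commute[of _ 4])
  qed
  also have "\<dots> = 1/2 * a2 * (\<kappa> * n * (D + \<gamma>\<^sup>2 * X)) + 4 * (1/2 * e1 * (\<kappa> * n * X))"
    by (intro has_bochner_integral_integral_eq has_bochner_integral_add has_bochner_integral_mult_right I1 I2)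
  finally have T1: "(LINT z|lebesgue_on halfspace. snd z powr \<alpha> * (Phi H (grad (test_function L N) z))\<^sup>2) =
      1/2 * a2 * (\<kappa> * n * (D + \<gamma>\<^sup>2 * X)) + 4 * (1/2 * e1 * (\<kappa> * n * X))" .
  have "(\<lambda>z. snd z powr \<alpha> * (test_function L N z)\<^sup>2 / (Phi_dual H z)\<^sup>2) =
     (\<lambda>z. snd z powr \<alpha> * ((profile \<gamma> L (Phi_dual H z) / Phi_dual H z)\<^sup>2 * (S N (?s z))\<^sup>2))"
    by (simp add: test_function_def polar_def power_mult_distrib power_divide)
  then have T3: "(LINT z|lebesgue_on halfspace. snd z powr \<alpha> * (test_function L N z)\<^sup>2 / (Phi_dual H z)\<^sup>2) = 1/2 * a2 * (\<kappa> * n * X)"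
    using has_bochner_integral_integral_eq[OF I3] by simp
  have T2: "(LINT x|lebesgue. (test_function L N (x, 0))\<^sup>2 / H0 x powr (1 - \<alpha>)) = \<kappa> * n * X * (S N 1)\<^sup>2"
    unfolding test_function_def
    by (intro has_bochner_integral_integral_eq trace_integral[folded n_eq] DX(6)[unfolded ex] DX(3)) (simp_all add: profile_def)
  have en: "energy p q (n / 2) N = e1 + p * q * a2"
  proof -
    have "energy p q (n / 2) N = (LINT s|lborel. ?w s * (s * (1 - s) * (S' N s)\<^sup>2) + p * q * (?w s * (S N s)\<^sup>2))"
      unfolding energy_def[OF params] exponent by (intro Bochner_Integration.integral_cong) (simp_all add: algebra_simps)
    also have "\<dots> = e1 + p * q * a2" unfolding e1_def a2_def
      by (subst Bochner_Integration.integral_add) (auto intro!: int cS cS' integrable_mult_right)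
    finally show ?thesis .
  qed
  have pq: "\<gamma>\<^sup>2 - \<delta>\<^sup>2 = 4 * (p * q)" by (simp add: p_def q_def power2_eq_square field_simps)
  have \<delta>2: "(\<alpha> + \<beta> - 2)\<^sup>2 / 4 = \<delta>\<^sup>2" by (simp add: \<delta>_def power_divide)
  have a2: "a2 \<le> (gauss p q (n / 2))\<^sup>2 * Beta (n / 2) ((\<alpha> + 1) / 2)"
  proof -
    have "a2 \<le> (LINT s|lborel. (gauss p q (n / 2))\<^sup>2 * ?w s)" unfolding a2_def
    proof (intro integral_mono int cS)
      show "integrable lborel (\<lambda>s. (gauss p q (n / 2))\<^sup>2 * ?w s)"
        using beta_weight_has_integral(1)[OF ce] by simp
      fix s
      show "?w s * (S N s)\<^sup>2 \<le> (gauss p q (n / 2))\<^sup>2 * ?w s"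
      proof (cases "s \<in> {0<..<1}")
        case True
        have "S N s \<le> gauss p q (n / 2)"
          using hyp_sum_mono[OF params, of s N] hyp_sum_le_gauss[OF params, of N] True by simp
        moreover have "0 \<le> S N s" using hyp_sum_ge_1[OF params, of s N] True by simp
        ultimately have "(S N s)\<^sup>2 \<le> (gauss p q (n / 2))\<^sup>2" by (intro power_mono)
        then show ?thesis using beta_weight_nonneg by (simp add: mult.commute mult_left_mono)
      qed (simp add: beta_weight_def)
    qed
    also have "\<dots> = (gauss p q (n / 2))\<^sup>2 * Beta (n / 2) ((\<alpha> - 1) / 2 + 1)"
      using beta_weight_has_integral(2)[OF ce] by simp
    also have "(\<alpha> - 1) / 2 + 1 = (\<alpha> + 1) / 2" by (simp add: field_simps)
    finally show ?thesis .
  qed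
  have a20: "0 \<le> a2" unfolding a2_def by (simp add: beta_weight_nonneg)
  let ?E = "energy p q (n / 2) N - trace_const p q (n / 2) * (S N 1)\<^sup>2"
  have "(1/2 * a2 * (\<kappa> * n * (D + \<gamma>\<^sup>2 * X)) + 4 * (1/2 * e1 * (\<kappa> * n * X)))
      - 2 * trace_const p q (n / 2) * (\<kappa> * n * X * (S N 1)\<^sup>2) - \<delta>\<^sup>2 * (1/2 * a2 * (\<kappa> * n * X))
    = \<kappa> * n * (1/2 * a2 * D + X * (1/2 * (\<gamma>\<^sup>2 - \<delta>\<^sup>2) * a2 + 2 * e1 - 2 * (trace_const p q (n / 2) * (S N 1)\<^sup>2)))"
    by (simp add: algebra_simps)
  also have "\<dots> = \<kappa> * n * (1/2 * (a2 * D) + 2 * (X * ?E))"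
    unfolding pq en by (simp add: algebra_simps)
  also have "\<dots> \<le> \<kappa> * n * (1/2 * ((gauss p q (n / 2))\<^sup>2 * Beta (n / 2) ((\<alpha> + 1) / 2) * (32 / L)) + 2 * (2 * L * (1 / L\<^sup>2)))"
  proof (intro mult_left_mono add_mono)
    show "a2 * D \<le> (gauss p q (n / 2))\<^sup>2 * Beta (n / 2) ((\<alpha> + 1) / 2) * (32 / L)"
      by (rule mult_mono'[OF a2 DX(2) a20 DX(1)])
    have "X * ?E \<le> X * (1 / L\<^sup>2)" using N DX(3) by (intro mult_left_mono) auto
    also have "\<dots> \<le> 2 * L * (1 / L\<^sup>2)" using DX(4) by (intro mult_right_mono) auto
    finally show "X * ?E \<le> 2 * L * (1 / L\<^sup>2)" .
  qed (use \<kappa>_nonneg in \<open>auto simp: n_eq\<close>)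
  also have "\<dots> = \<kappa> * n * (16 * ((gauss p q (n / 2))\<^sup>2 * Beta (n / 2) ((\<alpha> + 1) / 2)) + 4) / L"
    using L by (simp add: field_simps power2_eq_square)
  finally show ?thesis unfolding T1 T2 T3 K_const_eq \<delta>2 .
qed

lemma quadratic_form_tends_to_0:
  "\<exists>C N. \<forall>L>0.
      (LINT z|lebesgue_on halfspace. snd z powr \<alpha> * (Phi H (grad (test_function L (N L)) z))\<^sup>2)
       - K_const DIM('a) \<alpha> \<beta> * (LINT x|lebesgue. (test_function L (N L) (x, 0))\<^sup>2 / H0 x powr (1 - \<alpha>))
       - (\<alpha> + \<beta> - 2)\<^sup>2 / 4 *
           (LINT z|lebesgue_on halfspace. snd z powr \<alpha> * (test_function L (N L) z)\<^sup>2 / (Phi_dual H z)\<^sup>2) \<le> C / L"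
proof -
  have "\<exists>N. energy p q (n / 2) N \<le> trace_const p q (n / 2) * (S N 1)\<^sup>2 + 1 / L\<^sup>2" if "L > 0" for L
    by (rule energy_nearly_minimal[OF params]) (use that in simp)
  then obtain N where "\<And>L. L > 0 \<Longrightarrow> energy p q (n / 2) (N L) \<le> trace_const p q (n / 2) * (S (N L) 1)\<^sup>2 + 1 / L\<^sup>2"
    by metis
  then show ?thesis using quadratic_form_bound by blast
qed

lemma test_function_in_D12:
  assumes "L > 0"
  shows "in_D12 \<alpha> (test_function L N) (grad (test_function L N)) (\<lambda>x. test_function L N (x, 0))"
  using test_function_C1c[OF assms] C1c_in_D12[OF _ \<alpha>(1)] by blast

text \<open>The cutoffs increase with \<open>L\<close> and the partial sums are at least one, so the test functions for
  large \<open>L\<close> dominate a fixed one, whatever order the partial sums have.\<close>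

lemma test_function_lower_bound:
  assumes "0 < L" "L \<le> L'"
  shows "0 \<le> test_function L 0 z" "test_function L 0 z \<le> test_function L' N z"
proof -
  have S0: "S 0 s = 1" for s by (simp add: hyp_sum_def hyp_term_def)
  show "0 \<le> test_function L 0 z" by (simp add: test_function_def polar_def S0 profile_nonneg)
  have "profile \<gamma> L (Phi_dual H z) * 1 \<le> profile \<gamma> L' (Phi_dual H z) * S N ((H0 (fst z))\<^sup>2 / (Phi_dual H z)\<^sup>2)"
    by (intro mult_mono profile_mono assms hyp_sum_ge_1[OF params] profile_nonneg) auto
  then show "test_function L 0 z \<le> test_function L' N z" by (simp add: test_function_def polar_def S0)
qed

lemma test_function_pos:
  assumes "0 < L" "z \<noteq> 0" "\<bar>ln (Phi_dual H z)\<bar> < L"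
  shows "0 < test_function L 0 z"
  using profile_pos[OF assms(1,3) Phi_dual_pos[OF assms(2)], of \<gamma>]
  by (simp add: test_function_def polar_def hyp_sum_def hyp_term_def)

end

theorem mainTheorem4:
  fixes H :: "real^'n \<Rightarrow> real" and \<alpha> b :: real
  assumes "is_norm H"
    and "C_k_on 2 H (- {0})"
    and "strictly_convex (\<lambda>\<xi>. (H \<xi>)\<^sup>2)"
    and "-1 < \<alpha>" and "\<alpha> < 1"
    and "2 - \<alpha> \<le> b" and "b < real CARD('n) + 1"
  shows "\<not> (\<exists>(C::real) (V::(real^'n) \<times> real \<Rightarrow> real) (p::real).
              0 < C \<and> nontrivial_potential V \<and> 0 < p \<and>
              (\<forall>u Du u0. in_D12 \<alpha> u Du u0 \<longrightarrow> improved_inequality H \<alpha> b C V p u Du u0))"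
proof
  interpret hardy_parameters H "real CARD('n)" \<alpha> b
    by unfold_locales (use assms in auto)
  let ?\<mu> = "lebesgue_on (halfspace :: ((real^'n) \<times> real) set)"
  assume "\<exists>(C::real) (V::(real^'n) \<times> real \<Rightarrow> real) (p::real).
              0 < C \<and> nontrivial_potential V \<and> 0 < p \<and>
              (\<forall>u Du u0. in_D12 \<alpha> u Du u0 \<longrightarrow> improved_inequality H \<alpha> b C V p u Du u0)"
  then obtain C V e where C: "0 < C" and V: "nontrivial_potential V" and e: "0 < e" and
    ineq: "\<And>u Du u0. in_D12 \<alpha> u Du u0 \<Longrightarrow> improved_inequality H \<alpha> b C V e u Du u0" by blast
  let ?u = test_function
  obtain M N where M: "\<And>L. L > 0 \<Longrightarrow>
      (LINT z|?\<mu>. snd z powr \<alpha> * (Phi H (grad (?u L (N L)) z))\<^sup>2)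
       - K_const CARD('n) \<alpha> b * (LINT x|lebesgue. (?u L (N L) (x, 0))\<^sup>2 / H0 x powr (1 - \<alpha>))
       - (\<alpha> + b - 2)\<^sup>2 / 4 * (LINT z|?\<mu>. snd z powr \<alpha> * (?u L (N L) z)\<^sup>2 / (Phi_dual H z)\<^sup>2) \<le> M / L"
  proof -
    have "DIM(real^'n) = CARD('n)" by simp
    from quadratic_form_tends_to_0[unfolded this] that show ?thesis by blast
  qed
  have V0: "0 \<le> V z" if "z \<in> space ?\<mu>" for z
    using V that by (auto simp: nontrivial_potential_def space_restrict_space)
  have int: "integrable ?\<mu> (\<lambda>z. V z * \<bar>?u L N z\<bar> powr e)" if "L > 0" for L N
    using ineq[OF test_function_in_D12[OF that]] by (simp add: improved_inequality_def)
  have zero: "AE z in ?\<mu>. V z * \<bar>?u L 0 z\<bar> powr e = 0" if L: "L > 0" for L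
  proof -
    let ?I = "LINT z|?\<mu>. V z * \<bar>?u L 0 z\<bar> powr e"
    have nn: "0 \<le> V z * \<bar>?u L 0 z\<bar> powr e" if "z \<in> space ?\<mu>" for z using V0[OF that] by simp
    have I0: "0 \<le> ?I" by (intro Bochner_Integration.integral_nonneg) (use nn in auto)
    have le: "C * ?I powr (2 / e) \<le> M / L'" if L': "L \<le> L'" for L'
    proof -
      have L'0: "L' > 0" using L L' by simp
      have "?I \<le> (LINT z|?\<mu>. V z * \<bar>?u L' (N L') z\<bar> powr e)"
      proof (intro integral_mono int L L'0)
        fix z assume z: "z \<in> space ?\<mu>"
        have "\<bar>?u L 0 z\<bar> powr e \<le> \<bar>?u L' (N L') z\<bar> powr e"
        proof (rule powr_mono2)
          show "\<bar>?u L 0 z\<bar> \<le> \<bar>?u L' (N L') z\<bar>"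
            using test_function_lower_bound(1)[OF L L', of z] test_function_lower_bound(2)[OF L L', of z "N L'"] by linarith
        qed (use e in auto)
        then show "V z * \<bar>?u L 0 z\<bar> powr e \<le> V z * \<bar>?u L' (N L') z\<bar> powr e"
          using V0[OF z] by (rule mult_left_mono)
      qed
      then have "C * ?I powr (2 / e) \<le> C * (LINT z|?\<mu>. V z * \<bar>?u L' (N L') z\<bar> powr e) powr (2 / e)"
        using C e I0 by (intro mult_left_mono powr_mono2) auto
      also have "\<dots> \<le> M / L'"
        using ineq[OF test_function_in_D12[OF L'0, of "N L'"]] M[OF L'0] by (simp add: improved_inequality_def)
      finally show ?thesis .
    qed
    have "?I = 0"
    proof (rule ccontr)
      assume "?I \<noteq> 0"
      then have x: "0 < C * ?I powr (2 / e)" (is "0 < ?x") using C I0 by simp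
      \<comment> \<open>This cutoff length makes \<open>M / L'\<close> smaller than the left-hand side.\<close>
      define L' where "L' = max L ((\<bar>M\<bar> + 1) / ?x)"
      have "(\<bar>M\<bar> + 1) / ?x \<le> L'" by (simp add: L'_def)
      then have "\<bar>M\<bar> + 1 \<le> L' * ?x" using x by (simp add: pos_divide_le_eq)
      moreover have "?x \<le> M / L'" by (rule le) (simp add: L'_def)
      then have "?x * L' \<le> M" using L by (simp add: pos_le_divide_eq L'_def)
      ultimately show False by (simp add: mult.commute)
    qed
    moreover have "AE z in ?\<mu>. 0 \<le> V z * \<bar>?u L 0 z\<bar> powr e" by (intro AE_I2 nn)
    ultimately show ?thesis using integral_nonneg_eq_0_iff_AE[OF int[OF L, of 0]] by blast
  qed
  \<comment> \<open>Every point of the half-space is in the region where the test function is positive, once \<open>L\<close> is large.\<close>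
  have "AE z in ?\<mu>. \<forall>k. V z * \<bar>?u (real (Suc k)) 0 z\<bar> powr e = 0"
    unfolding AE_all_countable by (intro allI zero) simp
  then have "AE z in ?\<mu>. V z = 0"
  proof (rule AE_mp, intro AE_I2 impI)
    fix z assume z: "z \<in> space ?\<mu>" and *: "\<forall>k. V z * \<bar>?u (real (Suc k)) 0 z\<bar> powr e = 0"
    obtain k where k: "\<bar>ln (Phi_dual H z)\<bar> < real k" using reals_Archimedean2 by blast
    have "z \<noteq> 0" using z by (auto simp: halfspace_def space_restrict_space)
    then have "0 < ?u (real (Suc k)) 0 z" by (intro test_function_pos) (use k in auto)
    then show "V z = 0" using *[rule_format, of k] by auto
  qed
  then show False using V by (simp add: nontrivial_potential_def)
qed

end
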